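(* Let $A$ be a densely defined operator on a complex Banach space $X$ such that $\sigma(A)\subset\{\Re z\ge0\}$ and $\sup_{\alpha>0}\alpha\int_{\mathbb{R}}|\langle(\alpha+i\beta+A)^{-2}x,x^*\rangle|\,d\beta<\infty$ for all $x\in X$, $x^*\in X^*$. Let $(f_n)_{n\ge1}\subset\mathcal{B}$ with $\sup_{n}\|f_n\|_{\mathcal{B}}<\infty$. Assume that for every $z\in\mathbb{C}_+$ the limit $f_0(z):=\lim_{n\to\infty}f_n(z)\in\mathbb{C}$ exists, and that for every $r>0$, \[\lim_{\delta\to0+}\int_0^\delta\sup_{|\beta|\le r}|f_n'(\alpha+i\beta)|\,d\alpha=0\] uniformly in $n$. Let $g$ be holomorphic on $\mathbb{C}_+$ with $g'\in H^1(\mathbb{C}_+)$ and $g(\infty)=0$, and let $g_n:=f_ng$ for $n\ge0$. Then $f_0\in\mathcal{B}$, $g_n\in\mathcal{B}_0$ for all $n\ge0$, and $\lim_{n\to\infty}\|g_n(A)-g_0(A)\|=0$.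
   Context: $\mathbb{C}_+=\{z:\Re z>0\}$. $\mathcal{B}$ is the space of holomorphic $f:\mathbb{C}_+\to\mathbb{C}$ with $\int_0^\infty\sup_{y\in\mathbb{R}}|f'(x+iy)|\,dx<\infty$, with norm $\|f\|_{\mathcal{B}}=\sup_{\mathbb{C}_+}|f|+\int_0^\infty\sup_{y}|f'(x+iy)|\,dx$; $f(\infty):=\lim_{\Re z\to\infty}f(z)$ (exists for $f\in\mathcal{B}$), and $\mathcal{B}_0=\{f\in\mathcal{B}:f(\infty)=0\}$. $H^1(\mathbb{C}_+)$ is the Hardy space of holomorphic $h$ on $\mathbb{C}_+$ with $\sup_{x>0}\int_{\mathbb{R}}|h(x+iy)|\,dy<\infty$. For $f\in\mathcal{B}$, the bounded operator $f(A)$ is defined by $\langle f(A)x,x^*\rangle=f(\infty)\langle x,x^*\rangle-\frac{2}{\pi}\int_0^\infty\alpha\int_{\mathbb{R}}\langle(\alpha-i\beta+A)^{-2}x,x^*\rangle f'(\alpha+i\beta)\,d\beta\,d\alpha$ for $x\in X,x^*\in X^*$ (the $\mathcal{B}$-calculus, a bounded algebra homomorphism $\mathcal{B}\to L(X)$). *)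

theory Defs
  imports "HOL-Analysis.Analysis" "HOL-Complex_Analysis.Complex_Analysis"
begin

text \<open>
  HOL has no class of complex normed vector spaces.  A complex Banach space is
  modelled as a real Banach space (type class banach) together with a complex
  structure J (multiplication by the imaginary unit), compatible with the norm:
  the norm of e^{it} x equals the norm of x for all real t.
\<close>

definition complex_structure :: "('a::banach \<Rightarrow> 'a) \<Rightarrow> bool" where
  "complex_structure J \<longleftrightarrow> bounded_linear J \<and> (\<forall>x. J (J x) = - x) \<and>
     (\<forall>t x. norm (cos t *\<^sub>R x + sin t *\<^sub>R J x) = norm x)"

definition cscale :: "('a::banach \<Rightarrow> 'a) \<Rightarrow> complex \<Rightarrow> 'a \<Rightarrow> 'a" where
  "cscale J c x = Re c *\<^sub>R x + Im c *\<^sub>R J x"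

definition cbounded :: "('a::banach \<Rightarrow> 'a) \<Rightarrow> ('a \<Rightarrow> 'a) \<Rightarrow> bool" where
  "cbounded J T \<longleftrightarrow> bounded_linear T \<and> (\<forall>x. T (J x) = J (T x))"

definition cdual :: "('a::banach \<Rightarrow> 'a) \<Rightarrow> ('a \<Rightarrow> complex) \<Rightarrow> bool" where
  "cdual J \<phi> \<longleftrightarrow> bounded_linear \<phi> \<and> (\<forall>x. \<phi> (J x) = \<i> * \<phi> x)"

definition clinear_op :: "('a::banach \<Rightarrow> 'a) \<Rightarrow> 'a set \<Rightarrow> ('a \<Rightarrow> 'a) \<Rightarrow> bool" where
  "clinear_op J D A \<longleftrightarrow> 0 \<in> D \<and> (\<forall>x\<in>D. \<forall>y\<in>D. x + y \<in> D \<and> A (x + y) = A x + A y) \<and>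
     (\<forall>c. \<forall>x\<in>D. cscale J c x \<in> D \<and> A (cscale J c x) = cscale J c (A x))"

definition densely_defined :: "('a::banach \<Rightarrow> 'a) \<Rightarrow> 'a set \<Rightarrow> ('a \<Rightarrow> 'a) \<Rightarrow> bool" where
  "densely_defined J D A \<longleftrightarrow> clinear_op J D A \<and> closure D = UNIV"

definition is_bdd_inverse :: "('a::banach \<Rightarrow> 'a) \<Rightarrow> 'a set \<Rightarrow> ('a \<Rightarrow> 'a) \<Rightarrow> ('a \<Rightarrow> 'a) \<Rightarrow> bool" where
  "is_bdd_inverse J D B R \<longleftrightarrow> cbounded J R \<and> (\<forall>x. R x \<in> D \<and> B (R x) = x) \<and> (\<forall>x\<in>D. R (B x) = x)"

definition bdd_inverse :: "('a::banach \<Rightarrow> 'a) \<Rightarrow> 'a set \<Rightarrow> ('a \<Rightarrow> 'a) \<Rightarrow> 'a \<Rightarrow> 'a" where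
  "bdd_inverse J D B = (THE R. is_bdd_inverse J D B R)"

definition op_spectrum :: "('a::banach \<Rightarrow> 'a) \<Rightarrow> 'a set \<Rightarrow> ('a \<Rightarrow> 'a) \<Rightarrow> complex set" where
  "op_spectrum J D A = {w. \<not> (\<exists>R. is_bdd_inverse J D (\<lambda>x. cscale J w x - A x) R)}"

definition res_plus :: "('a::banach \<Rightarrow> 'a) \<Rightarrow> 'a set \<Rightarrow> ('a \<Rightarrow> 'a) \<Rightarrow> complex \<Rightarrow> 'a \<Rightarrow> 'a" where
  "res_plus J D A z = bdd_inverse J D (\<lambda>x. cscale J z x + A x)"

definition res_plus2 :: "('a::banach \<Rightarrow> 'a) \<Rightarrow> 'a set \<Rightarrow> ('a \<Rightarrow> 'a) \<Rightarrow> complex \<Rightarrow> 'a \<Rightarrow> 'a" where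
  "res_plus2 J D A z = res_plus J D A z \<circ> res_plus J D A z"

definition RHP :: "complex set" where
  "RHP = {z. 0 < Re z}"

definition at_inf_val :: "(complex \<Rightarrow> complex) \<Rightarrow> complex" where
  "at_inf_val f = Lim (filtercomap Re at_top) f"

definition B_seminorm :: "(complex \<Rightarrow> complex) \<Rightarrow> ennreal" where
  "B_seminorm f = (\<integral>\<^sup>+ x\<in>{0<..}. (SUP y. ennreal (cmod (deriv f (Complex x y)))) \<partial>lborel)"

definition B_space :: "(complex \<Rightarrow> complex) set" where
  "B_space = {f. f holomorphic_on RHP \<and> B_seminorm f < top }"

definition B_norm :: "(complex \<Rightarrow> complex) \<Rightarrow> ennreal" where
  "B_norm f = (SUP z\<in>RHP. ennreal (cmod (f z))) + B_seminorm f"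

definition B0_space :: "(complex \<Rightarrow> complex) set" where
  "B0_space = {f \<in> B_space. at_inf_val f = 0}"

definition H1_space :: "(complex \<Rightarrow> complex) set" where
  "H1_space = {h. h holomorphic_on RHP \<and>
     (SUP x\<in>{0<..}. \<integral>\<^sup>+ y. ennreal (cmod (h (Complex x y))) \<partial>lborel) < top }"

definition B_calc :: "('a::banach \<Rightarrow> 'a) \<Rightarrow> 'a set \<Rightarrow> ('a \<Rightarrow> 'a) \<Rightarrow> (complex \<Rightarrow> complex) \<Rightarrow> 'a \<Rightarrow> 'a" where
  "B_calc J D A f = (THE T. cbounded J T \<and> (\<forall>x \<phi>. cdual J \<phi> \<longrightarrow>
      \<phi> (T x) = at_inf_val f * \<phi> x
        - complex_of_real (2 / pi) *
          (LINT \<alpha>:{0<..}|lborel. complex_of_real \<alpha> *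
             (LINT \<beta>|lborel. \<phi> (res_plus2 J D A (Complex \<alpha> (- \<beta>)) x) * deriv f (Complex \<alpha> \<beta>)))))"

end

theory Submission
  imports Defs
begin

text \<open>
  On the subspace of functions vanishing at infinity the calculus is bounded by the seminorm
  \<open>f \<mapsto> \<integral>\<^sub>0\<^sup>\<infinity> sup\<^sub>y \<bar>f'(x + iy)\<bar> dx\<close>: two applications of Baire's theorem turn the pointwise
  resolvent condition into \<open>\<alpha> \<integral> \<bar>\<langle>(\<alpha> + i\<beta> + A)\<^sup>-\<^sup>2 x, \<phi>\<rangle>\<bar> d\<beta> \<le> K \<parallel>x\<parallel> \<parallel>\<phi>\<parallel>\<close>. It therefore suffices that
  \<open>f\<^sub>n g \<rightarrow> f\<^sub>0 g\<close> in this seminorm. The decisive fact is that \<open>h = g' \<in> H\<^sup>1\<close> satisfies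
  \<open>\<integral>\<^sub>0\<^sup>\<infinity> sup\<^sub>y \<bar>h(x + iy)\<bar> dx < \<infinity>\<close> (a Carleson embedding, proved with P. Jones' interpolating
  exponentials on dyadic strips). It makes \<open>g\<close> vanish at infinity uniformly in the whole half-plane, so that
  \<open>(f\<^sub>n - f\<^sub>0) g'\<close> is handled by dominated convergence, and \<open>(f\<^sub>n' - f\<^sub>0') g\<close> by locally uniform
  convergence away from the imaginary axis and the uniform smallness hypothesis near it.

  The operator representing the weak integral exists in the space itself, not only in the bidual: on the
  dense range of \<open>(1 + A)\<^sup>-\<^sup>2\<close> truncated norm integrals converge, uniformly in the functional.
\<close>


section \<open>Functionals and uniform boundedness\<close>

text \<open>The difficulty sits at both ends of the integral over x. Cauchy's inequality only gives
  |g'(z)| \<le> 2 M / Re z, whose integral diverges logarithmically at 0 and at infinity. What the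
  exponential factors buy is a bound over [2^-m, 2^m) that is independent of m. The work is done on
  a line Re z = \<delta> > 0, where g' is bounded, and the final constant is free of \<delta>.

  Locally uniform convergence alone does not make the seminorm converge: the mass of f_n' may escape
  to the imaginary axis or to infinity. The uniform hypothesis prevents the former at bounded
  heights, and the decay of g absorbs everything else.

  On the operator side functionals are plain functions, so uniform boundedness over them is proved
  in the Banach space of real bounded functionals and carried over by \<open>complexify\<close>.
  Estimates are kept proportional to an explicit bound k of the functional, which is what turns weak
  estimates into norm estimates. Since \<open>B_calc\<close> is a definite description, existence
  and uniqueness of the operator must precede any estimate of it.\<close>

definition sublinear :: "('a::real_vector \<Rightarrow> real) \<Rightarrow> bool" where
  "sublinear p \<longleftrightarrow> (\<forall>x y. p (x + y) \<le> p x + p y) \<and> (\<forall>c x. 0 \<le> c \<longrightarrow> p (c *\<^sub>R x) \<le> c * p x)"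

lemma sublinear_zero: "p 0 = 0" if "sublinear p"
proof -
  have "p (0 + 0) \<le> p 0 + p 0" "p (0 *\<^sub>R 0) \<le> 0 * p 0"
    using that unfolding sublinear_def by blast+
  then show ?thesis by simp
qed

lemma sublinear_lower: "- p (- x) \<le> p x" if "sublinear p"
proof -
  have "p (x + - x) \<le> p x + p (- x)"
    using that unfolding sublinear_def by blast
  then show ?thesis using sublinear_zero[OF that] by simp
qed

text \<open>Only an inequality is required in \<open>sublinear\<close>, because that is what
  survives infima; applying it to \<open>inverse c\<close> gives the other half.\<close>

lemma sublinear_scale: "sublinear p \<Longrightarrow> 0 < c \<Longrightarrow> p (c *\<^sub>R x) = c * p x"
proof (rule antisym)
  assume p: "sublinear p" and c: "0 < c"
  show "p (c *\<^sub>R x) \<le> c * p x"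
    using p c by (simp add: sublinear_def)
  have "p (inverse c *\<^sub>R (c *\<^sub>R x)) \<le> inverse c * p (c *\<^sub>R x)"
    using p c unfolding sublinear_def by (meson inverse_nonnegative_iff_nonnegative less_imp_le)
  then show "c * p x \<le> p (c *\<^sub>R x)"
    using c by (simp add: field_simps)
qed

text \<open>The classical Hahn-Banach modification of p in the direction y: t = 0 gives the first
  bound on q, t = 1 the second. The infimum is finite because t p(y) = p(ty) \<le> p(x + ty) +
  p(-x).\<close>

lemma sublinear_shift:
  fixes p :: "'a::real_vector \<Rightarrow> real"
  assumes p: "sublinear p"
  obtains q where "sublinear q" "\<And>x. q x \<le> p x" "\<And>x. q x \<le> p (x + y) - p y"
proof
  define q where "q x = (INF t\<in>{0..}. p (x + t *\<^sub>R y) - t * p y)" for x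
  have add: "p (u + v) \<le> p u + p v" and sc: "0 \<le> c \<Longrightarrow> p (c *\<^sub>R u) \<le> c * p u" for u v c
    using p by (auto simp: sublinear_def)
  have lb: "- p (- x) \<le> p (x + t *\<^sub>R y) - t * p y" if "0 \<le> t" for x t
    using add[of "x + t *\<^sub>R y" "- x"] sublinear_scale[OF p, of t y] that sublinear_zero[OF p]
    by (cases "t = 0") auto
  have bdd: "bdd_below ((\<lambda>t. p (x + t *\<^sub>R y) - t * p y) ` {0..})" for x
    using lb by (intro bdd_belowI2[of _ "- p (- x)"]) auto
  have qle: "q x \<le> p (x + t *\<^sub>R y) - t * p y" if "0 \<le> t" for x t
    unfolding q_def using that by (intro cINF_lower[OF bdd]) auto
  show "q x \<le> p x" for x
    using qle[of 0 x] by simp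
  show "q x \<le> p (x + y) - p y" for x
    using qle[of 1 x] by simp
  show "sublinear q"
    unfolding sublinear_def
  proof (intro conjI allI impI)
    fix u v
    have *: "q (u + v) - (p (u + s *\<^sub>R y) - s * p y) \<le> p (v + t *\<^sub>R y) - t * p y"
      if "0 \<le> s" "0 \<le> t" for s t
      using qle[of "s + t" "u + v"] add[of "u + s *\<^sub>R y" "v + t *\<^sub>R y"] that
      by (simp add: algebra_simps)
    have "q (u + v) - (p (u + s *\<^sub>R y) - s * p y) \<le> q v" if "0 \<le> s" for s
      unfolding q_def[of v] using *[OF that] by (intro cINF_greatest) auto
    then have "q (u + v) - q v \<le> q u"
      unfolding q_def[of u] by (intro cINF_greatest) (auto simp: algebra_simps)
    then show "q (u + v) \<le> q u + q v" by simp
  next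
    fix c :: real and x assume "0 \<le> c"
    show "q (c *\<^sub>R x) \<le> c * q x"
    proof (cases "c = 0")
      case True
      then show ?thesis using qle[of 0 0] sublinear_zero[OF p] by simp
    next
      case False
      then have c: "0 < c" using \<open>0 \<le> c\<close> by simp
      have "q (c *\<^sub>R x) / c \<le> p (x + t *\<^sub>R y) - t * p y" if "0 \<le> t" for t
      proof -
        have "q (c *\<^sub>R x) \<le> p (c *\<^sub>R (x + t *\<^sub>R y)) - (c * t) * p y"
          using qle[of "c * t" "c *\<^sub>R x"] c that by (simp add: scaleR_add_right)
        also have "\<dots> \<le> c * (p (x + t *\<^sub>R y) - t * p y)"
          using sc[of c "x + t *\<^sub>R y"] c by (simp add: algebra_simps)
        finally show ?thesis using c by (simp add: field_simps)
      qed
      then have "q (c *\<^sub>R x) / c \<le> q x"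
        unfolding q_def[of x] by (intro cINF_greatest) auto
      then show ?thesis using c by (simp add: field_simps)
    qed
  qed
qed

text \<open>A minimal sublinear functional is linear, since shifting it does not decrease it.\<close>

lemma sublinear_dominates_linear:
  fixes p :: "'a::real_vector \<Rightarrow> real"
  assumes p: "sublinear p"
  obtains m where "linear m" "\<And>x. m x \<le> p x"
proof -
  define S where "S = {q. sublinear q \<and> (\<forall>x. q x \<le> p x)}"
  \<comment> \<open>The order is reversed, so the maximal element delivered by Zorn's lemma is a
    pointwise minimal functional.\<close>
  define P where "P = (\<lambda>a b :: 'a \<Rightarrow> real. b \<le> a)"
  have "\<exists>m \<in> S. \<forall>a \<in> S. P m a \<longrightarrow> a = m"
  proof (rule predicate_Zorn)
    show "partial_order_on S (relation_of P S)"
      by (rule partial_order_on_relation_ofI) (auto simp: P_def)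
    fix C assume C: "C \<in> Chains (relation_of P S)"
    have CS: "C \<subseteq> S" and total: "\<And>a b. a \<in> C \<Longrightarrow> b \<in> C \<Longrightarrow> a \<le> b \<or> b \<le> a"
      using C unfolding Chains_def relation_of_def P_def by blast+
    show "\<exists>u\<in>S. \<forall>a\<in>C. P a u"
    proof (cases "C = {}")
      case True
      then show ?thesis using p by (auto simp: S_def)
    next
      case False
      define u where "u x = (INF a\<in>C. a x)" for x
      have sub: "sublinear a" "a x \<le> p x" if "a \<in> C" for a x
        using that CS by (auto simp: S_def)
      have bdd: "bdd_below ((\<lambda>a. a x) ` C)" for x
      proof (intro bdd_belowI2[of _ "- p (- x)"])
        fix a assume "a \<in> C"
        then show "- p (- x) \<le> a x"
          using sublinear_lower[OF sub(1)[of a], of x] sub(2)[of a "- x"] by simp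
      qed
      have ule: "u x \<le> a x" if "a \<in> C" for a x
        unfolding u_def using that by (intro cINF_lower[OF bdd]) auto
      have "sublinear u"
        unfolding sublinear_def
      proof (intro conjI allI impI)
        fix x y
        have *: "u (x + y) - a x \<le> b y" if ab: "a \<in> C" "b \<in> C" for a b
        proof -
          have "\<exists>c\<in>C. c \<le> a \<and> c \<le> b" using total[OF ab] ab by auto
          then obtain c where c: "c \<in> C" "c \<le> a" "c \<le> b" by blast
          have "u (x + y) \<le> c (x + y)" by (rule ule[OF c(1)])
          also have "\<dots> \<le> c x + c y" using sub(1)[OF c(1)] by (simp add: sublinear_def)
          also have "\<dots> \<le> a x + b y" using c by (simp add: le_fun_def add_mono)
          finally show ?thesis by simp
        qed
        have "u (x + y) - a x \<le> u y" if "a \<in> C" for a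
          unfolding u_def[of y] using *[OF that] False by (intro cINF_greatest) auto
        then have "u (x + y) - u y \<le> u x"
          unfolding u_def[of x] using False by (intro cINF_greatest) (auto simp: algebra_simps)
        then show "u (x + y) \<le> u x + u y" by simp
      next
        fix c :: real and x assume c: "0 \<le> c"
        have uc: "u (c *\<^sub>R x) \<le> c * a x" if "a \<in> C" for a
          using ule[OF that, of "c *\<^sub>R x"] sub(1)[OF that] c unfolding sublinear_def
          by (meson order_trans)
        show "u (c *\<^sub>R x) \<le> c * u x"
        proof (cases "c = 0")
          case True
          then show ?thesis using uc False by auto
        next
          case c0: False
          then have "u (c *\<^sub>R x) / c \<le> u x"
            unfolding u_def[of x] using uc c False
            by (intro cINF_greatest) (auto simp: field_simps)
          then show ?thesis using c c0 by (simp add: field_simps)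
        qed
      qed
      moreover have "u x \<le> p x" for x
      proof -
        obtain a where "a \<in> C" using False by blast
        then show ?thesis using ule[of a x] sub(2)[of a x] by simp
      qed
      ultimately have "u \<in> S" by (simp add: S_def)
      then show ?thesis using ule by (auto simp: P_def le_fun_def)
    qed
  qed
  then obtain m where mS: "m \<in> S" and mmin: "\<And>a. a \<in> S \<Longrightarrow> a \<le> m \<Longrightarrow> a = m"
    unfolding P_def by blast
  have m: "sublinear m" "\<And>x. m x \<le> p x"
    using mS by (auto simp: S_def)
  have min: "a = m" if "sublinear a" "\<And>x. a x \<le> m x" for a
    using that m by (intro mmin) (auto simp: S_def le_fun_def intro: order_trans)
  have add: "m (x + y) = m x + m y" for x y
  proof -
    obtain q where q: "sublinear q" "\<And>x. q x \<le> m x" "\<And>x. q x \<le> m (x + y) - m y"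
      using sublinear_shift[OF m(1)] by blast
    have "q = m" by (rule min) (use q in auto)
    then have "m x \<le> m (x + y) - m y" using q(3)[of x] by simp
    moreover have "m (x + y) \<le> m x + m y" using m(1) by (simp add: sublinear_def)
    ultimately show ?thesis by simp
  qed
  have neg: "m (- x) = - m x" for x
    using add[of x "- x"] sublinear_zero[OF m(1)] by simp
  have "m (c *\<^sub>R x) = c * m x" for c x
  proof (cases "c < 0")
    case True
    then show ?thesis using sublinear_scale[OF m(1), of "- c" x] neg[of "c *\<^sub>R x"] by simp
  next
    case False
    then show ?thesis
      using sublinear_scale[OF m(1), of c x] sublinear_zero[OF m(1)] by (cases "c = 0") auto
  qed
  then have "linear m" by (intro linearI) (auto simp: add)
  then show thesis using m(2) by (rule that)
qed

text \<open>Shifting the norm along x before passing to a linear minorant forces m(-x) \<le> - norm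
  x, so the minorant attains the norm at x.\<close>

lemma norming_functional:
  fixes x :: "'a::real_normed_vector"
  obtains m where "bounded_linear m" "\<And>y. m y \<le> norm y" "m x = norm x"
proof -
  have sn: "sublinear (norm :: 'a \<Rightarrow> real)"
    by (simp add: sublinear_def norm_triangle_ineq)
  obtain q where q: "sublinear q" "\<And>y. q y \<le> norm y" "\<And>y. q y \<le> norm (y + x) - norm x"
    using sublinear_shift[OF sn] by blast
  obtain m where m: "linear m" "\<And>y. m y \<le> q y"
    using sublinear_dominates_linear[OF q(1)] by blast
  have le: "m y \<le> norm y" for y
    using m(2)[of y] q(2)[of y] by simp
  have "m (- x) \<le> - norm x"
    using m(2)[of "- x"] q(3)[of "- x"] by simp
  then have "norm x \<le> m x" using linear_neg[OF m(1), of x] by simp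
  moreover have "bounded_linear m"
  proof (rule bounded_linear_intro[where K=1])
    show "norm (m y) \<le> norm y * 1" for y
      using le[of y] le[of "- y"] linear_neg[OF m(1), of y] by (simp add: abs_le_iff)
  qed (use m(1) in \<open>auto simp: linear_add linear_scale\<close>)
  ultimately show thesis using that[of m] le le[of x] by (auto intro: antisym)
qed

section \<open>Complex functionals from real ones\<close>

definition complexify :: "('a::banach \<Rightarrow> 'a) \<Rightarrow> ('a \<Rightarrow> real) \<Rightarrow> 'a \<Rightarrow> complex" where
  "complexify J m x = Complex (m x) (- m (J x))"

text \<open>\<open>complexify\<close> is the classical m(x) - i m(ix), with J in the role of i;
  \<open>J (J x) = - x\<close> is what makes it complex linear.\<close>

lemma cdual_complexify:
  assumes J: "complex_structure J" and m: "bounded_linear m"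
  shows "cdual J (complexify J m)"
proof -
  have blJ: "bounded_linear J" and JJ: "\<And>x. J (J x) = - x"
    using J by (auto simp: complex_structure_def)
  interpret J: bounded_linear J by fact
  interpret m: bounded_linear m by fact
  have eq: "complexify J m = (\<lambda>x. complex_of_real (m x) - \<i> * complex_of_real (m (J x)))"
    by (auto simp: complexify_def complex_eq_iff)
  have "bounded_linear (complexify J m)"
    unfolding eq
    by (intro bounded_linear_sub bounded_linear_mult_const bounded_linear_const_mult
        bounded_linear_compose[OF bounded_linear_of_real] m bounded_linear_compose[OF m blJ])
  then show ?thesis
    by (auto simp: cdual_def complexify_def complex_eq_iff JJ m.neg)
qed

text \<open>Rotating y by the opposite of the argument of the value makes the value real and
  nonnegative, hence a value of m; the rotation invariance in \<open>complex_structure\<close>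
  ensures that no constant is lost.\<close>

lemma cmod_complexify_le:
  assumes J: "complex_structure J" and m: "bounded_linear m" and le: "\<And>y. m y \<le> K * norm y"
  shows "cmod (complexify J m y) \<le> K * norm y"
proof -
  interpret m: bounded_linear m by fact
  define t where "t = - Arg (complexify J m y)"
  have "complex_of_real (cmod (complexify J m y)) = cis t * complexify J m y"
    using arg_cong[OF rcis_cmod_Arg[of "complexify J m y"], of "\<lambda>u. cis t * u"]
    by (simp add: rcis_def t_def cis_mult mult.left_commute)
  then have "cmod (complexify J m y) = Re (cis t * complexify J m y)"
    by (metis Re_complex_of_real)
  also have "\<dots> = m (cos t *\<^sub>R y + sin t *\<^sub>R J y)"
    by (simp add: complexify_def m.add m.scaleR)
  also have "\<dots> \<le> K * norm (cos t *\<^sub>R y + sin t *\<^sub>R J y)" by (rule le)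
  also have "\<dots> = K * norm y" using J by (simp add: complex_structure_def)
  finally show ?thesis .
qed

lemma complex_norming_functional:
  assumes J: "complex_structure J"
  obtains \<phi> where "cdual J \<phi>" "\<And>y. cmod (\<phi> y) \<le> norm y" "cmod (\<phi> x) \<ge> norm x"
proof -
  obtain m where m: "bounded_linear m" "\<And>y. m y \<le> norm y" "m x = norm x"
    using norming_functional by blast
  have "cmod (complexify J m x) \<ge> norm x"
    using complex_Re_le_cmod[of "complexify J m x"] m(3) by (simp add: complexify_def)
  then show thesis
    using that[OF cdual_complexify[OF J m(1)]] cmod_complexify_le[OF J m(1), of 1] m(2) by simp
qed

text \<open>The route by which weak estimates become norm estimates below: testing on functionals of
  norm at most one is enough.\<close>

lemma cdual_norm_bound:
  assumes "complex_structure J" "\<And>\<phi>. cdual J \<phi> \<Longrightarrow> (\<And>y. cmod (\<phi> y) \<le> norm y) \<Longrightarrow> cmod (\<phi> x) \<le> K"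
  shows "norm x \<le> K"
proof -
  obtain \<phi> where "cdual J \<phi>" "\<And>y. cmod (\<phi> y) \<le> norm y" and x: "cmod (\<phi> x) \<ge> norm x"
    using complex_norming_functional[OF assms(1)] by blast
  then have "cmod (\<phi> x) \<le> K" by (intro assms(2))
  then show ?thesis using x by linarith
qed

text \<open>Baire's theorem yields a sublevel set with interior, and subadditivity moves the ball to
  the origin. Closed sublevel sets express lower semicontinuity; with values in
  \<open>ennreal\<close>, integrals and suprema can serve as p directly.\<close>

lemma closed_seminorm_bounded:
  fixes p :: "'a::banach \<Rightarrow> ennreal"
  assumes closed: "\<And>n::nat. closed {x. p x \<le> of_nat n}"
    and add: "\<And>x y. p (x + y) \<le> p x + p y"
    and scale: "\<And>c x. p (c *\<^sub>R x) = ennreal \<bar>c\<bar> * p x"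
    and fin: "\<And>x. p x < top"
  obtains C where "0 \<le> C" "\<And>x. p x \<le> ennreal (C * norm x)"
proof -
  define G where "G = range (\<lambda>n::nat. {x. p x \<le> of_nat n})"
  have "\<exists>n::nat. p x \<le> of_nat n" for x
    using ennreal_Ex_less_of_nat[OF fin[of x]] by (auto intro: less_imp_le)
  then have "\<Union>G = UNIV" by (auto simp: G_def)
  moreover have "interior (\<Union>G) = {}" if "\<And>T. T \<in> G \<Longrightarrow> interior T = {}"
    using Baire_category_alt[of euclidean G, OF disjI1[OF completely_metrizable_space_euclidean]] closed that
    by (auto simp: G_def)
  ultimately have "\<exists>T\<in>G. interior T \<noteq> {}"
    by (metis interior_UNIV UNIV_not_empty)
  then obtain n :: nat and a where "a \<in> interior {x. p x \<le> of_nat n}"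
    unfolding G_def by blast
  then obtain r where "0 < r" "ball a r \<subseteq> {x. p x \<le> of_nat n}"
    unfolding mem_interior by blast
  then have r: "0 < r" "\<And>x. dist a x < r \<Longrightarrow> p x \<le> of_nat n"
    by auto
  have pm: "p (- x) = p x" for x using scale[of "-1" x] by simp
  have ball: "p x \<le> ennreal (2 * real n)" if "norm x < r" for x
  proof -
    have "p x \<le> p (x + a) + p a"
      using add[of "x + a" "- a"] pm[of a] by simp
    also have "\<dots> \<le> of_nat n + of_nat n"
      using that r by (intro add_mono r(2)) (auto simp: dist_norm)
    also have "\<dots> = ennreal (2 * real n)"
      by (metis ennreal_of_nat_eq_real_of_nat mult_2 of_nat_add)
    finally show ?thesis .
  qed
  \<comment> \<open>x is rescaled to norm r / 2, inside the ball where p is at most 2 n; undoing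
    this gives 2 norm x / r times 2 n.\<close>
  define C where "C = 4 * real n / r"
  show thesis
  proof (rule that[of C])
    show "0 \<le> C" using r by (simp add: C_def)
    fix x :: 'a
    show "p x \<le> ennreal (C * norm x)"
    proof (cases "x = 0")
      case True
      then show ?thesis using scale[of 0 x] by simp
    next
      case False
      define c where "c = 2 * norm x / r"
      have c: "0 < c" using False r by (simp add: c_def)
      have "p x = ennreal c * p (inverse c *\<^sub>R x)"
        using scale[of c "inverse c *\<^sub>R x"] c by simp
      also have "\<dots> \<le> ennreal c * ennreal (2 * real n)"
        using False r by (intro mult_left_mono ball) (auto simp: c_def)
      also have "\<dots> = ennreal (C * norm x)"
        using c by (simp add: c_def C_def ennreal_mult[symmetric] field_simps)
      finally show ?thesis .
    qed
  qed
qed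

section \<open>Integrals on lines in the half-plane\<close>

lemma open_RHP: "open RHP"
  by (simp add: RHP_def open_halfspace_Re_gt)

lemma Complex_in_RHP [simp]: "Complex x y \<in> RHP \<longleftrightarrow> 0 < x"
  by (simp add: RHP_def)

lemma tail_nn_integral:
  fixes f :: "real \<Rightarrow> ennreal"
  assumes [measurable]: "f \<in> borel_measurable borel" and fin: "(\<integral>\<^sup>+t. f t \<partial>lborel) < top" and e: "0 < e"
  obtains r where "0 < r" "(\<integral>\<^sup>+t. f t * indicator {t. r \<le> \<bar>t\<bar>} t \<partial>lborel) < e"
proof -
  have "(\<lambda>n. \<integral>\<^sup>+t. f t * indicator {t. real n \<le> \<bar>t\<bar>} t \<partial>lborel) \<longlonglongrightarrow> (\<integral>\<^sup>+t. 0 \<partial>(lborel :: real measure))"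
  proof (rule nn_integral_dominated_convergence[where w=f])
    show "AE t in lborel. (\<lambda>n. f t * indicator {t. real n \<le> \<bar>t\<bar>} t) \<longlonglongrightarrow> 0"
    proof (intro AE_I2 tendsto_eventually)
      fix t :: real
      obtain N :: nat where "\<bar>t\<bar> < real N" using reals_Archimedean2 by blast
      then show "\<forall>\<^sub>F n in sequentially. f t * indicator {t. real n \<le> \<bar>t\<bar>} t = 0"
        by (intro eventually_sequentiallyI[of N]) (auto simp: indicator_def)
    qed
  qed (use fin in \<open>auto simp: indicator_def\<close>)
  then have "\<forall>\<^sub>F n in sequentially. (\<integral>\<^sup>+t. f t * indicator {t. real n \<le> \<bar>t\<bar>} t \<partial>lborel) < e"
    using e by (intro order_tendstoD) auto
  then obtain n where "(\<integral>\<^sup>+t. f t * indicator {t. real (Suc n) \<le> \<bar>t\<bar>} t \<partial>lborel) < e"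
    by (meson eventually_sequentially le_SucI order_refl)
  then show thesis by (intro that[of "real (Suc n)"]) auto
qed

lemma norm_integral_le_nn_integral:
  fixes f :: "real \<Rightarrow> 'a::euclidean_space"
  assumes "continuous_on {a..b} f"
  shows "ennreal (norm (integral {a..b} f)) \<le> (\<integral>\<^sup>+t\<in>{a..b}. ennreal (norm (f t)) \<partial>lborel)"
proof -
  have int: "set_integrable lborel {a..b} f"
    by (rule borel_integrable_atLeastAtMost'[OF assms])
  have "integral {a..b} f = (LINT t|lborel. indicator {a..b} t *\<^sub>R f t)"
    using set_borel_integral_eq_integral(2)[OF int] by (simp add: set_lebesgue_integral_def)
  also have "ennreal (norm \<dots>) \<le> (\<integral>\<^sup>+t. ennreal (norm (indicator {a..b} t *\<^sub>R f t)) \<partial>lborel)"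
    using int by (intro integral_norm_bound_ennreal) (simp add: set_integrable_def)
  also have "\<dots> = (\<integral>\<^sup>+t\<in>{a..b}. ennreal (norm (f t)) \<partial>lborel)"
    by (intro nn_integral_cong) (auto simp: indicator_def)
  finally show ?thesis .
qed

text \<open>The bound is a nonnegative extended integral, so it can be enlarged at once to a whole
  line or half-line. It is used with u = 1 for horizontal and u = i for vertical segments.\<close>

lemma line_difference_le:
  assumes S: "open S" and g: "g holomorphic_on S" and ab: "a \<le> b"
    and seg: "\<And>t. a \<le> t \<Longrightarrow> t \<le> b \<Longrightarrow> z + of_real t * u \<in> S" and u: "cmod u = 1"
  shows "ennreal (cmod (g (z + of_real b * u) - g (z + of_real a * u)))
    \<le> (\<integral>\<^sup>+t\<in>{a..b}. ennreal (cmod (deriv g (z + of_real t * u))) \<partial>lborel)"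
proof -
  have der: "((\<lambda>t. g (z + of_real t * u)) has_vector_derivative (u * deriv g (z + of_real t * u)))
      (at t within {a..b})" if "t \<in> {a..b}" for t
  proof -
    have l: "((\<lambda>t. z + of_real t * u) has_vector_derivative u) (at t)"
      by (auto intro!: derivative_eq_intros simp: has_vector_derivative_def scaleR_conv_of_real)
    have "(g has_field_derivative deriv g (z + of_real t * u)) (at (z + of_real t * u))"
      using g S seg that by (intro holomorphic_derivI[OF g S]) auto
    from field_vector_diff_chain_at[OF l this] show ?thesis
      by (simp add: o_def has_vector_derivative_at_within)
  qed
  have "continuous_on {a..b} (\<lambda>t. deriv g (z + of_real t * u))"
    by (rule continuous_on_compose2[OF holomorphic_on_imp_continuous_on[OF holomorphic_deriv[OF g S]]])
      (use seg in \<open>auto intro!: continuous_intros\<close>)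
  then have c: "continuous_on {a..b} (\<lambda>t. u * deriv g (z + of_real t * u))"
    by (intro continuous_intros)
  have "g (z + of_real b * u) - g (z + of_real a * u) = integral {a..b} (\<lambda>t. u * deriv g (z + of_real t * u))"
    using integral_unique[OF fundamental_theorem_of_calculus[OF ab der]] by (rule sym)
  then show ?thesis
    using norm_integral_le_nn_integral[OF c] u by (simp add: norm_mult)
qed

section \<open>Poisson's formula as an upper estimate on a vertical line\<close>

lemma contour_integral_rectpath:
  assumes c: "continuous_on (path_image (rectpath (Complex a c) (Complex b d))) F" and ab: "a \<le> b" "c \<le> d"
  shows "contour_integral (rectpath (Complex a c) (Complex b d)) F =
    contour_integral (linepath (Complex a c) (Complex b c)) F + contour_integral (linepath (Complex b c) (Complex b d)) F
    + contour_integral (linepath (Complex b d) (Complex a d)) F - contour_integral (linepath (Complex a c) (Complex a d)) F" (is ?sum)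
    "continuous_on (closed_segment (Complex a c) (Complex b c)) F"
    "continuous_on (closed_segment (Complex b c) (Complex b d)) F"
    "continuous_on (closed_segment (Complex b d) (Complex a d)) F"
    "continuous_on (closed_segment (Complex a c) (Complex a d)) F"
proof -
  have *: "path_image (rectpath (Complex a c) (Complex b d)) =
      closed_segment (Complex a c) (Complex b c) \<union> closed_segment (Complex b c) (Complex b d) \<union>
      closed_segment (Complex b d) (Complex a d) \<union> closed_segment (Complex a d) (Complex a c)"
    by (simp add: rectpath_def Let_def path_image_join Un_assoc)
  have 1: "continuous_on (closed_segment (Complex a c) (Complex b c)) F"
    by (rule continuous_on_subset[OF c]) (auto simp: *)
  have 2: "continuous_on (closed_segment (Complex b c) (Complex b d)) F"
    by (rule continuous_on_subset[OF c]) (auto simp: *)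
  have 3: "continuous_on (closed_segment (Complex b d) (Complex a d)) F"
    by (rule continuous_on_subset[OF c]) (auto simp: *)
  have 4: "continuous_on (closed_segment (Complex a d) (Complex a c)) F"
    by (rule continuous_on_subset[OF c]) (auto simp: *)
  show "continuous_on (closed_segment (Complex a c) (Complex b c)) F"
    "continuous_on (closed_segment (Complex b c) (Complex b d)) F"
    "continuous_on (closed_segment (Complex b d) (Complex a d)) F"
    "continuous_on (closed_segment (Complex a c) (Complex a d)) F"
    using 1 2 3 4 by (simp_all add: closed_segment_commute)
  \<comment> \<open>The left side is reversed so that it runs upwards, in the direction of the line
    integral over t.\<close>
  have i4: "contour_integral (linepath (Complex a d) (Complex a c)) F
      = - contour_integral (linepath (Complex a c) (Complex a d)) F"
    by (rule contour_integral_reverse_linepath[OF 4])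
  have i: "F contour_integrable_on linepath (Complex a c) (Complex b c)"
    "F contour_integrable_on linepath (Complex b c) (Complex b d)"
    "F contour_integrable_on linepath (Complex b d) (Complex a d)"
    "F contour_integrable_on linepath (Complex a d) (Complex a c)"
    by (rule contour_integrable_continuous_linepath, fact)+
  show ?sum
    using i by (simp add: rectpath_def Let_def contour_integrable_joinI i4)
qed

text \<open>Only the upper bound of the Poisson formula is needed: Cauchy's formula on large rectangles,
  with the kernel multiplied by the factor that vanishes at the mirror image of \<open>p\<close>.\<close>

lemma Poisson_bound:
  assumes u: "u holomorphic_on RHP" and B: "\<And>z. \<delta> \<le> Re z \<Longrightarrow> cmod (u z) \<le> B"
    and d: "0 < \<delta>" "\<delta> < Re p"
  shows "ennreal (cmod (u p)) \<le>
    (\<integral>\<^sup>+t. ennreal (cmod (u (Complex \<delta> t)) * ((Re p - \<delta>) / (pi * (cmod (Complex \<delta> t - p))\<^sup>2))) \<partial>lborel)"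
proof -
  define x where "x = Re p - \<delta>"
  have x: "0 < x" using d by (simp add: x_def)
  \<comment> \<open>q mirrors p in the line Re z = \<delta>. The factor (p - q) / (\<zeta> - q)
    equals 1 at p, and on the line its modulus is 2 x / |\<zeta> - p|, so that F has there the
    modulus of u times 2 pi times the Poisson kernel.\<close>
  define q where "q = Complex (\<delta> - x) (Im p)"
  define K where "K = (\<lambda>\<zeta>. u \<zeta> * (p - q) / (\<zeta> - q))"
  define F where "F = (\<lambda>\<zeta>. K \<zeta> / (\<zeta> - p))"
  \<comment> \<open>A convex open half-plane that contains the contour and excludes the pole q, as
    Cauchy's formula for convex sets requires.\<close>
  define S where "S = {z. max 0 (\<delta> - x) < Re z}"
  have pq: "p - q = complex_of_real (2 * x)"
    by (simp add: q_def x_def complex_eq_iff)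
  have Kp: "K p = u p"
    using x by (simp add: K_def pq[symmetric]) (use pq x in auto)
  have S: "convex S" "open S"
    unfolding S_def by (rule convex_halfspace_Re_gt open_halfspace_Re_gt)+
  have SR: "S \<subseteq> RHP" and qS: "\<zeta> \<noteq> q" if "\<zeta> \<in> S" for \<zeta>
    using that by (auto simp: S_def RHP_def q_def)
  have pS: "p \<in> S" using d x by (auto simp: S_def x_def)
  have holK: "K holomorphic_on S"
    unfolding K_def using qS SR pS by (auto intro!: holomorphic_intros holomorphic_on_subset[OF u])
  have B0: "0 \<le> B" using B[of p] d norm_ge_zero[of "u p"] by linarith
  define R where "R = cmod p + cmod q + \<delta> + 1"
  have R: "cmod p < R" "cmod q < R" "\<delta> < R"
    using d norm_ge_zero[of p] norm_ge_zero[of q] unfolding R_def by linarith+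
  have normF: "cmod (F (Complex \<delta> t)) = 2 * pi * (cmod (u (Complex \<delta> t)) * (x / (pi * (cmod (Complex \<delta> t - p))\<^sup>2)))" for t
  proof -
    have "cmod (Complex \<delta> t - q) = cmod (Complex \<delta> t - p)"
      by (simp add: cmod_def q_def x_def power2_commute[of \<delta>])
    then show ?thesis
      unfolding F_def K_def pq using x by (simp add: norm_mult norm_divide power2_eq_square)
  qed
  define Q where "Q = (\<integral>\<^sup>+t. ennreal (cmod (F (Complex \<delta> t))) \<partial>lborel)"
  \<comment> \<open>The three far sides have total length 4 N and |F| is at most 8 B x / N^2 there,
    whence 32 B x / N. The second power comes from the extra factor 1 / (\<zeta> - q); with 1 /
    (\<zeta> - p) alone, a bounded u would leave a contribution that does not vanish.\<close>
  have main: "ennreal (2 * pi * cmod (u p)) \<le> ennreal (32 * (B * x) / N) + Q" if N: "2 * R \<le> N" for N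
  proof -
    have N0: "0 < N" "R < N" using R N d by linarith+
    define Y where "Y = rectpath (Complex \<delta> (- N)) (Complex (\<delta> + N) N)"
    have "\<bar>Im p\<bar> < N" "\<bar>Re p\<bar> < N"
      using abs_Im_le_cmod[of p] abs_Re_le_cmod[of p] R N0 by linarith+
    then have box: "p \<in> box (Complex \<delta> (- N)) (Complex (\<delta> + N) N)"
      using d by (auto simp: in_box_complex_iff)
    have corners: "Re (Complex \<delta> (- N)) \<le> Re (Complex (\<delta> + N) N)" "Im (Complex \<delta> (- N)) \<le> Im (Complex (\<delta> + N) N)"
      using N0 by auto
    have img: "path_image Y \<subseteq> {z. \<delta> \<le> Re z}"
      using path_image_rectpath_subset_cbox[OF corners] unfolding Y_def
      by (rule order_trans) (auto simp: in_cbox_complex_iff)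
    have pY: "p \<notin> path_image Y"
      using path_image_rectpath_inter_box[OF corners] box unfolding Y_def by blast
    have YS: "path_image Y \<subseteq> S - {p}"
      using img pY x d unfolding S_def by fastforce
    have contF: "continuous_on (path_image Y) F"
      unfolding F_def using YS
      by (intro continuous_intros holomorphic_on_imp_continuous_on[OF holomorphic_on_subset[OF holK]]) auto
    have "(F has_contour_integral 2 * pi * \<i> * winding_number Y p * K p) Y"
      unfolding F_def using S pS holK YS
      by (intro Cauchy_integral_formula_convex_simple) (auto simp: interior_open Y_def)
    moreover have "winding_number Y p = 1"
      unfolding Y_def by (rule winding_number_rectpath[OF box])
    ultimately have "contour_integral Y F = 2 * pi * \<i> * u p"
      by (simp add: Kp contour_integral_unique)
    have RC: "continuous_on (path_image (rectpath (Complex \<delta> (- N)) (Complex (\<delta> + N) N))) F"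
      using contF by (simp add: Y_def)
    have sides: "\<delta> \<le> \<delta> + N" "- N \<le> N" using N0 by auto
    note R4 = contour_integral_rectpath[OF RC sides]
    have far: "cmod (F \<zeta>) \<le> 8 * (B * x) / N\<^sup>2" if z: "\<delta> \<le> Re \<zeta>" "N \<le> cmod \<zeta>" for \<zeta>
    proof -
      have a: "N / 2 \<le> cmod (\<zeta> - p)" "N / 2 \<le> cmod (\<zeta> - q)"
        using norm_triangle_ineq2[of \<zeta> p] norm_triangle_ineq2[of \<zeta> q] R N z by linarith+
      have "N\<^sup>2 / 4 \<le> cmod (\<zeta> - q) * cmod (\<zeta> - p)"
        using mult_mono[OF a(2) a(1)] N0 by (simp add: power2_eq_square)
      moreover have "cmod (u \<zeta>) * (2 * x) \<le> B * (2 * x)"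
        using B z x by (intro mult_right_mono) auto
      ultimately have "cmod (u \<zeta>) * (2 * x) / (cmod (\<zeta> - q) * cmod (\<zeta> - p)) \<le> B * (2 * x) / (N\<^sup>2 / 4)"
        using N0 x B0 by (intro frac_le) auto
      then show ?thesis
        unfolding F_def K_def pq using x by (simp add: norm_mult norm_divide mult_ac)
    qed
    have P: "0 \<le> 8 * (B * x) / N\<^sup>2" using B0 x by simp
    let ?i1 = "contour_integral (linepath (Complex \<delta> (- N)) (Complex (\<delta> + N) (- N))) F"
    let ?i2 = "contour_integral (linepath (Complex (\<delta> + N) (- N)) (Complex (\<delta> + N) N)) F"
    let ?i3 = "contour_integral (linepath (Complex (\<delta> + N) N) (Complex \<delta> N)) F"
    let ?i4 = "contour_integral (linepath (Complex \<delta> (- N)) (Complex \<delta> N)) F"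
    have i1: "cmod (?i1) \<le> 8 * (B * x) / N\<^sup>2 * N"
    proof -
      have "cmod (F \<zeta>) \<le> 8 * (B * x) / N\<^sup>2" if "\<zeta> \<in> closed_segment (Complex \<delta> (- N)) (Complex (\<delta> + N) (- N))" for \<zeta>
        using that N0 abs_Im_le_cmod[of \<zeta>] by (intro far) (auto simp: closed_segment_same_Im closed_segment_eq_real_ivl)
      from contour_integral_bound_linepath[OF contour_integrable_continuous_linepath[OF R4(2)] P this] N0
      show ?thesis by (simp add: cmod_def)
    qed
    have i3: "cmod (?i3) \<le> 8 * (B * x) / N\<^sup>2 * N"
    proof -
      have "cmod (F \<zeta>) \<le> 8 * (B * x) / N\<^sup>2" if "\<zeta> \<in> closed_segment (Complex (\<delta> + N) N) (Complex \<delta> N)" for \<zeta>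
        using that N0 abs_Im_le_cmod[of \<zeta>] by (intro far) (auto simp: closed_segment_same_Im closed_segment_eq_real_ivl)
      from contour_integral_bound_linepath[OF contour_integrable_continuous_linepath[OF R4(4)] P this] N0
      show ?thesis by (simp add: cmod_def)
    qed
    have i2: "cmod (?i2) \<le> 8 * (B * x) / N\<^sup>2 * (2 * N)"
    proof -
      have "cmod (F \<zeta>) \<le> 8 * (B * x) / N\<^sup>2" if "\<zeta> \<in> closed_segment (Complex (\<delta> + N) (- N)) (Complex (\<delta> + N) N)" for \<zeta>
        using that N0 d abs_Re_le_cmod[of \<zeta>] by (intro far) (auto simp: closed_segment_same_Re)
      from contour_integral_bound_linepath[OF contour_integrable_continuous_linepath[OF R4(3)] P this] N0
      show ?thesis by (simp add: cmod_eq_Im)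
    qed
    have cI: "continuous_on {-N..N} (\<lambda>t. F (Complex \<delta> t))"
    proof (rule continuous_on_compose2[OF R4(5)])
      show "continuous_on {-N..N} (Complex \<delta>)"
        using continuous_on_Complex[of "{-N..N}" "\<lambda>_. \<delta>" "\<lambda>t. t"] by (simp add: continuous_on_id)
      show "Complex \<delta> ` {-N..N} \<subseteq> closed_segment (Complex \<delta> (- N)) (Complex \<delta> N)"
        using N0 by (auto simp: closed_segment_same_Re closed_segment_eq_real_ivl)
    qed
    have i4: "ennreal (cmod (?i4)) \<le> Q"
    proof -
      have "?i4 = \<i> * integral {-N..N} (\<lambda>t. F (Complex \<delta> t))"
        using N0 by (intro contour_integral_linepath_same_Re) auto
      then have "ennreal (cmod (?i4))
          \<le> (\<integral>\<^sup>+t\<in>{-N..N}. ennreal (cmod (F (Complex \<delta> t))) \<partial>lborel)"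
        using norm_integral_le_nn_integral[OF cI] by (simp add: norm_mult)
      also have "\<dots> \<le> Q"
        unfolding Q_def by (intro nn_integral_mono) (auto simp: indicator_def)
      finally show ?thesis .
    qed
    have eq: "2 * pi * \<i> * u p = ?i1 + ?i2 + ?i3 - ?i4"
      using R4(1) N0 \<open>contour_integral Y F = _\<close> by (simp add: Y_def)
    have "2 * pi * cmod (u p) = cmod (2 * pi * \<i> * u p)" by (simp add: norm_mult)
    also have "\<dots> \<le> cmod ?i1 + cmod ?i2 + cmod ?i3 + cmod ?i4"
      unfolding eq using norm_triangle_ineq4[of "?i1 + ?i2 + ?i3" ?i4] norm_triangle_ineq[of "?i1 + ?i2" ?i3]
        norm_triangle_ineq[of ?i1 ?i2] by linarith
    also have "\<dots> \<le> 32 * (B * x) / N + cmod ?i4"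
    proof -
      have "8 * (B * x) / N\<^sup>2 * N + 8 * (B * x) / N\<^sup>2 * (2 * N) + 8 * (B * x) / N\<^sup>2 * N = 32 * (B * x) / N"
        using N0 by (simp add: field_simps power2_eq_square)
      then show ?thesis using i1 i2 i3 by linarith
    qed
    finally have "ennreal (2 * pi * cmod (u p)) \<le> ennreal (32 * (B * x) / N + cmod ?i4)"
      by (rule ennreal_leI)
    also have "\<dots> = ennreal (32 * (B * x) / N) + ennreal (cmod ?i4)"
      using N0 B0 x by (intro ennreal_plus) auto
    also have "\<dots> \<le> ennreal (32 * (B * x) / N) + Q"
      by (intro add_left_mono i4)
    finally show ?thesis .
  qed
  have "ennreal (2 * pi * cmod (u p)) \<le> Q"
  proof (cases "Q = top")
    case False
    then obtain r where r: "Q = ennreal r" "0 \<le> r" by (cases Q) auto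
    have "((\<lambda>N. 32 * (B * x) / N + r) \<longlongrightarrow> 0 + r) at_top"
      by (intro tendsto_add tendsto_const tendsto_divide_0[OF tendsto_const] filterlim_at_top_imp_at_infinity filterlim_ident)
    moreover have "\<forall>\<^sub>F N in at_top. 2 * pi * cmod (u p) \<le> 32 * (B * x) / N + r"
    proof (rule eventually_at_top_linorderI[of "2 * R"])
      fix N assume N: "2 * R \<le> N"
      have "0 < N" using R N d by linarith
      then show "2 * pi * cmod (u p) \<le> 32 * (B * x) / N + r"
        using main[OF N] r B0 x by (simp add: ennreal_plus[symmetric] del: ennreal_plus)
    qed
    ultimately have "2 * pi * cmod (u p) \<le> 0 + r"
      by (intro tendsto_lowerbound) auto
    then show ?thesis using r by (auto intro: ennreal_leI)
  qed auto
  moreover have "Q = ennreal (2 * pi) * (\<integral>\<^sup>+t. ennreal (cmod (u (Complex \<delta> t)) * (x / (pi * (cmod (Complex \<delta> t - p))\<^sup>2))) \<partial>lborel)"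
  proof -
    have "continuous_on UNIV (\<lambda>t. u (Complex \<delta> t))"
      by (rule continuous_on_compose2[OF holomorphic_on_imp_continuous_on[OF u]])
        (use d in \<open>auto intro!: continuous_intros\<close>)
    then have [measurable]: "(\<lambda>t. u (Complex \<delta> t)) \<in> borel_measurable borel"
      by (rule borel_measurable_continuous_onI)
    have [measurable]: "(\<lambda>t. Complex \<delta> t) \<in> borel_measurable borel"
      by (intro borel_measurable_continuous_onI continuous_intros)
    show ?thesis
      unfolding Q_def normF using x
      by (subst nn_integral_cmult[symmetric])
        (measurable, intro nn_integral_cong ennreal_mult', auto)
  qed
  ultimately have "ennreal (2 * pi) * ennreal (cmod (u p)) \<le> ennreal (2 * pi) *
      (\<integral>\<^sup>+t. ennreal (cmod (u (Complex \<delta> t)) * (x / (pi * (cmod (Complex \<delta> t - p))\<^sup>2))) \<partial>lborel)"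
    by (simp add: ennreal_mult')
  then show ?thesis
    unfolding x_def by (subst (asm) ennreal_mult_le_mult_iff) auto
qed

section \<open>Weighted sums of values at test points\<close>

lemma sum_mult_exp_le:
  fixes a :: "nat \<Rightarrow> real"
  shows "(\<Sum>j<n. a j * exp (- (\<Sum>k\<le>j. a k))) \<le> 1"
proof -
  have "(\<Sum>j<n. a j * exp (- (\<Sum>k\<le>j. a k))) \<le> 1 - exp (- (\<Sum>k<n. a k))"
  proof (induction n)
    case (Suc n)
    \<comment> \<open>By 1 + a \<le> e^a each term is at most a difference of consecutive
      exponentials, so the sum telescopes: a discrete form of the integral of e^(-s) over s \<ge>
      0.\<close>
    have "(1 + a n) * exp (- (\<Sum>k<Suc n. a k)) \<le> exp (a n) * exp (- (\<Sum>k<Suc n. a k))"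
      by (intro mult_right_mono exp_ge_add_one_self) auto
    also have "\<dots> = exp (- (\<Sum>k<n. a k))"
      by (simp add: mult_exp_exp)
    finally have "a n * exp (- (\<Sum>k<Suc n. a k)) \<le> exp (- (\<Sum>k<n. a k)) - exp (- (\<Sum>k<Suc n. a k))"
      by (simp add: algebra_simps)
    then show ?case
      using Suc by (simp add: lessThan_Suc_atMost[symmetric])
  qed simp
  also have "\<dots> \<le> 1" by simp
  finally show ?thesis .
qed

lemma measurable_Complex_line:
  fixes h :: "complex \<Rightarrow> complex"
  assumes "continuous_on RHP h" "0 < x"
  shows "(\<lambda>y. h (Complex x y)) \<in> borel_measurable borel"
  by (intro borel_measurable_continuous_onI continuous_on_compose2[OF assms(1)])
    (use assms(2) in \<open>auto intro!: continuous_intros\<close>)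

text \<open>The exponential factors are P. Jones' device: multiplying \<open>h\<close> by a bounded function that
  decreases with \<open>j\<close> turns the divergent sum of Poisson kernels into a sum bounded by one, while at the
  points themselves the factors stay bounded below because of the condition on the weights.\<close>

lemma Jones_weighted_sum:
  fixes h :: "complex \<Rightarrow> complex" and z :: "nat \<Rightarrow> complex" and w :: "nat \<Rightarrow> real"
  assumes h: "h holomorphic_on RHP"
    and M: "\<And>x. 0 < x \<Longrightarrow> (\<integral>\<^sup>+y. ennreal (cmod (h (Complex x y))) \<partial>lborel) \<le> ennreal M" "0 \<le> M"
    and bd: "\<And>z. 0 < Re z \<Longrightarrow> cmod (h z) \<le> C / Re z"
    and \<delta>: "0 < \<delta>" and z: "\<And>j. j < n \<Longrightarrow> 2 * \<delta> \<le> Re (z j)"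
    and w: "\<And>j. j < n \<Longrightarrow> 0 \<le> w j" "\<And>j. j < n \<Longrightarrow> (\<Sum>k\<le>j. w k) \<le> 2 * Re (z j)"
  shows "(\<Sum>j<n. w j * cmod (h (z j))) \<le> exp 2 / pi * M"
proof -
  \<comment> \<open>The pole lies at the mirror image of \<open>z k\<close> in the line Re z =
    \<delta>. On that line the real part of \<open>c k\<close> is pi times \<open>w k\<close> times
    the Poisson kernel of \<open>z k\<close>; this is \<open>a k\<close> below, and it makes
    |\<open>E j\<close>| the exponential in \<open>sum_mult_exp_le\<close>.\<close>
  define c where "c k \<zeta> = of_real (w k) / (\<zeta> + cnj (z k) - of_real (2 * \<delta>))" for k \<zeta>
  define E where "E j \<zeta> = exp (- (\<Sum>k\<le>j. c k \<zeta>))" for j \<zeta>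
  define d2 where "d2 k t = (cmod (Complex \<delta> t - z k))\<^sup>2" for k t
  define a where "a k t = w k * (Re (z k) - \<delta>) / d2 k t" for k t
  define H where "H t = cmod (h (Complex \<delta> t))" for t
  have Rec: "0 \<le> Re (c k \<zeta>)" and den: "\<zeta> + cnj (z k) - of_real (2 * \<delta>) \<noteq> 0"
    if "k < n" "0 < Re \<zeta>" for k \<zeta>
  proof -
    \<comment> \<open>2 \<delta> \<le> Re (z k) keeps the mirrored pole out of the open right
      half-plane, so \<open>E j\<close> is holomorphic there with modulus at most 1.\<close>
    have p: "0 < Re (\<zeta> + cnj (z k) - of_real (2 * \<delta>))"
      using z[OF that(1)] that(2) by simp
    then show "\<zeta> + cnj (z k) - of_real (2 * \<delta>) \<noteq> 0" by (metis zero_complex.sel(1) less_irrefl)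
    show "0 \<le> Re (c k \<zeta>)"
      unfolding c_def Re_divide using p w(1)[OF that(1)] by (intro divide_nonneg_nonneg) auto
  qed
  have cmodE: "cmod (E j \<zeta>) = exp (- (\<Sum>k\<le>j. Re (c k \<zeta>)))" for j \<zeta>
    by (simp add: E_def)
  have E1: "cmod (E j \<zeta>) \<le> 1" if "j < n" "0 < Re \<zeta>" for j \<zeta>
    unfolding cmodE using sum_nonneg[of "{..j}" "\<lambda>k. Re (c k \<zeta>)"] that Rec by simp
  have holE: "E j holomorphic_on RHP" if "j < n" for j
    unfolding E_def c_def using that den
    by (intro holomorphic_intros) (auto simp: RHP_def)
  have Eline: "cmod (E j (Complex \<delta> t)) = exp (- (\<Sum>k\<le>j. a k t))" for j t
  proof -
    have "Re (c k (Complex \<delta> t)) = a k t" for k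
    proof -
      have "(cmod (Complex \<delta> t + cnj (z k) - of_real (2 * \<delta>)))\<^sup>2 = d2 k t"
        by (simp add: d2_def cmod_power2 power2_commute[of \<delta>])
      moreover have "Re (c k (Complex \<delta> t)) = w k * (Re (z k) - \<delta>) / (cmod (Complex \<delta> t + cnj (z k) - of_real (2 * \<delta>)))\<^sup>2"
        unfolding c_def Re_divide cmod_power2[symmetric] by simp
      ultimately show ?thesis by (simp add: a_def)
    qed
    then show ?thesis by (simp add: cmodE)
  qed
  \<comment> \<open>The distance from \<open>z j\<close> to each mirrored pole is at least Re (z j),
    so the exponent is at most the sum of the weights divided by Re (z j), hence at most 2. This is
    the origin of the constant exp 2.\<close>
  have Elow: "exp (- 2) \<le> cmod (E j (z j))" if j: "j < n" for j
  proof -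
    have zj: "0 < Re (z j)" using z[OF j] \<delta> by simp
    have "Re (c k (z j)) \<le> w k / Re (z j)" if "k \<le> j" for k
    proof -
      have k: "k < n" using that j by simp
      have "Re (z j) \<le> Re (z j + cnj (z k) - of_real (2 * \<delta>))"
        using z[OF k] by simp
      also have "\<dots> \<le> cmod (z j + cnj (z k) - of_real (2 * \<delta>))"
        by (rule complex_Re_le_cmod)
      finally have le: "Re (z j) \<le> cmod (z j + cnj (z k) - of_real (2 * \<delta>))" .
      have "Re (c k (z j)) \<le> cmod (c k (z j))" by (rule complex_Re_le_cmod)
      also have "\<dots> = w k / cmod (z j + cnj (z k) - of_real (2 * \<delta>))"
        using w(1)[OF k] by (simp add: c_def norm_divide)
      also have "\<dots> \<le> w k / Re (z j)"
        using le zj w(1)[OF k] by (intro divide_left_mono mult_pos_pos) linarith+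
      finally show ?thesis .
    qed
    then have "(\<Sum>k\<le>j. Re (c k (z j))) \<le> (\<Sum>k\<le>j. w k / Re (z j))"
      by (intro sum_mono) auto
    also have "\<dots> = (\<Sum>k\<le>j. w k) / Re (z j)" by (simp add: sum_divide_distrib)
    also have "\<dots> \<le> 2" using w(2)[OF j] zj by (simp add: field_simps)
    finally show ?thesis unfolding cmodE by simp
  qed
  have contH: "continuous_on UNIV (\<lambda>t. h (Complex \<delta> t))"
    by (intro continuous_on_compose2[OF holomorphic_on_imp_continuous_on[OF h]])
      (use \<delta> in \<open>auto intro!: continuous_intros\<close>)
  have mc [measurable]: "(\<lambda>t. Complex \<delta> t) \<in> borel_measurable borel"
    by (intro borel_measurable_continuous_onI continuous_intros)
  have mH [measurable]: "H \<in> borel_measurable borel"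
    unfolding H_def by (intro borel_measurable_continuous_onI continuous_intros contH)
  have ma [measurable]: "a k \<in> borel_measurable borel" for k
    unfolding a_def d2_def by measurable
  have a0: "0 \<le> a k t" if "k < n" for k t
    unfolding a_def d2_def using w(1)[OF that] z[OF that] \<delta> by simp
  \<comment> \<open>The Poisson estimate is applied to h times \<open>E j\<close> at the point
    \<open>z j\<close>, both factors being bounded to the right of the line; multiplying the kernel
    by \<open>w j\<close> turns it into \<open>a j\<close> / pi.\<close>
  have one: "ennreal (w j * (cmod (h (z j)) * exp (- 2))) \<le>
      (\<integral>\<^sup>+t. ennreal (H t / pi * (a j t * exp (- (\<Sum>k\<le>j. a k t)))) \<partial>lborel)" if j: "j < n" for j
  proof -
    have C0: "0 \<le> C" using bd[of 1] by (simp add: order_trans[OF norm_ge_zero])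
    have "w j * (cmod (h (z j)) * exp (- 2)) \<le> w j * cmod (h (z j) * E j (z j))"
      unfolding norm_mult using w(1)[OF j] Elow[OF j] by (intro mult_left_mono) auto
    then have "ennreal (w j * (cmod (h (z j)) * exp (- 2))) \<le> ennreal (w j) * ennreal (cmod (h (z j) * E j (z j)))"
      using w(1)[OF j] by (simp add: ennreal_mult[symmetric] ennreal_leI)
    also have "\<dots> \<le> ennreal (w j) * (\<integral>\<^sup>+t. ennreal (cmod (h (Complex \<delta> t) * E j (Complex \<delta> t)) *
        ((Re (z j) - \<delta>) / (pi * (cmod (Complex \<delta> t - z j))\<^sup>2))) \<partial>lborel)"
    proof (intro mult_left_mono Poisson_bound)
      show "(\<lambda>\<zeta>. h \<zeta> * E j \<zeta>) holomorphic_on RHP"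
        by (intro holomorphic_intros h holE j)
      show "\<delta> < Re (z j)" using z[OF j] \<delta> by simp
      fix \<zeta> :: complex assume \<zeta>: "\<delta> \<le> Re \<zeta>"
      have "cmod (h \<zeta>) * cmod (E j \<zeta>) \<le> C / \<delta> * 1"
      proof (intro mult_mono E1 j)
        have "cmod (h \<zeta>) \<le> C / Re \<zeta>" using bd \<zeta> \<delta> by simp
        also have "\<dots> \<le> C / \<delta>" using \<zeta> \<delta> C0 by (intro divide_left_mono) auto
        finally show "cmod (h \<zeta>) \<le> C / \<delta>" .
      qed (use \<zeta> \<delta> C0 in auto)
      then show "cmod (h \<zeta> * E j \<zeta>) \<le> C / \<delta>" by (simp add: norm_mult)
    qed (use \<delta> in auto)
    also have "\<dots> = (\<integral>\<^sup>+t. ennreal (w j) * ennreal (cmod (h (Complex \<delta> t) * E j (Complex \<delta> t)) *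
        ((Re (z j) - \<delta>) / (pi * (cmod (Complex \<delta> t - z j))\<^sup>2))) \<partial>lborel)"
    proof (rule nn_integral_cmult[symmetric])
      have "(\<lambda>t. cmod (h (Complex \<delta> t) * E j (Complex \<delta> t)) * ((Re (z j) - \<delta>) / (pi * (cmod (Complex \<delta> t - z j))\<^sup>2)))
         = (\<lambda>t. H t * exp (- (\<Sum>k\<le>j. a k t)) * ((Re (z j) - \<delta>) / (pi * (cmod (Complex \<delta> t - z j))\<^sup>2)))"
        by (simp add: norm_mult Eline H_def)
      moreover have "\<dots> \<in> borel_measurable borel" by measurable
      ultimately show "(\<lambda>t. ennreal (cmod (h (Complex \<delta> t) * E j (Complex \<delta> t)) *
        ((Re (z j) - \<delta>) / (pi * (cmod (Complex \<delta> t - z j))\<^sup>2)))) \<in> borel_measurable lborel"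
        by (simp add: measurable_compose[OF _ measurable_ennreal])
    qed
    also have "\<dots> = (\<integral>\<^sup>+t. ennreal (H t / pi * (a j t * exp (- (\<Sum>k\<le>j. a k t)))) \<partial>lborel)"
    proof (intro nn_integral_cong)
      fix t
      have "w j * (cmod (h (Complex \<delta> t) * E j (Complex \<delta> t)) * ((Re (z j) - \<delta>) / (pi * (cmod (Complex \<delta> t - z j))\<^sup>2)))
        = H t / pi * (a j t * exp (- (\<Sum>k\<le>j. a k t)))"
        unfolding norm_mult Eline H_def[symmetric] by (simp add: a_def[of j] d2_def)
      then show "ennreal (w j) * ennreal (cmod (h (Complex \<delta> t) * E j (Complex \<delta> t)) *
        ((Re (z j) - \<delta>) / (pi * (cmod (Complex \<delta> t - z j))\<^sup>2))) = ennreal (H t / pi * (a j t * exp (- (\<Sum>k\<le>j. a k t))))"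
        using w(1)[OF j] by (simp only: ennreal_mult'[symmetric])
    qed
    finally show ?thesis .
  qed
  have "ennreal (\<Sum>j<n. w j * (cmod (h (z j)) * exp (- 2))) = (\<Sum>j<n. ennreal (w j * (cmod (h (z j)) * exp (- 2))))"
    by (intro sum_ennreal[symmetric]) (use w(1) in auto)
  also have "\<dots> \<le> (\<Sum>j<n. (\<integral>\<^sup>+t. ennreal (H t / pi * (a j t * exp (- (\<Sum>k\<le>j. a k t)))) \<partial>lborel))"
    by (intro sum_mono one) auto
  also have "\<dots> = (\<integral>\<^sup>+t. (\<Sum>j<n. ennreal (H t / pi * (a j t * exp (- (\<Sum>k\<le>j. a k t))))) \<partial>lborel)"
    by (intro nn_integral_sum[symmetric]) measurable
  \<comment> \<open>\<open>sum_mult_exp_le\<close> applies pointwise in t under the integral, so the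
    bound does not see the number n of points.\<close>
  also have "\<dots> \<le> (\<integral>\<^sup>+t. ennreal (1 / pi) * ennreal (H t) \<partial>lborel)"
  proof (intro nn_integral_mono)
    fix t
    have "(\<Sum>j<n. ennreal (H t / pi * (a j t * exp (- (\<Sum>k\<le>j. a k t)))))
      = ennreal (\<Sum>j<n. H t / pi * (a j t * exp (- (\<Sum>k\<le>j. a k t))))"
      by (intro sum_ennreal) (auto simp: H_def a0)
    also have "\<dots> = ennreal (H t / pi * (\<Sum>j<n. a j t * exp (- (\<Sum>k\<le>j. a k t))))"
      by (simp add: sum_distrib_left)
    also have "\<dots> \<le> ennreal (H t / pi * 1)"
      by (intro ennreal_leI mult_left_mono sum_mult_exp_le) (auto simp: H_def)
    also have "\<dots> = ennreal (1 / pi) * ennreal (H t)"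
      by (simp add: ennreal_mult'[symmetric])
    finally show "(\<Sum>j<n. ennreal (H t / pi * (a j t * exp (- (\<Sum>k\<le>j. a k t))))) \<le> ennreal (1 / pi) * ennreal (H t)" .
  qed
  also have "\<dots> = ennreal (1 / pi) * (\<integral>\<^sup>+t. ennreal (H t) \<partial>lborel)"
    by (intro nn_integral_cmult) measurable
  also have "\<dots> \<le> ennreal (1 / pi) * ennreal M"
    unfolding H_def by (intro mult_left_mono M(1) \<delta>) auto
  also have "\<dots> = ennreal (M / pi)"
    by (simp add: ennreal_mult'[symmetric])
  finally have "(\<Sum>j<n. w j * (cmod (h (z j)) * exp (- 2))) \<le> M / pi"
    using M(2) by (simp add: ennreal_le_iff)
  moreover have "(\<Sum>j<n. w j * (cmod (h (z j)) * exp (- 2))) = exp (- 2) * (\<Sum>j<n. w j * cmod (h (z j)))"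
    by (simp add: sum_distrib_left mult_ac)
  ultimately have "exp 2 * (exp (- 2) * (\<Sum>j<n. w j * cmod (h (z j)))) \<le> exp 2 * (M / pi)"
    by (intro mult_left_mono) auto
  moreover have "exp 2 * (exp (- 2) * (\<Sum>j<n. w j * cmod (h (z j)))) = (\<Sum>j<n. w j * cmod (h (z j)))"
    by (simp add: mult.assoc[symmetric] mult_exp_exp)
  ultimately show ?thesis by simp
qed

section \<open>The Hardy space estimate\<close>

text \<open>The set B of heights is a parameter because three choices occur: all heights, |y| \<le>
  r near the imaginary axis, and |y| \<ge> n for the decay of g.\<close>

definition vsup :: "real set \<Rightarrow> (complex \<Rightarrow> complex) \<Rightarrow> real \<Rightarrow> ennreal" where
  "vsup B h x = (SUP y\<in>B. ennreal (cmod (h (Complex x y))))"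

abbreviation vint :: "(complex \<Rightarrow> complex) \<Rightarrow> ennreal" where
  "vint h \<equiv> \<integral>\<^sup>+x\<in>{0<..}. vsup UNIV h x \<partial>lborel"

lemma vsup_upper: "y \<in> B \<Longrightarrow> ennreal (cmod (h (Complex x y))) \<le> vsup B h x"
  unfolding vsup_def by (rule SUP_upper)

lemma vsup_least: "(\<And>y. y \<in> B \<Longrightarrow> ennreal (cmod (h (Complex x y))) \<le> c) \<Longrightarrow> vsup B h x \<le> c"
  unfolding vsup_def by (rule SUP_least)

lemma vsup_mono_set: "B \<subseteq> B' \<Longrightarrow> vsup B h x \<le> vsup B' h x"
  unfolding vsup_def by (rule SUP_subset_mono) auto

text \<open>The supremum may be uncountable, so measurability comes from lower semicontinuity:
  superlevel sets are unions of open sets. The indicator is there because h is controlled only for x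
  > 0.\<close>

lemma measurable_vsup:
  assumes "continuous_on RHP h"
  shows "(\<lambda>x. vsup B h x * indicator {0<..} x) \<in> borel_measurable borel"
proof (rule borel_measurableI_greater)
  fix a :: ennreal
  have eq: "{x \<in> space borel. a < vsup B h x * indicator {0<..} x} =
      (\<Union>y\<in>B. (\<lambda>x. ennreal (cmod (h (Complex x y)))) -` {a<..} \<inter> {0<..})"
    by (auto simp: vsup_def less_SUP_iff indicator_def)
  have "open ((\<lambda>x. ennreal (cmod (h (Complex x y)))) -` {a<..} \<inter> {0<..})" for y
  proof -
    have "continuous_on {0<..} (\<lambda>x. ennreal (cmod (h (Complex x y))))"
      by (intro continuous_on_ennreal continuous_on_norm continuous_on_compose2[OF assms] continuous_on_Complex
          continuous_on_id continuous_on_const) auto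
    then show ?thesis
      unfolding continuous_on_open_vimage[OF open_greaterThan] by (elim allE impE) auto
  qed
  then show "{x \<in> space borel. a < vsup B h x * indicator {0<..} x} \<in> sets borel"
    unfolding eq by (intro borel_open open_UN) auto
qed

text \<open>The supremum over an unbounded strip need not be attained; a point reaching half of it
  costs only a factor 2. If every value could be more than doubled, the supremum would be at most
  half of itself.\<close>

lemma ex_half_sup:
  fixes f :: "'a \<Rightarrow> real"
  assumes "T \<noteq> {}" "\<And>z. z \<in> T \<Longrightarrow> 0 \<le> f z" "\<And>z. z \<in> T \<Longrightarrow> f z \<le> K"
  shows "\<exists>z\<in>T. \<forall>z'\<in>T. f z' \<le> 2 * f z"
proof (rule ccontr)
  assume n: "\<not> ?thesis"
  have bdd: "bdd_above (f ` T)" using assms(3) by (auto intro!: bdd_aboveI2[of _ _ K])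
  define s where "s = (SUP z\<in>T. f z)"
  have up: "f z \<le> s" if "z \<in> T" for z
    unfolding s_def by (rule cSUP_upper[OF that bdd])
  have half: "2 * f z \<le> s" if z: "z \<in> T" for z
  proof -
    obtain z' where "z' \<in> T" "2 * f z < f z'" using n z by (auto simp: not_le)
    then show ?thesis using up[of z'] by simp
  qed
  have "s \<le> s / 2"
    unfolding s_def using assms(1) half by (intro cSUP_least) (auto simp: s_def field_simps)
  moreover obtain z where z: "z \<in> T" using assms(1) by blast
  moreover obtain z' where "z' \<in> T" "2 * f z < f z'" using n z by (auto simp: not_le)
  ultimately show False using up[of z'] assms(2)[OF z] by simp
qed

lemma ex_step:
  fixes b :: "nat \<Rightarrow> real"
  assumes "b 0 \<le> x" "x < b n"
  shows "\<exists>j<n. b j \<le> x \<and> x < b (Suc j)"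
  using assms
proof (induction n)
  case (Suc n)
  then show ?case by (cases "x < b n") (auto intro: less_SucI)
qed auto

section \<open>Pointwise estimates for a derivative in the Hardy space\<close>

locale H1_primitive =
  fixes g :: "complex \<Rightarrow> complex" and M :: real
  assumes holg: "g holomorphic_on RHP" and M0: "0 \<le> M"
    and line: "\<And>x. 0 < x \<Longrightarrow> (\<integral>\<^sup>+y. ennreal (cmod (deriv g (Complex x y))) \<partial>lborel) \<le> ennreal M"
begin

lemma hol_deriv: "deriv g holomorphic_on RHP"
  by (rule holomorphic_deriv[OF holg open_RHP])

lemma cont_deriv: "continuous_on RHP (deriv g)"
  by (rule holomorphic_on_imp_continuous_on[OF hol_deriv])

lemma vertical_difference:
  assumes "0 < x"
  shows "cmod (g (Complex x b) - g (Complex x a)) \<le> M"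
proof -
  have *: "cmod (g (Complex x b) - g (Complex x a)) \<le> M" if "a \<le> b" for a b
  proof -
    have C: "Complex x 0 + of_real t * \<i> = Complex x t" for t
      by (simp add: complex_eq_iff)
    have "ennreal (cmod (g (Complex x b) - g (Complex x a)))
        \<le> (\<integral>\<^sup>+t\<in>{a..b}. ennreal (cmod (deriv g (Complex x t))) \<partial>lborel)"
      using line_difference_le[OF open_RHP holg that, of "Complex x 0" \<i>] assms by (simp add: C)
    also have "\<dots> \<le> (\<integral>\<^sup>+t. ennreal (cmod (deriv g (Complex x t))) \<partial>lborel)"
      by (intro nn_integral_mono) (auto simp: indicator_def)
    also have "\<dots> \<le> ennreal M" by (rule line[OF assms])
    finally show ?thesis using M0 by (simp add: ennreal_le_iff)
  qed
  show ?thesis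
    using *[of a b] *[of b a] by (cases "a \<le> b") (auto simp: norm_minus_commute)
qed

text \<open>Vertical translates of \<open>g\<close> differ by at most \<open>M\<close>, so Cauchy's inequality bounds the oscillation
  of \<open>deriv g\<close> on a vertical line; integrability makes \<open>deriv g\<close> itself small somewhere on that line.\<close>

lemma deriv_bound:
  assumes z: "0 < Re z"
  shows "cmod (deriv g z) \<le> 2 * M / Re z"
proof (rule field_le_epsilon)
  fix e :: real assume e: "0 < e"
  have "\<exists>t. cmod (deriv g (Complex (Re z) t)) \<le> e"
  proof (rule ccontr)
    assume "\<not> ?thesis"
    then have "ennreal e \<le> ennreal (cmod (deriv g (Complex (Re z) t)))" for t
      by (intro ennreal_leI) (auto simp: not_le intro: less_imp_le)
    then have "(\<integral>\<^sup>+t. ennreal e \<partial>(lborel :: real measure)) \<le> (\<integral>\<^sup>+t. ennreal (cmod (deriv g (Complex (Re z) t))) \<partial>lborel)"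
      by (intro nn_integral_mono)
    also have "\<dots> \<le> ennreal M" by (rule line[OF z])
    finally show False using e by (simp add: ennreal_mult_top top_unique)
  qed
  then obtain t where t: "cmod (deriv g (Complex (Re z) t)) \<le> e" by blast
  \<comment> \<open>Translation by i \<tau> carries z to the point of its line where |g'| is at most
    e; the derivative of k at z is the difference of the two values of g'.\<close>
  define \<tau> where "\<tau> = t - Im z"
  define k where "k = (\<lambda>w. g (w + \<i> * of_real \<tau>) - g w)"
  have holshift: "(\<lambda>w. g (w + \<i> * of_real \<tau>)) holomorphic_on RHP"
    by (rule holomorphic_on_compose_gen[OF _ holg, unfolded o_def]) (auto intro!: holomorphic_intros simp: RHP_def)
  have holk: "k holomorphic_on RHP"
    unfolding k_def by (intro holomorphic_intros holshift holg)
  have kM: "cmod (k w) \<le> M" if "w \<in> RHP" for w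
  proof -
    have "w + \<i> * of_real \<tau> = Complex (Re w) (Im w + \<tau>)" "w = Complex (Re w) (Im w)"
      by (auto simp: complex_eq_iff)
    then show ?thesis
      using vertical_difference[of "Re w" "Im w + \<tau>" "Im w"] that by (simp add: k_def RHP_def)
  qed
  have zR: "z \<in> RHP" "z + \<i> * of_real \<tau> \<in> RHP" using z by (auto simp: RHP_def)
  have sub: "w \<in> RHP" if "cmod (z - w) < Re z" for w
    using that abs_Re_le_cmod[of "z - w"] by (simp add: RHP_def abs_le_iff)
  have r: "cmod (deriv k z) \<le> M / r" if "0 < r" "r < Re z" for r
  proof -
    have "norm ((deriv ^^ 1) k z) \<le> fact 1 * M / r ^ 1"
    proof (rule Cauchy_inequality)
      show "k holomorphic_on ball z r"
        using that sub by (intro holomorphic_on_subset[OF holk]) (auto simp: dist_norm)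
      show "continuous_on (cball z r) k"
        using that sub by (intro continuous_on_subset[OF holomorphic_on_imp_continuous_on[OF holk]]) (auto simp: dist_norm)
      show "cmod (k x) \<le> M" if "cmod (z - x) = r" for x
        using that \<open>r < Re z\<close> sub kM by simp
    qed (use that in auto)
    then show ?thesis by simp
  qed
  have "deriv k z = deriv g (z + \<i> * of_real \<tau>) - deriv g z"
  proof (rule DERIV_imp_deriv)
    have "(g has_field_derivative deriv g (z + \<i> * of_real \<tau>)) (at (z + \<i> * of_real \<tau>))"
      by (rule holomorphic_derivI[OF holg open_RHP zR(2)])
    then have "((\<lambda>w. g (w + \<i> * of_real \<tau>)) has_field_derivative deriv g (z + \<i> * of_real \<tau>)) (at z)"
      by (simp add: DERIV_shift)
    then show "(k has_field_derivative deriv g (z + \<i> * of_real \<tau>) - deriv g z) (at z)"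
      unfolding k_def using holomorphic_derivI[OF holg open_RHP zR(1)] by (rule DERIV_diff)
  qed
  moreover have "z + \<i> * of_real \<tau> = Complex (Re z) t"
    by (simp add: complex_eq_iff \<tau>_def)
  ultimately have "cmod (deriv g z) \<le> cmod (deriv k z) + cmod (deriv g (Complex (Re z) t))"
    by (metis norm_triangle_sub norm_minus_commute add.commute)
  also have "\<dots> \<le> 2 * M / Re z + e"
    using add_mono[OF r[of "Re z / 2"] t] z by (simp add: mult.commute)
  finally show "cmod (deriv g z) \<le> 2 * M / Re z + e" .
qed

text \<open>Cauchy's inequality on circles of radius x / 2, where \<open>deriv_bound\<close> gives
  at most 4 M / x, bounds g'' by 8 M / x^2 on the line.\<close>

lemma deriv_lipschitz:
  assumes x: "0 < x"
  shows "cmod (deriv g (Complex x s) - deriv g (Complex x t)) \<le> 8 * M / x\<^sup>2 * \<bar>s - t\<bar>"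
proof -
  have dd: "cmod (deriv (deriv g) z) \<le> 8 * M / x\<^sup>2" if z: "Re z = x" for z
  proof -
    have sub: "x / 2 \<le> Re w" if "cmod (z - w) \<le> x / 2" for w
      using that abs_Re_le_cmod[of "z - w"] z by (simp add: abs_le_iff)
    have "norm ((deriv ^^ 1) (deriv g) z) \<le> fact 1 * (4 * M / x) / (x / 2) ^ 1"
    proof (rule Cauchy_inequality)
      have R: "w \<in> RHP" if "cmod (z - w) \<le> x / 2" for w
        using sub[OF that] x by (simp add: RHP_def)
      show "deriv g holomorphic_on ball z (x / 2)"
        using R by (intro holomorphic_on_subset[OF hol_deriv]) (auto simp: dist_norm)
      show "continuous_on (cball z (x / 2)) (deriv g)"
        using R by (intro continuous_on_subset[OF cont_deriv]) (auto simp: dist_norm)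
      fix w assume w: "cmod (z - w) = x / 2"
      have "cmod (deriv g w) \<le> 2 * M / Re w"
        using sub[of w] w x by (intro deriv_bound) auto
      also have "\<dots> \<le> 2 * M / (x / 2)"
        using sub[of w] w x M0 by (intro divide_left_mono mult_pos_pos) auto
      finally show "cmod (deriv g w) \<le> 4 * M / x" by simp
    qed (use x in auto)
    then show ?thesis by (simp add: power2_eq_square)
  qed
  have "convex {z. Re z = x}"
    using convex_hyperplane[of "1 :: complex" x] by (simp add: inner_complex_def)
  then have "cmod (deriv g (Complex x s) - deriv g (Complex x t)) \<le> 8 * M / x\<^sup>2 * cmod (Complex x s - Complex x t)"
  proof (rule field_differentiable_bound)
    fix z assume "z \<in> {z. Re z = x}"
    then show "(deriv g has_field_derivative deriv (deriv g) z) (at z within {z. Re z = x})"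
      using x by (intro DERIV_subset[OF holomorphic_derivI[OF hol_deriv open_RHP]]) (auto simp: RHP_def)
  qed (use dd in auto)
  then show ?thesis by (simp add: cmod_eq_Im)
qed

text \<open>An integrable Lipschitz function on a line tends to zero: a value above e would stay at
  least e / 2 on an interval of fixed length \<eta>, more than the small tail of the integral
  allows.\<close>

lemma vertical_decay:
  assumes x: "0 < x" and e: "0 < e"
  obtains r where "0 < r" "\<And>y. r \<le> \<bar>y\<bar> \<Longrightarrow> cmod (deriv g (Complex x y)) \<le> e"
proof -
  define L where "L = 8 * M / x\<^sup>2 + 1"
  have L: "0 < L" using M0 x by (simp add: L_def add_nonneg_pos)
  define \<eta> where "\<eta> = e / (2 * L)"
  have \<eta>: "0 < \<eta>" using e L by (simp add: \<eta>_def)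
  have "(\<lambda>y. deriv g (Complex x y)) \<in> borel_measurable borel"
    by (rule measurable_Complex_line[OF cont_deriv x])
  then have m: "(\<lambda>y. ennreal (cmod (deriv g (Complex x y)))) \<in> borel_measurable borel"
    by measurable
  have "(\<integral>\<^sup>+y. ennreal (cmod (deriv g (Complex x y))) \<partial>lborel) < top"
    using line[OF x] by (simp add: le_less_trans)
  then obtain r where r: "0 < r"
    "(\<integral>\<^sup>+t. ennreal (cmod (deriv g (Complex x t))) * indicator {t. r \<le> \<bar>t\<bar>} t \<partial>lborel) < ennreal (e / 2 * \<eta>)"
    using tail_nn_integral[OF m, of "ennreal (e / 2 * \<eta>)"] e \<eta> by auto
  have "cmod (deriv g (Complex x y)) \<le> e" if y: "r \<le> \<bar>y\<bar>" for y
  proof (rule ccontr)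
    assume "\<not> ?thesis"
    then have big: "e < cmod (deriv g (Complex x y))" by simp
    \<comment> \<open>The interval is laid on the side of y away from 0, so that it stays within |t|
      \<ge> r.\<close>
    define a where "a = (if 0 \<le> y then y else y - \<eta>)"
    have "ennreal (e / 2) * indicator {a..a + \<eta>} t \<le>
        ennreal (cmod (deriv g (Complex x t))) * indicator {t. r \<le> \<bar>t\<bar>} t" for t
    proof (cases "t \<in> {a..a + \<eta>}")
      case True
      then have t: "\<bar>y - t\<bar> \<le> \<eta>" "r \<le> \<bar>t\<bar>"
        using y \<eta> by (auto simp: a_def abs_if split: if_splits)
      have "cmod (deriv g (Complex x y) - deriv g (Complex x t)) \<le> 8 * M / x\<^sup>2 * \<bar>y - t\<bar>"
        by (rule deriv_lipschitz[OF x])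
      also have "\<dots> \<le> L * \<eta>"
        using t M0 x L by (intro mult_mono) (auto simp: L_def)
      also have "\<dots> = e / 2" using L by (simp add: \<eta>_def)
      finally have "e / 2 \<le> cmod (deriv g (Complex x t))"
        using big norm_triangle_ineq2[of "deriv g (Complex x y)" "deriv g (Complex x t)"] by simp
      then show ?thesis using True t by (simp add: ennreal_leI)
    qed simp
    then have "(\<integral>\<^sup>+t. ennreal (e / 2) * indicator {a..a + \<eta>} t \<partial>lborel) \<le>
      (\<integral>\<^sup>+t. ennreal (cmod (deriv g (Complex x t))) * indicator {t. r \<le> \<bar>t\<bar>} t \<partial>lborel)"
      by (intro nn_integral_mono)
    moreover have "(\<integral>\<^sup>+t. ennreal (e / 2) * indicator {a..a + \<eta>} t \<partial>lborel) = ennreal (e / 2 * \<eta>)"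
      using \<eta> e by (simp add: nn_integral_cmult_indicator ennreal_mult'[symmetric])
    ultimately show False using r(2) by simp
  qed
  then show thesis using r(1) that by blast
qed

text \<open>The test points are near-maximal points of the dyadic strips, weighted by the strip
  widths \<open>b j\<close>. Since widths double, their partial sums are at most 2
  \<open>b j\<close> \<le> 2 Re (z j), which is the weight condition of
  \<open>Jones_weighted_sum\<close>. What matters is that the right-hand side is independent of
  m.\<close>

lemma dyadic_bound:
  "(\<integral>\<^sup>+x\<in>{1 / 2 ^ m..<2 ^ m}. vsup UNIV (deriv g) x \<partial>lborel) \<le> ennreal (2 * (exp 2 / pi * M))"
proof -
  define b :: "nat \<Rightarrow> real" where "b j = 2 ^ j / 2 ^ m" for j
  have b0: "0 < b j" "b (Suc j) = 2 * b j" for j by (auto simp: b_def)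
  define T where "T j = {z. b j \<le> Re z \<and> Re z < b (Suc j)}" for j
  have "\<exists>z\<in>T j. \<forall>z'\<in>T j. cmod (deriv g z') \<le> 2 * cmod (deriv g z)" for j
  proof (rule ex_half_sup)
    have "Complex (b j) 0 \<in> T j" using b0[of j] by (simp add: T_def)
    then show "T j \<noteq> {}" by blast
    fix z assume z: "z \<in> T j"
    then have "0 < Re z" using b0[of j] by (simp add: T_def)
    then have "cmod (deriv g z) \<le> 2 * M / Re z" by (rule deriv_bound)
    also have "\<dots> \<le> 2 * M / b j"
      using z b0[of j] M0 by (intro divide_left_mono mult_pos_pos) (auto simp: T_def)
    finally show "cmod (deriv g z) \<le> 2 * M / b j" .
  qed auto
  then obtain z where zT: "\<And>j. z j \<in> T j"
    and zmax: "\<And>j z'. z' \<in> T j \<Longrightarrow> cmod (deriv g z') \<le> 2 * cmod (deriv g (z j))"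
    by metis
  define n where "n = 2 * m"
  have bn: "b 0 = 1 / 2 ^ m" "b n = 2 ^ m"
    by (auto simp: b_def n_def mult_2 power_add)
  \<comment> \<open>With \<delta> = \<open>b 0 / 2\<close> the condition 2 \<delta> \<le> Re (z j)
    holds already in the lowest strip; \<delta> shrinks with m but does not enter the bound.\<close>
  have J: "(\<Sum>j<n. b j * cmod (deriv g (z j))) \<le> exp 2 / pi * M"
  proof (rule Jones_weighted_sum[OF hol_deriv line M0 deriv_bound, where \<delta> = "b 0 / 2"])
    show "2 * (b 0 / 2) \<le> Re (z j)" for j
    proof -
      have "b 0 \<le> b j" by (simp add: b_def divide_right_mono)
      then show ?thesis using zT[of j] by (simp add: T_def)
    qed
    show "(\<Sum>k\<le>j. b k) \<le> 2 * Re (z j)" for j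
    proof -
      have "(\<Sum>k\<le>j. b k) \<le> 2 * b j"
      proof (induction j)
        case (Suc j)
        then show ?case using b0[of j] by simp
      qed (use b0[of 0] in simp)
      then show ?thesis using zT[of j] by (simp add: T_def)
    qed
  qed (use b0 in \<open>auto intro: less_imp_le\<close>)
  have pw: "vsup UNIV (deriv g) x * indicator {1 / 2 ^ m..<2 ^ m} x \<le>
      (\<Sum>j<n. ennreal (2 * cmod (deriv g (z j))) * indicator {b j..<b (Suc j)} x)" for x
  proof (cases "x \<in> {1 / 2 ^ m..<2 ^ m}")
    case True
    then obtain j where j: "j < n" "b j \<le> x" "x < b (Suc j)"
      using ex_step[of b x n] bn by auto
    have "vsup UNIV (deriv g) x \<le> ennreal (2 * cmod (deriv g (z j)))"
      using j by (intro vsup_least ennreal_leI zmax) (auto simp: T_def)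
    also have "\<dots> = ennreal (2 * cmod (deriv g (z j))) * indicator {b j..<b (Suc j)} x"
      using j by simp
    also have "\<dots> \<le> (\<Sum>j<n. ennreal (2 * cmod (deriv g (z j))) * indicator {b j..<b (Suc j)} x)"
      using j by (intro member_le_sum) auto
    finally show ?thesis using True by simp
  qed simp
  have "(\<integral>\<^sup>+x\<in>{1 / 2 ^ m..<2 ^ m}. vsup UNIV (deriv g) x \<partial>lborel) \<le>
      (\<integral>\<^sup>+x. (\<Sum>j<n. ennreal (2 * cmod (deriv g (z j))) * indicator {b j..<b (Suc j)} x) \<partial>lborel)"
    by (intro nn_integral_mono pw)
  also have "\<dots> = (\<Sum>j<n. \<integral>\<^sup>+x. ennreal (2 * cmod (deriv g (z j))) * indicator {b j..<b (Suc j)} x \<partial>lborel)"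
    by (intro nn_integral_sum) measurable
  also have "\<dots> = (\<Sum>j<n. ennreal (2 * (b j * cmod (deriv g (z j)))))"
    using b0 by (intro sum.cong refl) (simp add: nn_integral_cmult_indicator ennreal_mult'[symmetric] mult_ac less_imp_le)
  also have "\<dots> = ennreal (\<Sum>j<n. 2 * (b j * cmod (deriv g (z j))))"
    using b0 by (intro sum_ennreal) (auto intro!: mult_nonneg_nonneg simp: less_imp_le)
  also have "\<dots> \<le> ennreal (2 * (exp 2 / pi * M))"
    using J by (intro ennreal_leI) (simp add: sum_distrib_left[symmetric])
  finally show ?thesis .
qed

text \<open>The dyadic bounds are uniform in m and the intervals exhaust the half-line; continuity
  from below is applied to the measure whose density is the line supremum.\<close>

lemma vint_bound: "vint (deriv g) \<le> ennreal (2 * (exp 2 / pi * M))"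
proof -
  define f where "f x = vsup UNIV (deriv g) x * indicator {0<..} x" for x
  have [measurable]: "f \<in> borel_measurable borel"
    unfolding f_def by (rule measurable_vsup[OF cont_deriv])
  define I where "I m = {1 / 2 ^ m..<2 ^ m :: real}" for m :: nat
  have "incseq I"
    by (rule incseq_SucI) (auto simp: I_def field_simps intro: order_trans less_le_trans)
  have U: "(\<Union>m. I m) = {0<..}"
  proof
    show "(\<Union>m. I m) \<subseteq> {0<..}"
      by (auto simp: I_def intro: less_le_trans[of 0 "1 / 2 ^ _"])
    show "{0<..} \<subseteq> (\<Union>m. I m)"
    proof
      fix x :: real assume x: "x \<in> {0<..}"
      obtain m :: nat where m: "max x (1 / x) < real m" using reals_Archimedean2 by blast
      have "real m < 2 ^ m" by (rule of_nat_less_two_power)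
      then have "x < 2 ^ m" "1 / x \<le> 2 ^ m" using m by linarith+
      then have "x \<in> I m" using x by (simp add: I_def field_simps)
      then show "x \<in> (\<Union>m. I m)" by blast
    qed
  qed
  have I: "range I \<subseteq> sets (density lborel f)" by (auto simp: I_def)
  have "vint (deriv g) = emeasure (density lborel f) {0<..}"
    by (subst emeasure_density) (auto simp: f_def indicator_def intro!: nn_integral_cong)
  also have "\<dots> = (SUP m. emeasure (density lborel f) (I m))"
    using SUP_emeasure_incseq[OF I \<open>incseq I\<close>] U by simp
  also have "\<dots> \<le> ennreal (2 * (exp 2 / pi * M))"
  proof (rule SUP_least)
    fix m
    have "emeasure (density lborel f) (I m) \<le> (\<integral>\<^sup>+x\<in>I m. vsup UNIV (deriv g) x \<partial>lborel)"
      by (subst emeasure_density) (auto simp: I_def f_def indicator_def intro!: nn_integral_mono)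
    then show "emeasure (density lborel f) (I m) \<le> ennreal (2 * (exp 2 / pi * M))"
      using dyadic_bound[of m] by (simp add: I_def)
  qed
  finally show ?thesis .
qed

end

section \<open>Normal families and lower semicontinuity\<close>

lemma normal_pointwise_limit:
  fixes u :: "nat \<Rightarrow> complex \<Rightarrow> complex"
  assumes S: "open S" and hol: "\<And>n. u n holomorphic_on S"
    and bd: "\<And>K. compact K \<Longrightarrow> K \<subseteq> S \<Longrightarrow> \<exists>B. \<forall>n. \<forall>z\<in>K. cmod (u n z) \<le> B"
    and lim: "\<And>z. z \<in> S \<Longrightarrow> (\<lambda>n. u n z) \<longlonglongrightarrow> v z"
  shows "v holomorphic_on S"
    and "\<And>K. compact K \<Longrightarrow> K \<subseteq> S \<Longrightarrow> uniform_limit K u v sequentially"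
proof -
  \<comment> \<open>Montel's theorem gives locally uniform limits only along subsequences; pointwise
    convergence identifies all of them with v. A failure of uniform convergence on K would produce a
    subsequence without such a further subsequence.\<close>
  have sub: "\<exists>h r. h holomorphic_on S \<and> strict_mono r \<and> (\<forall>z\<in>S. h z = v z) \<and>
      (\<forall>K. compact K \<longrightarrow> K \<subseteq> S \<longrightarrow> uniform_limit K (u \<circ> s \<circ> r) v sequentially)"
    if s: "strict_mono s" for s :: "nat \<Rightarrow> nat"
  proof -
    obtain h r where hr: "h holomorphic_on S" "strict_mono (r :: nat \<Rightarrow> nat)"
        "\<And>z. z \<in> S \<Longrightarrow> (\<lambda>n. (u \<circ> s) (r n) z) \<longlonglongrightarrow> h z"
        "\<And>K. compact K \<Longrightarrow> K \<subseteq> S \<Longrightarrow> uniform_limit K ((u \<circ> s) \<circ> r) h sequentially"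
    proof (rule Montel[OF S, of "range (u \<circ> s)" "u \<circ> s"])
      show "\<And>h. h \<in> range (u \<circ> s) \<Longrightarrow> h holomorphic_on S" using hol by auto
      show "\<And>K. compact K \<Longrightarrow> K \<subseteq> S \<Longrightarrow> \<exists>B. \<forall>h\<in>range (u \<circ> s). \<forall>z\<in>K. cmod (h z) \<le> B"
        using bd by fastforce
    qed (auto intro: that)
    have eq: "h z = v z" if "z \<in> S" for z
    proof -
      have "((\<lambda>n. u n z) \<circ> (s \<circ> r)) \<longlonglongrightarrow> v z"
        by (rule LIMSEQ_subseq_LIMSEQ[OF lim[OF that] strict_mono_o[OF s hr(2)]])
      then show ?thesis using hr(3)[OF that] LIMSEQ_unique by (auto simp: o_def)
    qed
    have "uniform_limit K (u \<circ> s \<circ> r) v sequentially" if "compact K" "K \<subseteq> S" for K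
      using hr(4)[OF that] eq that(2) by (subst uniform_limit_cong'[where g="u \<circ> s \<circ> r" and i=h]) auto
    then show ?thesis using hr(1,2) eq by blast
  qed
  obtain h where "h holomorphic_on S" "\<forall>z\<in>S. h z = v z"
    using sub[OF strict_mono_id] by blast
  then show "v holomorphic_on S" by (metis holomorphic_cong)
  fix K assume K: "compact K" "K \<subseteq> S"
  show "uniform_limit K u v sequentially"
  proof (rule ccontr)
    assume "\<not> ?thesis"
    then obtain e where e: "0 < e" "\<not> (\<forall>\<^sub>F n in sequentially. \<forall>z\<in>K. dist (u n z) (v z) < e)"
      by (auto simp: uniform_limit_iff)
    define P where "P = {n. \<not> (\<forall>z\<in>K. dist (u n z) (v z) < e)}"
    have "infinite P"
      using e(2) unfolding P_def eventually_sequentially infinite_nat_iff_unbounded_le by blast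
    then have s: "strict_mono (enumerate P)" "\<And>n. enumerate P n \<in> P"
      by (auto simp: strict_mono_enumerate enumerate_in_set)
    obtain r where "strict_mono (r :: nat \<Rightarrow> nat)" "uniform_limit K (u \<circ> enumerate P \<circ> r) v sequentially"
      using sub[OF s(1)] K by blast
    then have "\<forall>\<^sub>F n in sequentially. \<forall>z\<in>K. dist (u (enumerate P (r n)) z) (v z) < e"
      using e(1) by (auto simp: uniform_limit_iff)
    then obtain n where "\<forall>z\<in>K. dist (u (enumerate P (r n)) z) (v z) < e"
      by (auto simp: eventually_sequentially)
    then show False using s(2)[of "r n"] by (simp add: P_def)
  qed
qed

lemma vsup_le_liminf:
  assumes "\<And>y. y \<in> B \<Longrightarrow> (\<lambda>n. u n (Complex x y)) \<longlonglongrightarrow> v (Complex x y)"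
  shows "vsup B v x \<le> liminf (\<lambda>n. vsup B (u n) x)"
proof (rule vsup_least)
  fix y assume y: "y \<in> B"
  have "(\<lambda>n. ennreal (cmod (u n (Complex x y)))) \<longlonglongrightarrow> ennreal (cmod (v (Complex x y)))"
    by (intro tendsto_ennrealI tendsto_norm assms y)
  then have "ennreal (cmod (v (Complex x y))) = liminf (\<lambda>n. ennreal (cmod (u n (Complex x y))))"
    by (rule lim_imp_Liminf[OF sequentially_bot, symmetric])
  also have "\<dots> \<le> liminf (\<lambda>n. vsup B (u n) x)"
    by (intro Liminf_mono always_eventually allI vsup_upper y)
  finally show "ennreal (cmod (v (Complex x y))) \<le> liminf (\<lambda>n. vsup B (u n) x)" .
qed

text \<open>A supremum of limits is at most the lower limit of the suprema, and Fatou's lemma does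
  the rest. This is how the variation bound and the smallness near the axis pass from the sequence
  to its limit.\<close>

lemma vsup_Fatou:
  assumes A: "A \<in> sets borel" "A \<subseteq> {0<..}"
    and cont: "\<And>n. continuous_on RHP (u n)"
    and lim: "\<And>z. z \<in> RHP \<Longrightarrow> (\<lambda>n. u n z) \<longlonglongrightarrow> v z"
    and le: "\<And>n. (\<integral>\<^sup>+x\<in>A. vsup B (u n) x \<partial>lborel) \<le> c"
  shows "(\<integral>\<^sup>+x\<in>A. vsup B v x \<partial>lborel) \<le> c"
proof -
  have eq: "vsup B (u n) x * indicator A x = vsup B (u n) x * indicator {0<..} x * indicator A x" for n x
    using A by (auto simp: indicator_def)
  have m: "(\<lambda>x. vsup B (u n) x * indicator A x) \<in> borel_measurable lborel" for n
    unfolding eq using measurable_vsup[OF cont[of n], of B] A by auto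
  have "(\<integral>\<^sup>+x\<in>A. vsup B v x \<partial>lborel) \<le> (\<integral>\<^sup>+x. liminf (\<lambda>n. vsup B (u n) x * indicator A x) \<partial>lborel)"
  proof (intro nn_integral_mono)
    fix x
    show "vsup B v x * indicator A x \<le> liminf (\<lambda>n. vsup B (u n) x * indicator A x)"
    proof (cases "x \<in> A")
      case True
      then have "vsup B v x \<le> liminf (\<lambda>n. vsup B (u n) x)"
        using A by (intro vsup_le_liminf lim) auto
      then show ?thesis using True by simp
    qed simp
  qed
  also have "\<dots> \<le> liminf (\<lambda>n. \<integral>\<^sup>+x\<in>A. vsup B (u n) x \<partial>lborel)"
    by (rule nn_integral_liminf[OF m])
  also have "\<dots> \<le> liminf (\<lambda>n::nat. c)"
    by (intro Liminf_mono always_eventually allI le)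
  also have "\<dots> = c" by (simp add: Liminf_const)
  finally show ?thesis .
qed

section \<open>Uniform decay of the primitive\<close>

locale H1_primitive_vanishing = H1_primitive +
  assumes vanish: "(g \<longlongrightarrow> 0) (filtercomap Re at_top)"
begin

lemma cont_g: "continuous_on RHP g"
  by (rule holomorphic_on_imp_continuous_on[OF holg])

lemma g_far:
  assumes "0 < e"
  obtains X where "0 < X" "\<And>z. X \<le> Re z \<Longrightarrow> cmod (g z) \<le> e"
proof -
  have "\<forall>\<^sub>F z in filtercomap Re at_top. dist (g z) 0 < e"
    using vanish assms by (rule tendstoD)
  then obtain N where "\<And>z. N \<le> Re z \<Longrightarrow> cmod (g z) < e"
    by (auto simp: eventually_filtercomap_at_top_linorder)
  then show thesis by (intro that[of "max N 1"]) (auto intro: less_imp_le)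
qed

text \<open>Integrate g' to the right as far as a point where |g| is at most e, with e arbitrary.
  The right-hand side does not depend on x, which makes later bounds uniform up to the imaginary
  axis.\<close>

lemma g_le_integral:
  assumes x: "0 < x"
  shows "ennreal (cmod (g (Complex x y))) \<le> (\<integral>\<^sup>+t\<in>{0<..}. ennreal (cmod (deriv g (Complex t y))) \<partial>lborel)" (is "_ \<le> ?I")
proof (rule ennreal_le_epsilon)
  fix e :: real assume e: "0 < e"
  obtain X where X: "0 < X" "\<And>z. X \<le> Re z \<Longrightarrow> cmod (g z) \<le> e"
    using g_far[OF e] by blast
  define b where "b = max X x"
  have C: "Complex 0 y + of_real t = Complex t y" for t
    by (simp add: complex_eq_iff)
  have "ennreal (cmod (g (Complex b y) - g (Complex x y))) \<le> (\<integral>\<^sup>+t\<in>{x..b}. ennreal (cmod (deriv g (Complex t y))) \<partial>lborel)"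
    using line_difference_le[OF open_RHP holg, of x b "Complex 0 y" 1] x by (simp add: b_def C)
  also have "\<dots> \<le> ?I"
    using x by (intro nn_integral_mono) (auto simp: indicator_def)
  finally have le: "ennreal (cmod (g (Complex b y) - g (Complex x y))) \<le> ?I" .
  have "cmod (g (Complex x y)) \<le> cmod (g (Complex b y) - g (Complex x y)) + e"
    using X(2)[of "Complex b y"] norm_triangle_ineq4[of "g (Complex b y)" "g (Complex b y) - g (Complex x y)"]
    by (simp add: b_def)
  then have "ennreal (cmod (g (Complex x y))) \<le> ennreal (cmod (g (Complex b y) - g (Complex x y))) + ennreal e"
    using e by (simp add: ennreal_leI ennreal_plus[symmetric] del: ennreal_plus)
  also have "\<dots> \<le> ?I + ennreal e"
    by (intro add_right_mono le)
  finally show "ennreal (cmod (g (Complex x y))) \<le> ?I + ennreal e" .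
qed

definition G where "G = 2 * (exp 2 / pi * M)"

lemma G_nonneg: "0 \<le> G"
  using M0 by (simp add: G_def)

lemma g_bound:
  assumes "z \<in> RHP"
  shows "cmod (g z) \<le> G"
proof -
  have "ennreal (cmod (g (Complex (Re z) (Im z)))) \<le> (\<integral>\<^sup>+t\<in>{0<..}. ennreal (cmod (deriv g (Complex t (Im z)))) \<partial>lborel)"
    using assms by (intro g_le_integral) (simp add: RHP_def)
  also have "\<dots> \<le> vint (deriv g)"
    by (intro nn_integral_mono mult_right_mono vsup_upper) auto
  also have "\<dots> \<le> ennreal G" unfolding G_def by (rule vint_bound)
  finally show ?thesis using G_nonneg by (simp add: ennreal_le_iff)
qed

text \<open>The integral of the supremum of |g'| over heights |y| \<ge> n tends to 0 by dominated
  convergence: \<open>vint_bound\<close> makes the majorant integrable and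
  \<open>vertical_decay\<close> gives the pointwise limit. \<open>g_le_integral\<close> at the
  height of z transfers this to g.\<close>

lemma g_high:
  assumes e: "0 < e"
  obtains r where "0 < r" "\<And>z. z \<in> RHP \<Longrightarrow> r \<le> \<bar>Im z\<bar> \<Longrightarrow> cmod (g z) \<le> e"
proof -
  define B where "B n = {y. real n \<le> \<bar>y\<bar>}" for n
  define u where "u n x = vsup (B n) (deriv g) x * indicator {0<..} x" for n x
  have "(\<lambda>n. \<integral>\<^sup>+x. u n x \<partial>lborel) \<longlonglongrightarrow> (\<integral>\<^sup>+x. 0 \<partial>(lborel :: real measure))"
  proof (rule nn_integral_dominated_convergence[where w="\<lambda>x. vsup UNIV (deriv g) x * indicator {0<..} x"])
    show "u n \<in> borel_measurable lborel" for n
      unfolding u_def using measurable_vsup[OF cont_deriv] by simp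
    show "(\<lambda>x. vsup UNIV (deriv g) x * indicator {0<..} x) \<in> borel_measurable lborel"
      using measurable_vsup[OF cont_deriv] by simp
    show "AE x in lborel. u n x \<le> vsup UNIV (deriv g) x * indicator {0<..} x" for n
      unfolding u_def by (intro AE_I2 mult_right_mono vsup_mono_set) auto
    show "vint (deriv g) < \<infinity>"
      using vint_bound by (simp add: le_less_trans)
    show "AE x in lborel. (\<lambda>n. u n x) \<longlonglongrightarrow> 0"
    proof (intro AE_I2)
      fix x :: real
      show "(\<lambda>n. u n x) \<longlonglongrightarrow> 0"
      proof (cases "0 < x")
        case True
        show ?thesis
        proof (rule order_tendstoI)
          fix a :: ennreal assume "0 < a"
          then obtain c where c: "0 < c" "c < a" using dense by blast
          then obtain d where d: "0 < d" "ennreal d < a"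
            by (cases c) (auto simp: top_unique)
          obtain r where r: "0 < r" "\<And>y. r \<le> \<bar>y\<bar> \<Longrightarrow> cmod (deriv g (Complex x y)) \<le> d"
            using vertical_decay[OF True d(1)] by blast
          obtain N :: nat where N: "r < real N" using reals_Archimedean2 by blast
          show "\<forall>\<^sub>F n in sequentially. u n x < a"
          proof (rule eventually_sequentiallyI[of N])
            fix n assume "N \<le> n"
            then have "vsup (B n) (deriv g) x \<le> ennreal d"
              using N by (intro vsup_least ennreal_leI r(2)) (auto simp: B_def)
            then show "u n x < a" using True d by (simp add: u_def le_less_trans)
          qed
        qed simp
      qed (simp add: u_def)
    qed
  qed simp_all
  then have "\<forall>\<^sub>F n in sequentially. (\<integral>\<^sup>+x. u n x \<partial>lborel) < ennreal e"
    using e by (intro order_tendstoD) auto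
  then obtain N where N: "\<And>n. N \<le> n \<Longrightarrow> (\<integral>\<^sup>+x. u n x \<partial>lborel) < ennreal e"
    by (auto simp: eventually_sequentially)
  show thesis
  proof (rule that[of "real (Suc N)"])
    fix z assume z: "z \<in> RHP" "real (Suc N) \<le> \<bar>Im z\<bar>"
    have "ennreal (cmod (g (Complex (Re z) (Im z)))) \<le> (\<integral>\<^sup>+t\<in>{0<..}. ennreal (cmod (deriv g (Complex t (Im z)))) \<partial>lborel)"
      using z by (intro g_le_integral) (simp add: RHP_def)
    also have "\<dots> \<le> (\<integral>\<^sup>+x. u (Suc N) x \<partial>lborel)"
      unfolding u_def using z by (intro nn_integral_mono mult_right_mono vsup_upper) (auto simp: B_def)
    also have "\<dots> < ennreal e" by (rule N) simp
    finally show "cmod (g z) \<le> e" using e by (simp add: ennreal_less_iff)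
  qed simp
qed

end

section \<open>Convergence in the Besov seminorm\<close>

lemma vsup_add_le: "vsup B (\<lambda>z. u z + v z) x \<le> vsup B u x + vsup B v x"
proof (rule vsup_least)
  fix y assume y: "y \<in> B"
  have "ennreal (cmod (u (Complex x y) + v (Complex x y))) \<le> ennreal (cmod (u (Complex x y))) + ennreal (cmod (v (Complex x y)))"
    by (simp add: ennreal_leI norm_triangle_ineq ennreal_plus[symmetric] del: ennreal_plus)
  also have "\<dots> \<le> vsup B u x + vsup B v x"
    by (intro add_mono vsup_upper y)
  finally show "ennreal (cmod (u (Complex x y) + v (Complex x y))) \<le> vsup B u x + vsup B v x" .
qed

lemma bounded_holomorphic_deriv_bound:
  assumes u: "u holomorphic_on RHP" and C: "\<And>z. z \<in> RHP \<Longrightarrow> cmod (u z) \<le> C" and "z \<in> RHP"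
  shows "cmod (deriv u z) \<le> 2 * C / Re z"
proof -
  have z: "0 < Re z" using assms by (simp add: RHP_def)
  have R: "w \<in> RHP" if "cmod (z - w) \<le> Re z / 2" for w
    using that z abs_Re_le_cmod[of "z - w"] by (simp add: RHP_def abs_le_iff)
  have "norm ((deriv ^^ 1) u z) \<le> fact 1 * C / (Re z / 2) ^ 1"
  proof (rule Cauchy_inequality)
    show "u holomorphic_on ball z (Re z / 2)"
      using R by (intro holomorphic_on_subset[OF u]) (auto simp: dist_norm)
    show "continuous_on (cball z (Re z / 2)) u"
      using R by (intro continuous_on_subset[OF holomorphic_on_imp_continuous_on[OF u]]) (auto simp: dist_norm)
  qed (use z R C in auto)
  then show ?thesis by (simp add: mult.commute)
qed

text \<open>One constant C bounds both the functions and their variation. The limit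
  \<open>f0\<close> is kept apart from the sequence, which is later instantiated with
  \<open>f (Suc n)\<close>.\<close>

locale B_convergence = H1_primitive_vanishing +
  fixes f :: "nat \<Rightarrow> complex \<Rightarrow> complex" and f0 :: "complex \<Rightarrow> complex" and C :: real
  assumes holf: "\<And>n. f n holomorphic_on RHP"
    and C0: "0 \<le> C"
    and fC: "\<And>n z. z \<in> RHP \<Longrightarrow> cmod (f n z) \<le> C"
    and var: "\<And>n. vint (deriv (f n)) \<le> ennreal C"
    and lim: "\<And>z. z \<in> RHP \<Longrightarrow> (\<lambda>n. f n z) \<longlonglongrightarrow> f0 z"
    and unif: "\<And>r e. 0 < r \<Longrightarrow> 0 < e \<Longrightarrow>
      \<exists>\<delta>>0. \<forall>n. (\<integral>\<^sup>+x\<in>{0<..<\<delta>}. vsup {-r..r} (deriv (f n)) x \<partial>lborel) \<le> ennreal e"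
begin

lemma locally_bounded: "\<exists>B. \<forall>n. \<forall>z\<in>K. cmod (f n z) \<le> B" if "K \<subseteq> RHP"
  using fC that by blast

lemma holf0: "f0 holomorphic_on RHP"
  by (rule normal_pointwise_limit(1)[OF open_RHP holf locally_bounded lim])

lemma uniform_f: "compact K \<Longrightarrow> K \<subseteq> RHP \<Longrightarrow> uniform_limit K f f0 sequentially"
  by (rule normal_pointwise_limit(2)[OF open_RHP holf locally_bounded lim])

lemma f0C: "z \<in> RHP \<Longrightarrow> cmod (f0 z) \<le> C"
  by (rule tendsto_upperbound[OF tendsto_norm[OF lim] always_eventually[OF allI[OF fC]] sequentially_bot])

lemma hol_deriv_f: "deriv (f n) holomorphic_on RHP" "deriv f0 holomorphic_on RHP"
  by (rule holomorphic_deriv[OF holf open_RHP] holomorphic_deriv[OF holf0 open_RHP])+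

lemma cont_deriv_f: "continuous_on RHP (deriv (f n))" "continuous_on RHP (deriv f0)"
  by (rule holomorphic_on_imp_continuous_on hol_deriv_f)+

lemma deriv_lim:
  assumes "z \<in> RHP"
  shows "(\<lambda>n. deriv (f n) z) \<longlonglongrightarrow> deriv f0 z"
proof -
  obtain d where d: "0 < d" "cball z d \<subseteq> RHP"
    using open_RHP assms open_contains_cball by blast
  have "uniform_limit (cball z d) f f0 sequentially"
    by (rule uniform_f) (use d in auto)
  then have "uniform_limit (ball z d) f f0 sequentially"
    by (rule uniform_limit_on_subset) auto
  then show ?thesis
  proof (rule deriv_complex_uniform_limit)
    show "\<forall>\<^sub>F n in sequentially. f n holomorphic_on ball z d"
      using d ball_subset_cball[of z d] by (intro always_eventually allI holomorphic_on_subset[OF holf]) blast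
  qed (use d in auto)
qed

lemma deriv_f_bound: "z \<in> RHP \<Longrightarrow> cmod (deriv (f n) z) \<le> 2 * C / Re z"
  by (rule bounded_holomorphic_deriv_bound[OF holf fC])

text \<open>The derivatives again form a pointwise convergent sequence, locally bounded by 2 C / Re
  z, so the normal family argument applies to them directly.\<close>

lemma uniform_deriv:
  assumes K: "compact K" "K \<subseteq> RHP"
  shows "uniform_limit K (\<lambda>n. deriv (f n)) (deriv f0) sequentially"
proof (rule normal_pointwise_limit(2)[OF open_RHP hol_deriv_f(1) _ deriv_lim K])
  fix K :: "complex set" assume K: "compact K" "K \<subseteq> RHP"
  show "\<exists>B. \<forall>n. \<forall>z\<in>K. cmod (deriv (f n) z) \<le> B"
  proof -
    have "compact ((\<lambda>z. 2 * C / Re z) ` K)"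
      using K by (intro compact_continuous_image continuous_intros) (auto simp: RHP_def)
    from bounded_imp_bdd_above[OF compact_imp_bounded[OF this]]
    obtain B where B: "\<And>z. z \<in> K \<Longrightarrow> 2 * C / Re z \<le> B"
      by (auto simp: bdd_above_def)
    have "cmod (deriv (f n) z) \<le> B" if "z \<in> K" for n z
      using deriv_f_bound[of z n] B[OF that] that K by (auto intro: order_trans)
    then show ?thesis by blast
  qed
qed

lemma var0: "vint (deriv f0) \<le> ennreal C"
  by (rule vsup_Fatou[OF _ _ cont_deriv_f(1) deriv_lim var]) auto

text \<open>One \<delta> has to serve both the sequence and its limit; the limit inherits the bound
  through \<open>vsup_Fatou\<close>.\<close>

lemma unif0:
  assumes "0 < r" "0 < e"
  obtains \<delta> where "0 < \<delta>" "\<And>n. (\<integral>\<^sup>+x\<in>{0<..<\<delta>}. vsup {-r..r} (deriv (f n)) x \<partial>lborel) \<le> ennreal e"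
    "(\<integral>\<^sup>+x\<in>{0<..<\<delta>}. vsup {-r..r} (deriv f0) x \<partial>lborel) \<le> ennreal e"
proof -
  obtain \<delta> where d: "0 < \<delta>" "\<And>n. (\<integral>\<^sup>+x\<in>{0<..<\<delta>}. vsup {-r..r} (deriv (f n)) x \<partial>lborel) \<le> ennreal e"
    using unif[OF assms] by blast
  have "(\<integral>\<^sup>+x\<in>{0<..<\<delta>}. vsup {-r..r} (deriv f0) x \<partial>lborel) \<le> ennreal e"
    by (rule vsup_Fatou[OF _ _ cont_deriv_f(1) deriv_lim d(2)]) auto
  then show thesis using d that by blast
qed

text \<open>These are the two summands of the derivative of (f n - f0) g.\<close>

abbreviation "fterm n \<equiv> \<lambda>z. (f n z - f0 z) * deriv g z"
abbreviation "dterm n \<equiv> \<lambda>z. (deriv (f n) z - deriv f0 z) * g z"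

text \<open>Dominated convergence, with 2 C times the line supremum of |g'| as majorant. On a single
  line, g' is small outside a bounded segment while f n - f0 stays bounded, and on that segment f n
  tends to f0 uniformly.\<close>

lemma difference_deriv_term:
  "(\<lambda>n. \<integral>\<^sup>+x\<in>{0<..}. vsup UNIV (fterm n) x \<partial>lborel) \<longlonglongrightarrow> 0"
proof -
  define u where "u n x = vsup UNIV (fterm n) x * indicator {0<..} x" for n x
  define V where "V x = vsup UNIV (deriv g) x * indicator {0<..} x" for x
  have mV: "V \<in> borel_measurable borel"
    unfolding V_def by (rule measurable_vsup[OF cont_deriv])
  have diff: "cmod (f n z - f0 z) \<le> 2 * C" if "z \<in> RHP" for n z
    using norm_triangle_ineq4[of "f n z" "f0 z"] fC[OF that, of n] f0C[OF that] by simp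
  have "(\<lambda>n. \<integral>\<^sup>+x. u n x \<partial>lborel) \<longlonglongrightarrow> (\<integral>\<^sup>+x. 0 \<partial>(lborel :: real measure))"
  proof (rule nn_integral_dominated_convergence[where w="\<lambda>x. ennreal (2 * C) * V x"])
    have "continuous_on RHP (fterm n)" for n
      by (intro continuous_intros holomorphic_on_imp_continuous_on holf holf0 hol_deriv)
    then show "u n \<in> borel_measurable lborel" for n
      unfolding u_def using measurable_vsup by simp
    show "(\<lambda>x. ennreal (2 * C) * V x) \<in> borel_measurable lborel" using mV by simp
    show "AE x in lborel. u n x \<le> ennreal (2 * C) * V x" for n
    proof (intro AE_I2)
      fix x :: real
      show "u n x \<le> ennreal (2 * C) * V x"
      proof (cases "0 < x")
        case True
        have "vsup UNIV (fterm n) x \<le> ennreal (2 * C) * vsup UNIV (deriv g) x"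
        proof (rule vsup_least)
          fix y
          have "ennreal (cmod (fterm n (Complex x y))) =
             ennreal (cmod (f n (Complex x y) - f0 (Complex x y))) * ennreal (cmod (deriv g (Complex x y)))"
            by (simp add: norm_mult ennreal_mult)
          also have "\<dots> \<le> ennreal (2 * C) * vsup UNIV (deriv g) x"
            using diff True by (intro mult_mono ennreal_leI vsup_upper) auto
          finally show "ennreal (cmod (fterm n (Complex x y))) \<le>
             ennreal (2 * C) * vsup UNIV (deriv g) x" .
        qed
        then show ?thesis using True by (simp add: u_def V_def)
      qed (simp add: u_def)
    qed
    have "(\<integral>\<^sup>+x. ennreal (2 * C) * V x \<partial>lborel) = ennreal (2 * C) * (\<integral>\<^sup>+x. V x \<partial>lborel)"
      using mV by (intro nn_integral_cmult) simp
    also have "\<dots> < \<infinity>"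
      using vint_bound by (simp add: V_def ennreal_mult_less_top le_less_trans)
    finally show "(\<integral>\<^sup>+x. ennreal (2 * C) * V x \<partial>lborel) < \<infinity>" .
    show "AE x in lborel. (\<lambda>n. u n x) \<longlonglongrightarrow> 0"
    proof (intro AE_I2)
      fix x :: real
      show "(\<lambda>n. u n x) \<longlonglongrightarrow> 0"
      proof (cases "0 < x")
        case x: True
        show ?thesis
        proof (rule order_tendstoI)
          fix a :: ennreal assume "0 < a"
          then obtain c where c: "0 < c" "c < a" using dense by blast
          then obtain d where d: "0 < d" "ennreal d < a"
            by (cases c) (auto simp: top_unique)
          have dC: "0 < d / (2 * C + 1)" using d C0 by simp
          obtain r where r: "0 < r" "\<And>y. r \<le> \<bar>y\<bar> \<Longrightarrow> cmod (deriv g (Complex x y)) \<le> d / (2 * C + 1)"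
            using vertical_decay[OF x dC] by blast
          \<comment> \<open>A bound for |g'| on the line; the summand 1 keeps it positive when M =
            0.\<close>
          define L where "L = 2 * M / x + 1"
          have L: "0 < L" using M0 x by (simp add: L_def add_nonneg_pos)
          define K where "K = Complex x ` {-r..r}"
          have "uniform_limit K f f0 sequentially"
            unfolding K_def using x by (intro uniform_f compact_continuous_image continuous_intros) auto
          then have "\<forall>\<^sub>F n in sequentially. \<forall>z\<in>K. dist (f n z) (f0 z) < d / L"
            using d L by (auto simp: uniform_limit_iff)
          then show "\<forall>\<^sub>F n in sequentially. u n x < a"
          proof (rule eventually_mono)
            fix n assume n: "\<forall>z\<in>K. dist (f n z) (f0 z) < d / L"
            have "vsup UNIV (fterm n) x \<le> ennreal d"
            proof (intro vsup_least ennreal_leI)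
              fix y
              show "cmod (fterm n (Complex x y)) \<le> d"
              proof (cases "r \<le> \<bar>y\<bar>")
                case True
                have "cmod (f n (Complex x y) - f0 (Complex x y)) * cmod (deriv g (Complex x y)) \<le> (2 * C + 1) * (d / (2 * C + 1))"
                  using diff[of "Complex x y" n] x r(2)[OF True] C0 by (intro mult_mono) auto
                then show ?thesis using C0 by (simp add: norm_mult)
              next
                case False
                then have "Complex x y \<in> K" unfolding K_def by (intro imageI) auto
                then have "cmod (f n (Complex x y) - f0 (Complex x y)) \<le> d / L"
                  using n by (auto simp: dist_norm intro: less_imp_le)
                moreover have "cmod (deriv g (Complex x y)) \<le> L"
                  using deriv_bound[of "Complex x y"] x by (simp add: L_def)
                ultimately have "cmod (f n (Complex x y) - f0 (Complex x y)) * cmod (deriv g (Complex x y)) \<le> d / L * L"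
                  using d L by (intro mult_mono) auto
                then show ?thesis using L by (simp add: norm_mult)
              qed
            qed
            then show "u n x < a" using x d by (simp add: u_def le_less_trans)
          qed
        qed simp
      qed (simp add: u_def)
    qed
  qed simp_all
  then show ?thesis by (simp add: u_def)
qed

text \<open>Three regions: high up or far to the right |g| is at most e and meets the total
  variations; near the axis at bounded height |g| \<le> G meets variations of at most e each; on the
  compact remainder the derivatives converge uniformly.\<close>

lemma deriv_difference_term:
  "(\<lambda>n. \<integral>\<^sup>+x\<in>{0<..}. vsup UNIV (dterm n) x \<partial>lborel) \<longlonglongrightarrow> 0"
proof (rule order_tendstoI)
  fix a :: ennreal assume "0 < a"
  then obtain c where c: "0 < c" "c < a" using dense by blast
  then obtain d where d: "0 < d" "ennreal d < a"
    by (cases c) (auto simp: top_unique)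
  \<comment> \<open>The regions contribute 2 C e, 2 G e and, with accuracy e / X over an interval of
    length X, another G e; the summand 1 keeps the divisor positive.\<close>
  define e where "e = d / (2 * C + 3 * G + 1)"
  have pos: "0 < 2 * C + 3 * G + 1" using C0 G_nonneg by simp
  have e: "0 < e" using d pos by (simp add: e_def)
  obtain r where r: "0 < r" "\<And>z. z \<in> RHP \<Longrightarrow> r \<le> \<bar>Im z\<bar> \<Longrightarrow> cmod (g z) \<le> e"
    using g_high[OF e] by blast
  obtain X where X: "0 < X" "\<And>z. X \<le> Re z \<Longrightarrow> cmod (g z) \<le> e"
    using g_far[OF e] by blast
  obtain \<delta> where \<delta>: "0 < \<delta>" "\<And>n. (\<integral>\<^sup>+x\<in>{0<..<\<delta>}. vsup {-r..r} (deriv (f n)) x \<partial>lborel) \<le> ennreal e"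
    "(\<integral>\<^sup>+x\<in>{0<..<\<delta>}. vsup {-r..r} (deriv f0) x \<partial>lborel) \<le> ennreal e"
    using unif0[OF r(1) e] by blast
  define K where "K = (\<lambda>(x, y). Complex x y) ` ({\<delta>..X} \<times> {-r..r})"
  have "uniform_limit K (\<lambda>n. deriv (f n)) (deriv f0) sequentially"
  proof (rule uniform_deriv)
    show "compact K"
      unfolding K_def case_prod_beta
      by (intro compact_continuous_image compact_Times continuous_intros) auto
  qed (use \<delta> in \<open>auto simp: K_def\<close>)
  moreover have "0 < e / X" using e X by simp
  ultimately have "\<forall>\<^sub>F n in sequentially. \<forall>z\<in>K. dist (deriv (f n) z) (deriv f0 z) < e / X"
    by (simp add: uniform_limit_iff)
  then show "\<forall>\<^sub>F n in sequentially. vint (dterm n) < a"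
  proof (rule eventually_mono)
    fix n assume n: "\<forall>z\<in>K. dist (deriv (f n) z) (deriv f0 z) < e / X"
    define A where "A x = vsup UNIV (deriv (f n)) x * indicator {0<..} x" for x
    define A0 where "A0 x = vsup UNIV (deriv f0) x * indicator {0<..} x" for x
    define B where "B x = vsup {-r..r} (deriv (f n)) x * indicator {0<..} x * indicator {0<..<\<delta>} x" for x
    define B0 where "B0 x = vsup {-r..r} (deriv f0) x * indicator {0<..} x * indicator {0<..<\<delta>} x" for x
    note mv = measurable_vsup[OF cont_deriv_f(1)] measurable_vsup[OF cont_deriv_f(2)]
    have [measurable]: "A \<in> borel_measurable borel" "A0 \<in> borel_measurable borel"
      unfolding A_def A0_def by (rule mv)+
    have [measurable]: "B \<in> borel_measurable borel" "B0 \<in> borel_measurable borel"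
      unfolding B_def B0_def by (intro borel_measurable_times_ennreal mv borel_measurable_indicator; simp)+
    let ?rhs = "\<lambda>x. ennreal e * (A x + A0 x) + (ennreal G * (B x + B0 x) + ennreal (G * (e / X)) * indicator {0..X} x)"
    have pw: "vsup UNIV (dterm n) x * indicator {0<..} x \<le>
       ?rhs x" for x
    proof (cases "0 < x")
      case x: True
      have "vsup UNIV (dterm n) x \<le>
          ?rhs x"
      proof (rule vsup_least)
        fix y
        define z where "z = Complex x y"
        have z: "z \<in> RHP" "Re z = x" "Im z = y" using x by (auto simp: z_def)
        have prod: "ennreal (cmod (dterm n z)) \<le>
            ennreal (cmod (g z)) * (ennreal (cmod (deriv (f n) z)) + ennreal (cmod (deriv f0 z)))"
        proof -
          have "cmod (dterm n z) \<le> cmod (g z) * (cmod (deriv (f n) z) + cmod (deriv f0 z))"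
            unfolding norm_mult mult.commute[of _ "cmod (g z)"] by (intro mult_left_mono norm_triangle_ineq4) simp
          then show ?thesis
            by (simp add: ennreal_leI ennreal_mult[symmetric] ennreal_plus[symmetric] del: ennreal_plus)
        qed
        consider "r \<le> \<bar>y\<bar> \<or> X \<le> x" | "\<bar>y\<bar> < r" "x < X" "x < \<delta>" | "\<bar>y\<bar> < r" "x < X" "\<delta> \<le> x"
          by linarith
        then show "ennreal (cmod (dterm n z)) \<le>
          ?rhs x"
        proof cases
          case 1
          then have "cmod (g z) \<le> e" using r(2)[of z] X(2)[of z] z by auto
          then have "ennreal (cmod (g z)) * (ennreal (cmod (deriv (f n) z)) + ennreal (cmod (deriv f0 z))) \<le>
              ennreal e * (A x + A0 x)"
            unfolding A_def A0_def z_def using x by (intro mult_mono add_mono ennreal_leI) (auto intro: vsup_upper)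
          then have "ennreal (cmod (dterm n z)) \<le> ennreal e * (A x + A0 x)"
            by (rule order_trans[OF prod])
          then show ?thesis by (rule order_trans) (rule add_increasing2; simp)
        next
          case 2
          have "ennreal (cmod (g z)) * (ennreal (cmod (deriv (f n) z)) + ennreal (cmod (deriv f0 z))) \<le>
              ennreal G * (B x + B0 x)"
            unfolding B_def B0_def using x 2 g_bound[OF z(1)]
            by (intro mult_mono add_mono ennreal_leI) (auto simp: z_def intro!: vsup_upper)
          then have "ennreal (cmod (dterm n z)) \<le> ennreal G * (B x + B0 x)"
            by (rule order_trans[OF prod])
          then show ?thesis by (rule order_trans) (rule add_increasing, simp, rule add_increasing2; simp)
        next
          case 3
          then have "z \<in> K"
            using imageI[of "(x, y)" "{\<delta>..X} \<times> {-r..r}" "\<lambda>(x, y). Complex x y"] 3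
            by (simp add: K_def z_def abs_less_iff)
          then have "cmod (deriv (f n) z - deriv f0 z) \<le> e / X"
            using n by (auto simp: dist_norm intro: less_imp_le)
          then have "cmod (dterm n z) \<le> G * (e / X)"
            unfolding norm_mult mult.commute[of _ "cmod (g z)"]
            using g_bound[OF z(1)] G_nonneg by (intro mult_mono) auto
          then have "ennreal (cmod (dterm n z)) \<le> ennreal (G * (e / X)) * indicator {0..X} x"
            using 3 x by (simp add: ennreal_leI)
          then show ?thesis by (rule order_trans) (rule add_increasing, simp, rule add_increasing; simp)
        qed
      qed
      then show ?thesis using x by simp
    qed simp
    have iA: "(\<integral>\<^sup>+x. A x \<partial>lborel) \<le> ennreal C" "(\<integral>\<^sup>+x. A0 x \<partial>lborel) \<le> ennreal C"
      unfolding A_def A0_def by (rule var var0)+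
    have "(\<integral>\<^sup>+x. B x \<partial>lborel) = (\<integral>\<^sup>+x\<in>{0<..<\<delta>}. vsup {-r..r} (deriv (f n)) x \<partial>lborel)"
      "(\<integral>\<^sup>+x. B0 x \<partial>lborel) = (\<integral>\<^sup>+x\<in>{0<..<\<delta>}. vsup {-r..r} (deriv f0) x \<partial>lborel)"
      unfolding B_def B0_def by (intro nn_integral_cong; auto simp: indicator_def)+
    then have iB: "(\<integral>\<^sup>+x. B x \<partial>lborel) \<le> ennreal e" "(\<integral>\<^sup>+x. B0 x \<partial>lborel) \<le> ennreal e"
      using \<delta> by auto
    have "vint (dterm n) \<le>
      (\<integral>\<^sup>+x. ?rhs x \<partial>lborel)"
      by (intro nn_integral_mono pw)
    also have "\<dots> = ennreal e * ((\<integral>\<^sup>+x. A x \<partial>lborel) + (\<integral>\<^sup>+x. A0 x \<partial>lborel)) +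
      (ennreal G * ((\<integral>\<^sup>+x. B x \<partial>lborel) + (\<integral>\<^sup>+x. B0 x \<partial>lborel)) + ennreal (G * (e / X)) * ennreal X)"
      using X by (simp add: nn_integral_add nn_integral_cmult nn_integral_cmult_indicator)
    also have "\<dots> \<le> ennreal e * (ennreal C + ennreal C) + (ennreal G * (ennreal e + ennreal e) + ennreal (G * (e / X)) * ennreal X)"
      by (intro add_mono mult_left_mono iA iB order_refl) auto
    also have "\<dots> = ennreal (e * (2 * C + 3 * G))"
      using e C0 G_nonneg X by (simp add: ennreal_plus[symmetric] ennreal_mult[symmetric] algebra_simps del: ennreal_plus)
    also have "\<dots> \<le> ennreal d"
      using d pos by (intro ennreal_leI) (simp add: e_def field_simps)
    finally show "vint (dterm n) < a"
      using d(2) by (rule le_less_trans)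
  qed
qed simp

lemma product_var_tendsto:
  "(\<lambda>n. B_seminorm (\<lambda>z. f n z * g z - f0 z * g z)) \<longlonglongrightarrow> 0"
proof (rule tendsto_sandwich[OF _ _ tendsto_const])
  let ?s = "\<lambda>n. vint (dterm n) +
    vint (fterm n)"
  show "?s \<longlonglongrightarrow> 0"
    using tendsto_add[OF deriv_difference_term difference_deriv_term] by simp
  show "\<forall>\<^sub>F n in sequentially. B_seminorm (\<lambda>z. f n z * g z - f0 z * g z) \<le> ?s n"
  proof (intro always_eventually allI)
    fix n
    have d: "deriv (\<lambda>z. f n z * g z - f0 z * g z) z = (deriv (f n) z - deriv f0 z) * g z + (f n z - f0 z) * deriv g z"
      if "z \<in> RHP" for z
      by (rule DERIV_imp_deriv)
        (auto intro!: derivative_eq_intros holomorphic_derivI[OF holf open_RHP that] holomorphic_derivI[OF holf0 open_RHP that]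
          holomorphic_derivI[OF holg open_RHP that] simp: algebra_simps)
    have "B_seminorm (\<lambda>z. f n z * g z - f0 z * g z) \<le>
      (\<integral>\<^sup>+x. vsup UNIV (dterm n) x * indicator {0<..} x +
        vsup UNIV (fterm n) x * indicator {0<..} x \<partial>lborel)"
      unfolding B_seminorm_def
    proof (intro nn_integral_mono)
      fix x :: real
      show "(SUP y. ennreal (cmod (deriv (\<lambda>z. f n z * g z - f0 z * g z) (Complex x y)))) * indicator {0<..} x \<le>
        vsup UNIV (dterm n) x * indicator {0<..} x +
        vsup UNIV (fterm n) x * indicator {0<..} x"
        using vsup_add_le[of UNIV "dterm n" "fterm n" x]
        by (cases "0 < x") (simp_all add: d vsup_def)
    qed
    also have "\<dots> = ?s n"
    proof (rule nn_integral_add)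
      have "continuous_on RHP (dterm n)"
        "continuous_on RHP (fterm n)"
        by (intro continuous_intros cont_deriv_f cont_g holomorphic_on_imp_continuous_on holf holf0 hol_deriv)+
      from this[THEN measurable_vsup]
      show "(\<lambda>x. vsup UNIV (dterm n) x * indicator {0<..} x) \<in> borel_measurable lborel"
        "(\<lambda>x. vsup UNIV (fterm n) x * indicator {0<..} x) \<in> borel_measurable lborel"
        by auto
    qed
    finally show "B_seminorm (\<lambda>z. f n z * g z - f0 z * g z) \<le> ?s n" .
  qed
qed simp

end

section \<open>Resolvents\<close>

text \<open>The uniform boundedness principle for extended seminorms: their supremum is again of
  this kind, its sublevel sets being intersections of closed sets.\<close>

lemma SUP_seminorm_bounded:
  fixes P :: "'s \<Rightarrow> 'a::banach \<Rightarrow> ennreal"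
  assumes closed: "\<And>s c. s \<in> S \<Longrightarrow> closed {x. P s x \<le> c}"
    and add: "\<And>s x y. s \<in> S \<Longrightarrow> P s (x + y) \<le> P s x + P s y"
    and scale: "\<And>s c x. s \<in> S \<Longrightarrow> P s (c *\<^sub>R x) = ennreal \<bar>c\<bar> * P s x"
    and fin: "\<And>x. (SUP s\<in>S. P s x) < top"
  obtains C where "0 \<le> C" "\<And>s x. s \<in> S \<Longrightarrow> P s x \<le> ennreal (C * norm x)"
proof -
  define p where "p x = (SUP s\<in>S. P s x)" for x
  obtain C where C: "0 \<le> C" "\<And>x. p x \<le> ennreal (C * norm x)"
  proof (rule closed_seminorm_bounded[of p])
    fix n :: nat
    have "{x. p x \<le> of_nat n} = (\<Inter>s\<in>S. {x. P s x \<le> of_nat n})"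
      by (auto simp: p_def SUP_le_iff)
    then show "closed {x. p x \<le> of_nat n}" using closed by auto
  next
    show "p (x + y) \<le> p x + p y" for x y
      unfolding p_def
    proof (rule SUP_least)
      fix s assume s: "s \<in> S"
      have "P s (x + y) \<le> P s x + P s y" by (rule add[OF s])
      also have "\<dots> \<le> (SUP s\<in>S. P s x) + (SUP s\<in>S. P s y)"
        by (intro add_mono SUP_upper s)
      finally show "P s (x + y) \<le> (SUP s\<in>S. P s x) + (SUP s\<in>S. P s y)" .
    qed
    show "p (c *\<^sub>R x) = ennreal \<bar>c\<bar> * p x" for c x
      unfolding p_def SUP_mult_left_ennreal by (intro SUP_cong refl scale)
    show "p x < top" for x unfolding p_def by (rule fin)
  qed (use that in blast)
  show thesis
  proof (rule that[OF C(1)])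
    fix s x assume "s \<in> S"
    then have "P s x \<le> p x" unfolding p_def by (rule SUP_upper)
    then show "P s x \<le> ennreal (C * norm x)" using C(2) by (rule order_trans)
  qed
qed

text \<open>Supplies the hypotheses of \<open>SUP_seminorm_bounded\<close>; closedness is Fatou's
  lemma along a convergent sequence. It serves both with the functional fixed and with the vector
  fixed.\<close>

lemma integral_seminorm:
  fixes \<Phi> :: "real \<Rightarrow> 'a::banach \<Rightarrow> complex" and a :: real
  assumes lin: "\<And>t. bounded_linear (\<Phi> t)" and meas: "\<And>x. (\<lambda>t. \<Phi> t x) \<in> borel_measurable borel"
  defines "P \<equiv> \<lambda>x. ennreal a * (\<integral>\<^sup>+t. ennreal (cmod (\<Phi> t x)) \<partial>lborel)"
  shows "closed {x. P x \<le> c}" "P (x + y) \<le> P x + P y" "P (r *\<^sub>R x) = ennreal \<bar>r\<bar> * P x"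
proof -
  have m [measurable]: "(\<lambda>t. \<Phi> t x) \<in> borel_measurable borel" for x by (rule meas)
  show "closed {x. P x \<le> c}"
    unfolding closed_sequential_limits
  proof (intro allI impI)
    fix X l assume X: "(\<forall>n. X n \<in> {x. P x \<le> c}) \<and> X \<longlonglongrightarrow> l"
    have "(\<integral>\<^sup>+t. ennreal a * ennreal (cmod (\<Phi> t l)) \<partial>lborel) =
        (\<integral>\<^sup>+t. liminf (\<lambda>n. ennreal a * ennreal (cmod (\<Phi> t (X n)))) \<partial>lborel)"
    proof (intro nn_integral_cong)
      fix t
      have "(\<lambda>n. \<Phi> t (X n)) \<longlonglongrightarrow> \<Phi> t l"
        using X by (intro bounded_linear.tendsto[OF lin]) auto
      then have "(\<lambda>n. ennreal a * ennreal (cmod (\<Phi> t (X n)))) \<longlonglongrightarrow> ennreal a * ennreal (cmod (\<Phi> t l))"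
        by (intro tendsto_mult_ennreal tendsto_const tendsto_ennrealI tendsto_norm) auto
      then show "ennreal a * ennreal (cmod (\<Phi> t l)) = liminf (\<lambda>n. ennreal a * ennreal (cmod (\<Phi> t (X n))))"
        by (rule lim_imp_Liminf[OF sequentially_bot, symmetric])
    qed
    also have "\<dots> \<le> liminf (\<lambda>n. \<integral>\<^sup>+t. ennreal a * ennreal (cmod (\<Phi> t (X n))) \<partial>lborel)"
      by (intro nn_integral_liminf) measurable
    also have "\<dots> = liminf (\<lambda>n. P (X n))"
      unfolding P_def by (simp add: nn_integral_cmult)
    also have "\<dots> \<le> liminf (\<lambda>n::nat. c)"
      using X by (intro Liminf_mono always_eventually) auto
    also have "\<dots> = c" by (simp add: Liminf_const)
    finally have "P l \<le> c"
      unfolding P_def by (simp add: nn_integral_cmult)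
    then show "l \<in> {x. P x \<le> c}" by simp
  qed
  have "(\<integral>\<^sup>+t. ennreal (cmod (\<Phi> t (x + y))) \<partial>lborel) \<le>
      (\<integral>\<^sup>+t. ennreal (cmod (\<Phi> t x)) + ennreal (cmod (\<Phi> t y)) \<partial>lborel)"
    by (intro nn_integral_mono)
      (simp add: linear_add[OF bounded_linear.linear[OF lin]] ennreal_leI norm_triangle_ineq
        ennreal_plus[symmetric] del: ennreal_plus)
  also have "\<dots> = (\<integral>\<^sup>+t. ennreal (cmod (\<Phi> t x)) \<partial>lborel) + (\<integral>\<^sup>+t. ennreal (cmod (\<Phi> t y)) \<partial>lborel)"
    by (intro nn_integral_add) measurable
  finally show "P (x + y) \<le> P x + P y"
    unfolding P_def by (simp add: distrib_left[symmetric] mult_left_mono)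
  have "(\<integral>\<^sup>+t. ennreal (cmod (\<Phi> t (r *\<^sub>R x))) \<partial>lborel) = (\<integral>\<^sup>+t. ennreal \<bar>r\<bar> * ennreal (cmod (\<Phi> t x)) \<partial>lborel)"
    by (intro nn_integral_cong) (simp add: linear_scale[OF bounded_linear.linear[OF lin]] ennreal_mult)
  then show "P (r *\<^sub>R x) = ennreal \<bar>r\<bar> * P x"
    unfolding P_def by (simp add: nn_integral_cmult mult.left_commute)
qed

section \<open>Complex scalars and the resolvent\<close>

locale complex_banach =
  fixes J :: "'a::banach \<Rightarrow> 'a"
  assumes cs: "complex_structure J"
begin

abbreviation cs_scale (infixr "\<cdot>" 75) where "c \<cdot> x \<equiv> cscale J c x"

lemma J_bounded: "bounded_linear J" and JJ [simp]: "J (J x) = - x"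
  and norm_rotate: "norm (cos t *\<^sub>R x + sin t *\<^sub>R J x) = norm x"
  using cs by (auto simp: complex_structure_def)

lemma J_linear: "linear J"
  by (rule bounded_linear.linear[OF J_bounded])

lemmas J_simps = linear_add[OF J_linear] linear_diff[OF J_linear] linear_scale[OF J_linear] linear_neg[OF J_linear]

lemma cscale_diff: "c \<cdot> (x - y) = c \<cdot> x - c \<cdot> y"
  and cscale_minus: "c \<cdot> (- x) = - (c \<cdot> x)"
  and cscale_diff_left: "(c - d) \<cdot> x = c \<cdot> x - d \<cdot> x"
  and cscale_minus_left: "(- c) \<cdot> x = - (c \<cdot> x)"
  and cscale_cscale: "c \<cdot> (d \<cdot> x) = (c * d) \<cdot> x"
  and cscale_one [simp]: "1 \<cdot> x = x"
  and cscale_i: "\<i> \<cdot> x = J x"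
  by (simp_all add: cscale_def J_simps algebra_simps)

lemma norm_cscale: "norm (c \<cdot> x) = cmod c * norm x"
proof -
  have "c \<cdot> x = cmod c *\<^sub>R (cos (Arg c) *\<^sub>R x + sin (Arg c) *\<^sub>R J x)"
    using arg_cong[OF rcis_cmod_Arg[of c], of Re] arg_cong[OF rcis_cmod_Arg[of c], of Im]
    by (simp add: cscale_def scaleR_add_right)
  then show ?thesis by (simp add: norm_rotate)
qed

lemma cdual_cscale: "cdual J \<phi> \<Longrightarrow> \<phi> (c \<cdot> x) = c * \<phi> x"
proof -
  assume \<phi>: "cdual J \<phi>"
  interpret bounded_linear \<phi> using \<phi> by (simp add: cdual_def)
  have "\<phi> (c \<cdot> x) = (of_real (Re c) + \<i> * of_real (Im c)) * \<phi> x"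
    using \<phi> by (simp add: cscale_def add scaleR scaleR_conv_of_real cdual_def algebra_simps)
  then show ?thesis by (metis complex_eq)
qed

lemma cdual_linear: "cdual J \<phi> \<Longrightarrow> bounded_linear \<phi>"
  by (simp add: cdual_def)

lemma cdual_eqI: "(\<And>\<phi>. cdual J \<phi> \<Longrightarrow> \<phi> x = \<phi> y) \<Longrightarrow> x = y"
proof -
  assume eq: "\<And>\<phi>. cdual J \<phi> \<Longrightarrow> \<phi> x = \<phi> y"
  have "norm (x - y) \<le> 0"
    using cs by (rule cdual_norm_bound) (simp add: linear_diff[OF bounded_linear.linear[OF cdual_linear]] eq)
  then show ?thesis by simp
qed

lemma cbounded_cscale: "cbounded J T \<Longrightarrow> T (c \<cdot> x) = c \<cdot> T x"
proof -
  assume T: "cbounded J T"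
  interpret bounded_linear T using T by (simp add: cbounded_def)
  show ?thesis using T by (simp add: cscale_def add scaleR cbounded_def)
qed

end

locale half_plane_resolvent = complex_banach +
  fixes D :: "'a::banach set" and A :: "'a \<Rightarrow> 'a"
  assumes dd: "densely_defined J D A"
    and spec: "op_spectrum J D A \<subseteq> {z. 0 \<le> Re z}"
begin

definition R where "R z = res_plus J D A z"

lemma A_cscale: "x \<in> D \<Longrightarrow> c \<cdot> x \<in> D" "x \<in> D \<Longrightarrow> A (c \<cdot> x) = c \<cdot> A x"
  using dd by (auto simp: densely_defined_def clinear_op_def)

lemma dense_D: "closure D = UNIV"
  using dd by (simp add: densely_defined_def)

lemma A_minus: "x \<in> D \<Longrightarrow> - x \<in> D" "x \<in> D \<Longrightarrow> A (- x) = - A x"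
  using A_cscale[of x "- 1"] by (simp_all add: cscale_minus_left)

text \<open>Since z + A = -((-z) - A) and -z lies outside the spectrum, minus the inverse found
  there works; inverses are unique, so the definite description in \<open>bdd_inverse\<close> picks
  it.\<close>

lemma is_bdd_inverse_R:
  assumes "z \<in> RHP"
  shows "is_bdd_inverse J D (\<lambda>x. z \<cdot> x + A x) (R z)"
proof -
  have "- z \<notin> op_spectrum J D A" using spec assms by (auto simp: RHP_def)
  then obtain S where S: "is_bdd_inverse J D (\<lambda>x. (- z) \<cdot> x - A x) S"
    by (auto simp: op_spectrum_def)
  have Sc: "cbounded J S" "bounded_linear S" and SD: "\<And>x. S x \<in> D" and BS: "\<And>x. (- z) \<cdot> S x - A (S x) = x"
    and SB: "\<And>x. x \<in> D \<Longrightarrow> S ((- z) \<cdot> x - A x) = x"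
    using S by (auto simp: is_bdd_inverse_def cbounded_def)
  note Sn = linear_neg[OF bounded_linear.linear[OF Sc(2)]]
  have inv: "is_bdd_inverse J D (\<lambda>x. z \<cdot> x + A x) (\<lambda>x. - S x)"
    unfolding is_bdd_inverse_def
  proof (intro conjI allI ballI)
    show "cbounded J (\<lambda>x. - S x)"
      using Sc by (auto simp: cbounded_def bounded_linear_minus J_simps)
    show "- S x \<in> D" for x by (intro A_minus SD)
    show "z \<cdot> (- S x) + A (- S x) = x" for x
      using BS[of x] by (simp add: A_minus SD cscale_minus cscale_minus_left)
    show "- S (z \<cdot> x + A x) = x" if "x \<in> D" for x
      using SB[OF that] by (simp add: Sn[symmetric] cscale_minus_left)
  qed
  have "R z = (\<lambda>x. - S x)"
    unfolding R_def res_plus_def bdd_inverse_def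
  proof (rule the_equality, rule inv)
    fix R' assume R': "is_bdd_inverse J D (\<lambda>x. z \<cdot> x + A x) R'"
    show "R' = (\<lambda>x. - S x)"
    proof
      fix x
      show "R' x = - S x"
        using R' inv unfolding is_bdd_inverse_def by metis
    qed
  qed
  then show ?thesis using inv by simp
qed

lemma R_in_D: "z \<in> RHP \<Longrightarrow> R z x \<in> D"
  and R_right: "z \<in> RHP \<Longrightarrow> z \<cdot> R z x + A (R z x) = x"
  and R_left: "z \<in> RHP \<Longrightarrow> y \<in> D \<Longrightarrow> R z (z \<cdot> y + A y) = y"
  and R_cbounded: "z \<in> RHP \<Longrightarrow> cbounded J (R z)"
  using is_bdd_inverse_R[of z] by (auto simp: is_bdd_inverse_def)

lemma R_bl: "z \<in> RHP \<Longrightarrow> bounded_linear (R z)"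
  using R_cbounded by (simp add: cbounded_def)

lemma R_linear: "z \<in> RHP \<Longrightarrow> linear (R z)"
  by (intro bounded_linear.linear R_bl)

lemma R_diff: "z \<in> RHP \<Longrightarrow> R z (x - y) = R z x - R z y"
  and R_add: "z \<in> RHP \<Longrightarrow> R z (x + y) = R z x + R z y"
  by (simp_all add: linear_diff[OF R_linear] linear_add[OF R_linear])

lemma R_norm: "z \<in> RHP \<Longrightarrow> norm (R z x) \<le> onorm (R z) * norm x"
  by (intro onorm R_bl)

lemma onorm_R_nonneg: "z \<in> RHP \<Longrightarrow> 0 \<le> onorm (R z)"
  by (intro onorm_pos_le R_bl)

lemma resolvent_identity:
  assumes "z \<in> RHP" "w \<in> RHP"
  shows "R w x - R z x = (z - w) \<cdot> R w (R z x)"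
proof -
  define y where "y = R z x"
  have y: "y \<in> D" and x: "z \<cdot> y + A y = x"
    unfolding y_def by (rule R_in_D[OF assms(1)] R_right[OF assms(1)])+
  have "w \<cdot> y + A y = (w - z) \<cdot> y + x"
    by (simp add: x[symmetric] cscale_diff_left)
  then have "y = R w ((w - z) \<cdot> y + x)" using R_left[OF assms(2) y] by simp
  also have "\<dots> = (w - z) \<cdot> R w y + R w x"
    by (simp add: R_add assms cbounded_cscale[OF R_cbounded])
  finally show ?thesis
    by (simp add: y_def[symmetric] cscale_diff_left algebra_simps)
qed

lemma R_commute:
  assumes "z \<in> RHP" "w \<in> RHP"
  shows "R w (R z x) = R z (R w x)"
proof (cases "z = w")
  case False
  have "(z - w) \<cdot> R z (R w x) = R w x - R z x"
    using resolvent_identity[OF assms(2,1), of x] cscale_minus_left[of "w - z" "R z (R w x)"]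
    by (metis minus_diff_eq)
  then have "(z - w) \<cdot> (R w (R z x) - R z (R w x)) = 0"
    using resolvent_identity[OF assms, of x] by (simp add: cscale_diff)
  then have "norm ((z - w) \<cdot> (R w (R z x) - R z (R w x))) = 0" by simp
  then show ?thesis using False by (simp add: norm_cscale)
qed simp

text \<open>R w x = R z x + (z - w) R z (R w x), and the last term, at most half of norm (R w x), is
  absorbed on the left. This plays the part of a Neumann series.\<close>

lemma R_local_bound:
  assumes "z \<in> RHP" "w \<in> RHP" "cmod (z - w) * onorm (R z) \<le> 1 / 2"
  shows "norm (R w x) \<le> 2 * onorm (R z) * norm x"
proof -
  have "R w x = R z x + (z - w) \<cdot> R z (R w x)"
    using resolvent_identity[OF assms(1,2), of x] R_commute[OF assms(1,2), of x] by (simp add: algebra_simps)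
  then have "norm (R w x) \<le> norm (R z x) + cmod (z - w) * norm (R z (R w x))"
    by (metis norm_cscale norm_triangle_ineq)
  also have "\<dots> \<le> onorm (R z) * norm x + cmod (z - w) * (onorm (R z) * norm (R w x))"
    by (intro add_mono mult_left_mono R_norm assms) auto
  also have "\<dots> \<le> onorm (R z) * norm x + 1 / 2 * norm (R w x)"
    using mult_right_mono[OF assms(3) norm_ge_zero[of "R w x"]] by (simp add: mult.assoc)
  finally show ?thesis by simp
qed

lemma eventually_R_local_bound:
  assumes "z \<in> RHP"
  shows "\<forall>\<^sub>F w in at z within RHP. w \<in> RHP \<and> (\<forall>x. norm (R w x) \<le> 2 * onorm (R z) * norm x)"
proof -
  have "((\<lambda>w. cmod (z - w) * onorm (R z)) \<longlongrightarrow> cmod (z - z) * onorm (R z)) (at z within RHP)"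
    by (intro tendsto_intros)
  then have "\<forall>\<^sub>F w in at z within RHP. cmod (z - w) * onorm (R z) < 1 / 2"
    by (intro order_tendstoD) auto
  moreover have "\<forall>\<^sub>F w in at z within RHP. w \<in> RHP"
    by (simp add: eventually_at_filter)
  ultimately show ?thesis
    by eventually_elim (use assms R_local_bound in auto)
qed

text \<open>The vector may vary with z, so that the lemma can be iterated to give continuity of the
  squared resolvent.\<close>

lemma continuous_on_R:
  assumes v: "continuous_on RHP v"
  shows "continuous_on RHP (\<lambda>z. R z (v z))"
  unfolding continuous_on_def
proof
  fix z assume z: "z \<in> RHP"
  have vz: "(v \<longlongrightarrow> v z) (at z within RHP)"
    using v z by (simp add: continuous_on_def)
  have "((\<lambda>w. R w (v w) - R z (v z)) \<longlongrightarrow> 0) (at z within RHP)"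
  proof (rule Lim_null_comparison)
    show "\<forall>\<^sub>F w in at z within RHP. norm (R w (v w) - R z (v z)) \<le>
        2 * onorm (R z) * norm (v w - v z) + cmod (z - w) * (2 * onorm (R z) * norm (R z (v z)))"
      using eventually_R_local_bound[OF z]
    proof eventually_elim
      case (elim w)
      then have w: "w \<in> RHP" and bd: "\<And>x. norm (R w x) \<le> 2 * onorm (R z) * norm x" by auto
      have "R w (v w) - R z (v z) = R w (v w - v z) + (z - w) \<cdot> R w (R z (v z))"
        by (simp add: R_diff w resolvent_identity[OF z w, symmetric])
      then have "norm (R w (v w) - R z (v z)) \<le> norm (R w (v w - v z)) + cmod (z - w) * norm (R w (R z (v z)))"
        by (metis norm_cscale norm_triangle_ineq)
      also have "\<dots> \<le> 2 * onorm (R z) * norm (v w - v z) + cmod (z - w) * (2 * onorm (R z) * norm (R z (v z)))"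
        by (intro add_mono mult_left_mono bd) auto
      finally show ?case .
    qed
    have "((\<lambda>w. 2 * onorm (R z) * norm (v w - v z) + cmod (z - w) * (2 * onorm (R z) * norm (R z (v z)))) \<longlongrightarrow>
       2 * onorm (R z) * norm (v z - v z) + cmod (z - z) * (2 * onorm (R z) * norm (R z (v z)))) (at z within RHP)"
      by (intro tendsto_intros vz)
    then show "((\<lambda>w. 2 * onorm (R z) * norm (v w - v z) + cmod (z - w) * (2 * onorm (R z) * norm (R z (v z)))) \<longlongrightarrow> 0) (at z within RHP)"
      by simp
  qed
  then show "((\<lambda>z. R z (v z)) \<longlongrightarrow> R z (v z)) (at z within RHP)"
    by (simp add: LIM_zero_iff)
qed

lemma continuous_R: "continuous_on RHP (\<lambda>z. R z x)"
  by (rule continuous_on_R) (rule continuous_on_const)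

lemma continuous_R2: "continuous_on RHP (\<lambda>z. R z (R z x))"
  by (rule continuous_on_R) (rule continuous_R)

lemma R2_bl: "z \<in> RHP \<Longrightarrow> bounded_linear (\<lambda>x. R z (R z x))"
  by (rule bounded_linear_compose[OF R_bl R_bl])

lemma res_plus2_eq: "res_plus2 J D A z x = R z (R z x)"
  by (simp add: res_plus2_def R_def)

text \<open>Because of this derivative, the hypothesis on squared resolvents controls the vertical
  variation of the resolvent itself.\<close>

lemma functional_R_deriv:
  assumes \<phi>: "cdual J \<phi>" and z: "z \<in> RHP"
  shows "((\<lambda>z. \<phi> (R z x)) has_field_derivative - \<phi> (R z (R z x))) (at z)"
proof -
  interpret \<phi>: bounded_linear \<phi> by (rule cdual_linear[OF \<phi>])
  have "continuous_on RHP (\<lambda>w. R w (R z x))" by (rule continuous_R)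
  then have "((\<lambda>w. R w (R z x)) \<longlongrightarrow> R z (R z x)) (at z)"
    using z unfolding continuous_on_def by (metis at_within_open[OF z open_RHP])
  then have "((\<lambda>w. - \<phi> (R w (R z x))) \<longlongrightarrow> - \<phi> (R z (R z x))) (at z)"
    by (intro tendsto_minus \<phi>.tendsto)
  moreover have "\<forall>\<^sub>F w in at z. - \<phi> (R w (R z x)) = (\<phi> (R w x) - \<phi> (R z x)) / (w - z)"
  proof -
    have "\<forall>\<^sub>F w in at z. w \<in> RHP \<and> w \<noteq> z"
      using eventually_at_topological[of "\<lambda>w. w \<in> RHP \<and> w \<noteq> z" z UNIV] open_RHP z by auto
    then show ?thesis
    proof eventually_elim
      case (elim w)
      have "\<phi> (R w x) - \<phi> (R z x) = (z - w) * \<phi> (R w (R z x))"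
        using elim z by (simp add: \<phi>.diff[symmetric] resolvent_identity cdual_cscale[OF \<phi>])
      then show ?case using elim by (simp add: field_simps)
    qed
  qed
  ultimately have "((\<lambda>w. (\<phi> (R w x) - \<phi> (R z x)) / (w - z)) \<longlongrightarrow> - \<phi> (R z (R z x))) (at z)"
    by (rule Lim_transform_eventually)
  then show ?thesis by (simp add: has_field_derivative_iff)
qed

lemma functional_R_holomorphic: "cdual J \<phi> \<Longrightarrow> (\<lambda>z. \<phi> (R z x)) holomorphic_on RHP"
  using functional_R_deriv by (auto simp: holomorphic_on_open[OF open_RHP])

lemma deriv_functional_R: "cdual J \<phi> \<Longrightarrow> z \<in> RHP \<Longrightarrow> deriv (\<lambda>z. \<phi> (R z x)) z = - \<phi> (R z (R z x))"
  by (rule DERIV_imp_deriv[OF functional_R_deriv])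

text \<open>The domain is the range of R z and is dense: approximate x by R z v and then v by R z y,
  which suffices because R z is bounded.\<close>

lemma dense_range_R2:
  assumes z: "z \<in> RHP" and e: "0 < e"
  obtains y where "dist (R z (R z y)) x < e"
proof -
  have "x \<in> closure D" "\<And>u. u \<in> closure D" using dense_D by auto
  then obtain u where u: "u \<in> D" "dist u x < e / 2"
    using e by (meson closure_approachable half_gt_zero)
  define v where "v = z \<cdot> u + A u"
  have Rv: "R z v = u" unfolding v_def by (rule R_left[OF z u(1)])
  have "0 < e / (2 * (onorm (R z) + 1))" using e onorm_R_nonneg[OF z] by simp
  then obtain w where w: "w \<in> D" "dist w v < e / (2 * (onorm (R z) + 1))"
    using \<open>\<And>u. u \<in> closure D\<close> by (meson closure_approachable)
  define y where "y = z \<cdot> w + A w"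
  have Ry: "R z y = w" unfolding y_def by (rule R_left[OF z w(1)])
  have "dist (R z w) (R z v) \<le> (onorm (R z) + 1) * dist w v"
  proof -
    have "norm (R z (w - v)) \<le> onorm (R z) * norm (w - v)" by (rule R_norm[OF z])
    also have "\<dots> \<le> (onorm (R z) + 1) * norm (w - v)" by (intro mult_right_mono) auto
    finally show ?thesis by (simp add: dist_norm R_diff[OF z])
  qed
  also have "\<dots> < e / 2"
    using w(2) onorm_R_nonneg[OF z] by (simp add: field_simps)
  finally have "dist (R z (R z y)) x < e"
    using u(2) dist_triangle[of "R z w" x u] by (simp add: Rv Ry)
  then show thesis by (rule that)
qed

end

section \<open>The resolvent condition made uniform in vectors and functionals\<close>

lemma complexify_Re: "cdual J \<phi> \<Longrightarrow> complexify J (\<lambda>x. Re (\<phi> x)) = \<phi>"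
  by (auto simp: complexify_def cdual_def complex_eq_iff)

text \<open>GSF refers to the integral resolvent condition of Gomilko, Shi and Feng.\<close>

locale GSF_operator = half_plane_resolvent +
  assumes resbd: "\<And>x \<phi>. cdual J \<phi> \<Longrightarrow> (SUP \<alpha>\<in>{0<..}. ennreal \<alpha> *
      (\<integral>\<^sup>+\<beta>. ennreal (cmod (\<phi> (res_plus2 J D A (Complex \<alpha> \<beta>) x))) \<partial>lborel)) < top"
begin

text \<open>Functionals are plain functions here, so an explicit bound k replaces a dual norm;
  estimates linear in k become norm estimates at k = 1.\<close>

definition bounded_by :: "('a \<Rightarrow> complex) \<Rightarrow> real \<Rightarrow> bool" where
  "bounded_by \<phi> k \<longleftrightarrow> cdual J \<phi> \<and> 0 \<le> k \<and> (\<forall>y. cmod (\<phi> y) \<le> k * norm y)"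

lemma ex_bounded_by: "cdual J \<phi> \<Longrightarrow> \<exists>k. bounded_by \<phi> k"
  unfolding bounded_by_def using onorm[OF cdual_linear] onorm_pos_le[OF cdual_linear] by blast

definition res2 :: "real \<Rightarrow> real \<Rightarrow> 'a \<Rightarrow> 'a" where
  "res2 \<alpha> \<beta> x = R (Complex \<alpha> \<beta>) (R (Complex \<alpha> \<beta>) x)"

lemma res2_bl: "0 < \<alpha> \<Longrightarrow> bounded_linear (res2 \<alpha> \<beta>)"
  unfolding res2_def by (rule R2_bl) simp

lemma continuous_res2: "0 < \<alpha> \<Longrightarrow> continuous_on UNIV (\<lambda>\<beta>. res2 \<alpha> \<beta> x)"
  unfolding res2_def
  by (rule continuous_on_compose2[OF continuous_R2]) (auto intro!: continuous_intros)

lemma functional_res2_measurable: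
  assumes "bounded_linear \<phi>" "0 < \<alpha>"
  shows "(\<lambda>\<beta>. \<phi> (res2 \<alpha> \<beta> x)) \<in> borel_measurable borel"
  by (intro borel_measurable_continuous_onI bounded_linear.continuous_on[OF assms(1)] continuous_res2 assms(2))

definition line_seminorm :: "real \<Rightarrow> ('a \<Rightarrow> complex) \<Rightarrow> 'a \<Rightarrow> ennreal" where
  "line_seminorm \<alpha> \<phi> x = ennreal \<alpha> * (\<integral>\<^sup>+\<beta>. ennreal (cmod (\<phi> (res2 \<alpha> \<beta> x))) \<partial>lborel)"

lemma line_seminorm_facts:
  assumes "bounded_linear \<phi>" "0 < \<alpha>"
  shows "closed {x. line_seminorm \<alpha> \<phi> x \<le> c}"
    "line_seminorm \<alpha> \<phi> (x + y) \<le> line_seminorm \<alpha> \<phi> x + line_seminorm \<alpha> \<phi> y"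
    "line_seminorm \<alpha> \<phi> (r *\<^sub>R x) = ennreal \<bar>r\<bar> * line_seminorm \<alpha> \<phi> x"
  unfolding line_seminorm_def
  by (rule integral_seminorm[of "\<lambda>\<beta> x. \<phi> (res2 \<alpha> \<beta> x)"];
      rule bounded_linear_compose[OF assms(1) res2_bl[OF assms(2)]] functional_res2_measurable[OF assms])+

text \<open>The first use of Baire's theorem: on the space itself, with the family indexed by
  \<alpha>.\<close>

lemma line_seminorm_bound_fixed_functional:
  assumes \<phi>: "cdual J \<phi>"
  obtains C where "0 \<le> C" "\<And>\<alpha> x. 0 < \<alpha> \<Longrightarrow> line_seminorm \<alpha> \<phi> x \<le> ennreal (C * norm x)"
proof (rule SUP_seminorm_bounded[of "{0<..}" "\<lambda>\<alpha>. line_seminorm \<alpha> \<phi>"])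
  fix x
  show "(SUP \<alpha>\<in>{0<..}. line_seminorm \<alpha> \<phi> x) < top"
    using resbd[OF \<phi>, of x] unfolding line_seminorm_def res2_def res_plus2_eq .
qed (use line_seminorm_facts[OF cdual_linear[OF \<phi>]] that in auto)

text \<open>The second use of Baire's theorem, now on the Banach space of real bounded functionals,
  which reaches every complex functional through its real part (\<open>complexify_Re\<close>). The
  family is indexed by \<alpha> and x in the unit ball; its supremum is finite by the first
  use.\<close>

lemma ex_resolvent_constant:
  "\<exists>K\<ge>0. \<forall>\<alpha>>0. \<forall>\<phi> k x. bounded_by \<phi> k \<longrightarrow> line_seminorm \<alpha> \<phi> x \<le> ennreal (K * k * norm x)"
proof -
  define P where "P = (\<lambda>(\<alpha>, x) (\<psi> :: 'a \<Rightarrow>\<^sub>L real). line_seminorm \<alpha> (complexify J (blinfun_apply \<psi>)) x)"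
  have cd: "cdual J (complexify J (blinfun_apply \<psi>))" for \<psi> :: "'a \<Rightarrow>\<^sub>L real"
    by (rule cdual_complexify[OF cs blinfun.bounded_linear_right])
  have semi: "closed {\<psi>. P s \<psi> \<le> c}" "P s (\<psi> + \<psi>') \<le> P s \<psi> + P s \<psi>'" "P s (r *\<^sub>R \<psi>) = ennreal \<bar>r\<bar> * P s \<psi>"
    if s_in: "s \<in> {0<..} \<times> cball 0 1" for s \<psi> \<psi>' c r
  proof -
    obtain \<alpha> x where s: "s = (\<alpha>, x)" "0 < \<alpha>" using s_in by (cases s) auto
    have bl: "bounded_linear (\<lambda>\<psi>. complexify J (blinfun_apply \<psi>) v)" for v
    proof -
      have eq: "(\<lambda>\<psi>. complexify J (blinfun_apply \<psi>) v) =
          (\<lambda>\<psi>. complex_of_real (blinfun_apply \<psi> v) - \<i> * complex_of_real (blinfun_apply \<psi> (J v)))"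
        by (auto simp: complexify_def complex_eq_iff)
      show ?thesis
        unfolding eq
        by (intro bounded_linear_sub bounded_linear_const_mult
            bounded_linear_compose[OF bounded_linear_of_real blinfun.bounded_linear_left])
    qed
    note I = integral_seminorm[of "\<lambda>\<beta> \<psi>. complexify J (blinfun_apply \<psi>) (res2 \<alpha> \<beta> x)" \<alpha>,
        OF bl functional_res2_measurable[OF cdual_linear[OF cd] s(2)]]
    show "closed {\<psi>. P s \<psi> \<le> c}" "P s (\<psi> + \<psi>') \<le> P s \<psi> + P s \<psi>'" "P s (r *\<^sub>R \<psi>) = ennreal \<bar>r\<bar> * P s \<psi>"
      unfolding P_def s(1) prod.case line_seminorm_def by (rule I)+
  qed
  have fin: "(SUP s\<in>{0<..} \<times> cball 0 1. P s \<psi>) < top" for \<psi>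
  proof -
    obtain C where C: "0 \<le> C" "\<And>\<alpha> x. 0 < \<alpha> \<Longrightarrow> line_seminorm \<alpha> (complexify J (blinfun_apply \<psi>)) x \<le> ennreal (C * norm x)"
      using line_seminorm_bound_fixed_functional[OF cd] by blast
    have "(SUP s\<in>{0<..} \<times> cball 0 1. P s \<psi>) \<le> ennreal C"
    proof (rule SUP_least)
      fix s :: "real \<times> 'a" assume "s \<in> {0<..} \<times> cball 0 1"
      then obtain \<alpha> x where s: "s = (\<alpha>, x)" "0 < \<alpha>" "norm x \<le> 1" by auto
      have "P s \<psi> \<le> ennreal (C * norm x)" using C(2)[OF s(2)] by (simp add: P_def s(1))
      also have "\<dots> \<le> ennreal C" using s(3) C(1) by (intro ennreal_leI mult_left_le)
      finally show "P s \<psi> \<le> ennreal C" .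
    qed
    then show ?thesis by (simp add: le_less_trans)
  qed
  obtain K where K: "0 \<le> K" "\<And>s \<psi>. s \<in> {0<..} \<times> cball 0 1 \<Longrightarrow> P s \<psi> \<le> ennreal (K * norm \<psi>)"
    using SUP_seminorm_bounded[of "{0<..} \<times> cball 0 1" P, OF semi fin] by blast
  have "line_seminorm \<alpha> \<phi> x \<le> ennreal (K * k * norm x)" if \<alpha>: "0 < \<alpha>" and b: "bounded_by \<phi> k" for \<alpha> \<phi> k x
  proof -
    have \<phi>: "cdual J \<phi>" and k: "0 \<le> k" "\<And>y. cmod (\<phi> y) \<le> k * norm y"
      using b by (auto simp: bounded_by_def)
    have "bounded_linear (\<lambda>x. Re (\<phi> x))"
      by (rule bounded_linear_compose[OF bounded_linear_Re cdual_linear[OF \<phi>]])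
    then have B: "blinfun_apply (Blinfun (\<lambda>x. Re (\<phi> x))) = (\<lambda>x. Re (\<phi> x))"
      by (rule bounded_linear_Blinfun_apply)
    have n: "norm (Blinfun (\<lambda>x. Re (\<phi> x))) \<le> k"
      using k abs_Re_le_cmod by (intro norm_blinfun_bound) (auto simp: B intro: order_trans)
    have unit: "line_seminorm \<alpha> \<phi> u \<le> ennreal (K * k)" if "norm u \<le> 1" for u
    proof -
      have "line_seminorm \<alpha> \<phi> u = P (\<alpha>, u) (Blinfun (\<lambda>x. Re (\<phi> x)))"
        by (simp add: P_def B complexify_Re[OF \<phi>])
      also have "\<dots> \<le> ennreal (K * norm (Blinfun (\<lambda>x. Re (\<phi> x))))"
        using that \<alpha> by (intro K(2)) auto
      also have "\<dots> \<le> ennreal (K * k)"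
        by (intro ennreal_leI mult_left_mono n K(1))
      finally show ?thesis .
    qed
    \<comment> \<open>For x = 0 the normalised vector is 0, as 0 has inverse 0, so it lies in the
      unit ball in that case too.\<close>
    have "line_seminorm \<alpha> \<phi> (norm x *\<^sub>R (x /\<^sub>R norm x)) = ennreal (norm x) * line_seminorm \<alpha> \<phi> (x /\<^sub>R norm x)"
      using line_seminorm_facts(3)[OF cdual_linear[OF \<phi>] \<alpha>, of "norm x" "x /\<^sub>R norm x"]
      unfolding abs_norm_cancel .
    also have "\<dots> \<le> ennreal (norm x) * ennreal (K * k)"
      by (intro mult_left_mono unit; cases "x = 0") auto
    also have "\<dots> = ennreal (K * k * norm x)"
      using K k by (simp add: ennreal_mult[symmetric] mult.commute)
    finally show ?thesis by (cases "x = 0") auto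
  qed
  then show ?thesis using K(1) by blast
qed

definition K where
  "K = (SOME K. 0 \<le> K \<and> (\<forall>\<alpha>>0. \<forall>\<phi> k x. bounded_by \<phi> k \<longrightarrow> line_seminorm \<alpha> \<phi> x \<le> ennreal (K * k * norm x)))"

lemma K_nonneg: "0 \<le> K"
  and line_seminorm_le: "0 < \<alpha> \<Longrightarrow> bounded_by \<phi> k \<Longrightarrow> line_seminorm \<alpha> \<phi> x \<le> ennreal (K * k * norm x)"
  using someI_ex[OF ex_resolvent_constant] unfolding K_def by blast+

lemma bounded_by_unit: "cdual J \<phi> \<Longrightarrow> (\<And>y. cmod (\<phi> y) \<le> norm y) \<Longrightarrow> bounded_by \<phi> 1"
  by (simp add: bounded_by_def)

text \<open>Along a vertical line \<open>R\<close> is a primitive of its (weakly integrable) derivative, hence bounded.\<close>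

lemma R_vertical_bound:
  assumes \<alpha>: "0 < \<alpha>"
  shows "norm (R (Complex \<alpha> \<beta>) x - R (Complex \<alpha> 0) x) \<le> K * norm x / \<alpha>"
proof (rule cdual_norm_bound[OF cs])
  fix \<phi> assume \<phi>: "cdual J \<phi>" "\<And>y. cmod (\<phi> y) \<le> norm y"
  have diff: "cmod (\<phi> (R (Complex \<alpha> b) x) - \<phi> (R (Complex \<alpha> a) x)) \<le> K * norm x / \<alpha>" if "a \<le> b" for a b
  proof -
    have C: "Complex \<alpha> 0 + of_real t * \<i> = Complex \<alpha> t" for t
      by (simp add: complex_eq_iff)
    have "ennreal (cmod (\<phi> (R (Complex \<alpha> b) x) - \<phi> (R (Complex \<alpha> a) x))) \<le>
        (\<integral>\<^sup>+t\<in>{a..b}. ennreal (cmod (deriv (\<lambda>z. \<phi> (R z x)) (Complex \<alpha> t))) \<partial>lborel)"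
      using line_difference_le[OF open_RHP functional_R_holomorphic[OF \<phi>(1)] that, of "Complex \<alpha> 0" \<i>] \<alpha>
      by (simp add: C)
    also have "\<dots> \<le> (\<integral>\<^sup>+t. ennreal (cmod (\<phi> (res2 \<alpha> t x))) \<partial>lborel)"
      using \<alpha> by (intro nn_integral_mono) (auto simp: indicator_def deriv_functional_R[OF \<phi>(1)] res2_def)
    finally have "ennreal \<alpha> * ennreal (cmod (\<phi> (R (Complex \<alpha> b) x) - \<phi> (R (Complex \<alpha> a) x))) \<le> line_seminorm \<alpha> \<phi> x"
      unfolding line_seminorm_def by (intro mult_left_mono) auto
    also have "\<dots> \<le> ennreal (K * 1 * norm x)"
      by (rule line_seminorm_le[OF \<alpha> bounded_by_unit[OF \<phi>]])
    finally show ?thesis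
      using \<alpha> K_nonneg by (simp add: ennreal_mult[symmetric] field_simps)
  qed
  have "\<phi> (R (Complex \<alpha> \<beta>) x - R (Complex \<alpha> 0) x) = \<phi> (R (Complex \<alpha> \<beta>) x) - \<phi> (R (Complex \<alpha> 0) x)"
    by (rule linear_diff[OF bounded_linear.linear[OF cdual_linear[OF \<phi>(1)]]])
  then show "cmod (\<phi> (R (Complex \<alpha> \<beta>) x - R (Complex \<alpha> 0) x)) \<le> K * norm x / \<alpha>"
    using diff[of 0 \<beta>] diff[of \<beta> 0] by (cases "0 \<le> \<beta>") (auto simp: norm_minus_commute)
qed

text \<open>On the real segment, continuity in \<alpha> bounds each orbit and uniform boundedness
  gives C; \<open>R_vertical_bound\<close> then reaches all heights at the cost of K / a.\<close>

lemma R_strip_bound: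
  assumes a: "0 < a"
  obtains B where "0 \<le> B" "\<And>\<alpha> \<beta> x. a \<le> \<alpha> \<Longrightarrow> \<alpha> \<le> b \<Longrightarrow> norm (R (Complex \<alpha> \<beta>) x) \<le> B * norm x"
proof -
  obtain C where C: "0 \<le> C" "\<And>\<alpha> x. \<alpha> \<in> {a..b} \<Longrightarrow> ennreal (norm (R (Complex \<alpha> 0) x)) \<le> ennreal (C * norm x)"
  proof (rule SUP_seminorm_bounded[of "{a..b}" "\<lambda>\<alpha> x. ennreal (norm (R (Complex \<alpha> 0) x))"])
    fix \<alpha> :: real and c :: ennreal and x y :: 'a and r :: real
    assume "\<alpha> \<in> {a..b}"
    then have z: "Complex \<alpha> 0 \<in> RHP" using a by simp
    show "closed {x. ennreal (norm (R (Complex \<alpha> 0) x)) \<le> c}"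
      by (intro closed_Collect_le continuous_on_ennreal continuous_on_norm continuous_on_const
          bounded_linear.continuous_on[OF R_bl[OF z]] continuous_on_id)
    show "ennreal (norm (R (Complex \<alpha> 0) (x + y))) \<le> ennreal (norm (R (Complex \<alpha> 0) x)) + ennreal (norm (R (Complex \<alpha> 0) y))"
      by (simp add: R_add[OF z] ennreal_leI norm_triangle_ineq ennreal_plus[symmetric] del: ennreal_plus)
    show "ennreal (norm (R (Complex \<alpha> 0) (r *\<^sub>R x))) = ennreal \<bar>r\<bar> * ennreal (norm (R (Complex \<alpha> 0) x))"
      by (simp add: linear_scale[OF R_linear[OF z]] ennreal_mult)
  next
    fix x
    have "continuous_on {a..b} (\<lambda>\<alpha>. norm (R (Complex \<alpha> 0) x))"
      by (intro continuous_on_norm continuous_on_compose2[OF continuous_R] continuous_on_Complex continuous_on_id continuous_on_const)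
        (use a in auto)
    then have "bdd_above ((\<lambda>\<alpha>. norm (R (Complex \<alpha> 0) x)) ` {a..b})"
      by (intro bounded_imp_bdd_above compact_imp_bounded compact_continuous_image) auto
    then obtain m where m: "\<And>\<alpha>. \<alpha> \<in> {a..b} \<Longrightarrow> norm (R (Complex \<alpha> 0) x) \<le> m"
      unfolding bdd_above_def by (metis imageI)
    have "(SUP \<alpha>\<in>{a..b}. ennreal (norm (R (Complex \<alpha> 0) x))) \<le> ennreal m"
      by (intro SUP_least ennreal_leI m)
    then show "(SUP \<alpha>\<in>{a..b}. ennreal (norm (R (Complex \<alpha> 0) x))) < top"
      by (simp add: le_less_trans)
  qed (use that in blast)
  show thesis
  proof (rule that[of "C + K / a"])
    show "0 \<le> C + K / a" using C(1) K_nonneg a by simp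
    fix \<alpha> \<beta> x assume \<alpha>: "a \<le> \<alpha>" "\<alpha> \<le> b"
    have "norm (R (Complex \<alpha> \<beta>) x) \<le> norm (R (Complex \<alpha> 0) x) + norm (R (Complex \<alpha> \<beta>) x - R (Complex \<alpha> 0) x)"
      by (rule norm_triangle_sub)
    also have "\<dots> \<le> C * norm x + K * norm x / \<alpha>"
      using C(2)[of \<alpha> x] C(1) \<alpha> a by (intro add_mono R_vertical_bound) auto
    also have "\<dots> \<le> C * norm x + K * norm x / a"
      using \<alpha> a K_nonneg by (intro add_left_mono divide_left_mono) auto
    finally show "norm (R (Complex \<alpha> \<beta>) x) \<le> (C + K / a) * norm x"
      by (simp add: algebra_simps)
  qed
qed

text \<open>R 1 - R z = (z - 1) R 1 R z is bounded on the strip. Its square applied to y is (z -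
  1)^2 times the squared resolvent at z of R 1 (R 1 y), so the two factors R 1 buy quadratic decay,
  as |z - 1| \<ge> |\<beta>|.\<close>

lemma res2_decay:
  assumes a: "0 < a"
  obtains c where "0 \<le> c"
    "\<And>\<alpha> \<beta>. a \<le> \<alpha> \<Longrightarrow> \<alpha> \<le> b \<Longrightarrow> \<beta> \<noteq> 0 \<Longrightarrow> norm (res2 \<alpha> \<beta> (R 1 (R 1 y))) \<le> c / \<beta>\<^sup>2"
proof -
  obtain B where B: "0 \<le> B" "\<And>\<alpha> \<beta> x. a \<le> \<alpha> \<Longrightarrow> \<alpha> \<le> b \<Longrightarrow> norm (R (Complex \<alpha> \<beta>) x) \<le> B * norm x"
    using R_strip_bound[OF a] by blast
  define B' where "B' = onorm (R 1) + B"
  have one: "1 \<in> RHP" by (simp add: RHP_def)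
  have B': "0 \<le> B'" using B onorm_R_nonneg[OF one] by (simp add: B'_def)
  show thesis
  proof (rule that[of "B' * (B' * norm y)"])
    show "0 \<le> B' * (B' * norm y)" using B' by simp
    fix \<alpha> \<beta> :: real assume \<alpha>: "a \<le> \<alpha>" "\<alpha> \<le> b" and \<beta>: "\<beta> \<noteq> 0"
    define z where "z = Complex \<alpha> \<beta>"
    have z: "z \<in> RHP" using \<alpha> a by (simp add: z_def)
    have S: "norm (R 1 x - R z x) \<le> B' * norm x" for x
    proof -
      have "norm (R 1 x - R z x) \<le> norm (R 1 x) + norm (R z x)" by (rule norm_triangle_ineq4)
      also have "\<dots> \<le> onorm (R 1) * norm x + B * norm x"
        unfolding z_def by (intro add_mono R_norm[OF one] B(2)[OF \<alpha>])
      finally show ?thesis by (simp add: B'_def algebra_simps)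
    qed
    have id: "(z - 1) \<cdot> R 1 (R z x) = R 1 x - R z x" for x
      using resolvent_identity[OF z one, of x] by simp
    have "res2 \<alpha> \<beta> (R 1 (R 1 y)) = R 1 (R z (R 1 (R z y)))"
      unfolding res2_def z_def[symmetric] by (simp add: R_commute[OF one z])
    then have "((z - 1) * (z - 1)) \<cdot> res2 \<alpha> \<beta> (R 1 (R 1 y)) = (z - 1) \<cdot> R 1 (R z ((z - 1) \<cdot> R 1 (R z y)))"
      by (simp add: cscale_cscale[symmetric] cbounded_cscale[OF R_cbounded] one z)
    also have "\<dots> = R 1 (R 1 y - R z y) - R z (R 1 y - R z y)"
      unfolding id by (rule refl)
    finally have "norm (((z - 1) * (z - 1)) \<cdot> res2 \<alpha> \<beta> (R 1 (R 1 y))) \<le> B' * norm (R 1 y - R z y)"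
      using S by simp
    also have "\<dots> \<le> B' * (B' * norm y)"
      by (intro mult_left_mono S B')
    finally have "(cmod (z - 1))\<^sup>2 * norm (res2 \<alpha> \<beta> (R 1 (R 1 y))) \<le> B' * (B' * norm y)"
      by (simp add: norm_cscale norm_mult power2_eq_square)
    moreover have "\<beta>\<^sup>2 \<le> (cmod (z - 1))\<^sup>2"
      by (simp add: z_def cmod_power2)
    then have "\<beta>\<^sup>2 * norm (res2 \<alpha> \<beta> (R 1 (R 1 y))) \<le> (cmod (z - 1))\<^sup>2 * norm (res2 \<alpha> \<beta> (R 1 (R 1 y)))"
      by (intro mult_right_mono) auto
    ultimately have "\<beta>\<^sup>2 * norm (res2 \<alpha> \<beta> (R 1 (R 1 y))) \<le> B' * (B' * norm y)" by simp
    then show "norm (res2 \<alpha> \<beta> (R 1 (R 1 y))) \<le> B' * (B' * norm y) / \<beta>\<^sup>2"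
      using \<beta> by (simp add: field_simps)
  qed
qed

end

section \<open>The operator integral\<close>

abbreviation mass :: "(real \<Rightarrow> real) \<Rightarrow> ennreal" where
  "mass s \<equiv> \<integral>\<^sup>+\<alpha>\<in>{0<..}. ennreal (s \<alpha>) \<partial>lborel"

text \<open>s bounds m on each vertical line and carries the integrability; for m = f' this is the
  seminorm condition. It is a separate parameter, and m is only measurable, so that cutting m off to
  a Borel set keeps the same s.\<close>

definition dominated :: "(complex \<Rightarrow> complex) \<Rightarrow> (real \<Rightarrow> real) \<Rightarrow> bool" where
  "dominated m s \<longleftrightarrow> (\<lambda>z. indicator RHP z *\<^sub>R m z) \<in> borel_measurable borel \<and> s \<in> borel_measurable borel \<and>
    (\<forall>\<alpha>. 0 \<le> s \<alpha>) \<and> (\<forall>\<alpha>>0. \<forall>\<beta>. cmod (m (Complex \<alpha> \<beta>)) \<le> s \<alpha>) \<and> mass s < top"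

context GSF_operator
begin

text \<open>The reflection to - \<beta> reproduces the resolvent argument \<alpha> - i \<beta> of
  the calculus, with m in place of f'.\<close>

definition kern :: "(complex \<Rightarrow> complex) \<Rightarrow> ('a \<Rightarrow> complex) \<Rightarrow> 'a \<Rightarrow> real \<Rightarrow> real \<Rightarrow> complex" where
  "kern m \<phi> x \<alpha> \<beta> = \<phi> (res2 \<alpha> (- \<beta>) x) * m (Complex \<alpha> \<beta>)"

abbreviation kern_int :: "(complex \<Rightarrow> complex) \<Rightarrow> ('a \<Rightarrow> complex) \<Rightarrow> 'a \<Rightarrow> real \<Rightarrow> complex" where
  "kern_int m \<phi> x \<alpha> \<equiv> complex_of_real \<alpha> * (LINT \<beta>|lborel. kern m \<phi> x \<alpha> \<beta>)"

abbreviation knorm :: "(complex \<Rightarrow> complex) \<Rightarrow> ('a \<Rightarrow> complex) \<Rightarrow> 'a \<Rightarrow> real \<Rightarrow> ennreal" where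
  "knorm m \<phi> x \<alpha> \<equiv> \<integral>\<^sup>+\<beta>. ennreal (cmod (kern m \<phi> x \<alpha> \<beta>)) \<partial>lborel"

text \<open>The double integral of the calculus, without the factor -2 / pi and the term at
  infinity.\<close>

definition F :: "(complex \<Rightarrow> complex) \<Rightarrow> ('a \<Rightarrow> complex) \<Rightarrow> 'a \<Rightarrow> complex" where
  "F m \<phi> x = (LINT \<alpha>:{0<..}|lborel. kern_int m \<phi> x \<alpha>)"

lemma kern_joint_measurable:
  assumes m: "(\<lambda>z. indicator RHP z *\<^sub>R m z) \<in> borel_measurable borel" and \<phi>: "cdual J \<phi>"
  shows "(\<lambda>(\<alpha>, \<beta>). indicator {0<..} \<alpha> *\<^sub>R kern m \<phi> x \<alpha> \<beta>) \<in> borel_measurable (borel \<Otimes>\<^sub>M borel)"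
proof -
  let ?H = "{0<..} \<times> UNIV :: (real \<times> real) set"
  have op: "open ?H" by (intro open_Times) auto
  have "continuous_on ?H (\<lambda>p. \<phi> (R (Complex (fst p) (- snd p)) (R (Complex (fst p) (- snd p)) x)))"
    by (intro bounded_linear.continuous_on[OF cdual_linear[OF \<phi>]] continuous_on_compose2[OF continuous_R2]
        continuous_intros) auto
  then have 1: "(\<lambda>p. indicator ?H p *\<^sub>R \<phi> (res2 (fst p) (- snd p) x)) \<in> borel_measurable borel"
    unfolding res2_def by (intro borel_measurable_continuous_on_indicator) (use op in auto)
  have "(\<lambda>p :: real \<times> real. Complex (fst p) (snd p)) \<in> borel_measurable borel"
    by (intro borel_measurable_continuous_onI continuous_intros)
  from measurable_compose[OF this m]
  have 2: "(\<lambda>p. indicator RHP (Complex (fst p) (snd p)) *\<^sub>R m (Complex (fst p) (snd p))) \<in> borel_measurable borel" .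
  have "(\<lambda>p. (indicator ?H p *\<^sub>R \<phi> (res2 (fst p) (- snd p) x)) *
      (indicator RHP (Complex (fst p) (snd p)) *\<^sub>R m (Complex (fst p) (snd p)))) \<in> borel_measurable borel"
    by (rule borel_measurable_times[OF 1 2])
  also have "(\<lambda>p. (indicator ?H p *\<^sub>R \<phi> (res2 (fst p) (- snd p) x)) *
      (indicator RHP (Complex (fst p) (snd p)) *\<^sub>R m (Complex (fst p) (snd p)))) =
      (\<lambda>(\<alpha>, \<beta>). indicator {0<..} \<alpha> *\<^sub>R kern m \<phi> x \<alpha> \<beta>)"
    by (auto simp: kern_def indicator_def)
  finally show ?thesis by (simp add: borel_prod)
qed

lemma kern_measurable:
  assumes "(\<lambda>z. indicator RHP z *\<^sub>R m z) \<in> borel_measurable borel" "cdual J \<phi>" "0 < \<alpha>"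
  shows "kern m \<phi> x \<alpha> \<in> borel_measurable borel"
  using measurable_compose[OF measurable_Pair1'[of \<alpha> borel borel] kern_joint_measurable[OF assms(1,2), of x]] assms(3)
  by simp

text \<open>The line bound \<open>s \<alpha>\<close> comes out of the integral; what remains is
  \<open>line_seminorm\<close> after reflecting \<beta>.\<close>

lemma kern_nn_integral:
  assumes "dominated m s" and b: "bounded_by \<phi> k" and \<alpha>: "0 < \<alpha>"
  shows "ennreal \<alpha> * knorm m \<phi> x \<alpha> \<le> ennreal (K * k * norm x * s \<alpha>)"
proof -
  have \<phi>: "cdual J \<phi>" and k: "0 \<le> k" using b by (auto simp: bounded_by_def)
  have s: "0 \<le> s \<alpha>" "\<And>\<beta>. cmod (m (Complex \<alpha> \<beta>)) \<le> s \<alpha>"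
    using assms by (auto simp: dominated_def)
  have [measurable]: "(\<lambda>\<beta>. \<phi> (res2 \<alpha> \<beta> x)) \<in> borel_measurable borel"
    by (rule functional_res2_measurable[OF cdual_linear[OF \<phi>] \<alpha>])
  have "knorm m \<phi> x \<alpha> \<le>
      (\<integral>\<^sup>+\<beta>. ennreal (s \<alpha>) * ennreal (cmod (\<phi> (res2 \<alpha> (- \<beta>) x))) \<partial>lborel)"
  proof (intro nn_integral_mono)
    fix \<beta>
    have "cmod (kern m \<phi> x \<alpha> \<beta>) \<le> s \<alpha> * cmod (\<phi> (res2 \<alpha> (- \<beta>) x))"
      using mult_left_mono[OF s(2)[of \<beta>] norm_ge_zero[of "\<phi> (res2 \<alpha> (- \<beta>) x)"]] by (simp add: kern_def norm_mult mult.commute)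
    then show "ennreal (cmod (kern m \<phi> x \<alpha> \<beta>)) \<le> ennreal (s \<alpha>) * ennreal (cmod (\<phi> (res2 \<alpha> (- \<beta>) x)))"
      using s by (simp add: ennreal_mult[symmetric] ennreal_leI)
  qed
  also have "\<dots> = ennreal (s \<alpha>) * (\<integral>\<^sup>+\<beta>. ennreal (cmod (\<phi> (res2 \<alpha> (- \<beta>) x))) \<partial>lborel)"
  proof (rule nn_integral_cmult)
    have "(\<lambda>\<beta>. \<phi> (res2 \<alpha> (- \<beta>) x)) \<in> borel_measurable borel"
      by (rule measurable_compose[of uminus]) measurable
    then show "(\<lambda>\<beta>. ennreal (cmod (\<phi> (res2 \<alpha> (- \<beta>) x)))) \<in> borel_measurable lborel" by simp
  qed
  also have "(\<integral>\<^sup>+\<beta>. ennreal (cmod (\<phi> (res2 \<alpha> (- \<beta>) x))) \<partial>lborel) = (\<integral>\<^sup>+\<beta>. ennreal (cmod (\<phi> (res2 \<alpha> \<beta> x))) \<partial>lborel)"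
    using nn_integral_real_affine[of "\<lambda>\<beta>. ennreal (cmod (\<phi> (res2 \<alpha> \<beta> x)))" "-1" 0] by simp
  finally have "ennreal \<alpha> * knorm m \<phi> x \<alpha> \<le> ennreal (s \<alpha>) * line_seminorm \<alpha> \<phi> x"
    unfolding line_seminorm_def by (metis mult.left_commute mult_left_mono zero_le)
  also have "\<dots> \<le> ennreal (s \<alpha>) * ennreal (K * k * norm x)"
    by (intro mult_left_mono line_seminorm_le \<alpha> b) auto
  also have "\<dots> = ennreal (K * k * norm x * s \<alpha>)"
    using s K_nonneg k by (simp add: ennreal_mult[symmetric] mult.commute)
  finally show ?thesis .
qed

lemma kern_integrable:
  assumes d: "dominated m s" and b: "bounded_by \<phi> k" and \<alpha>: "0 < \<alpha>"
  shows "integrable lborel (kern m \<phi> x \<alpha>)"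
proof (rule integrableI_bounded)
  show "kern m \<phi> x \<alpha> \<in> borel_measurable lborel"
    using kern_measurable[of m \<phi> \<alpha> x] d b \<alpha> by (simp add: dominated_def bounded_by_def)
  have "ennreal \<alpha> * knorm m \<phi> x \<alpha> < top"
    using kern_nn_integral[OF assms, of x] by (rule le_less_trans) simp
  then show "knorm m \<phi> x \<alpha> < \<infinity>"
    using \<alpha> by (auto simp: ennreal_mult_less_top)
qed

lemma inner_measurable:
  assumes m: "(\<lambda>z. indicator RHP z *\<^sub>R m z) \<in> borel_measurable borel" and \<phi>: "cdual J \<phi>"
  shows "(\<lambda>\<alpha>. indicator {0<..} \<alpha> *\<^sub>R kern_int m \<phi> x \<alpha>) \<in> borel_measurable lborel"
proof -
  have "(\<lambda>\<alpha>. LINT \<beta>|lborel. indicator {0<..} \<alpha> *\<^sub>R kern m \<phi> x \<alpha> \<beta>) \<in> borel_measurable lborel"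
    using kern_joint_measurable[OF assms, of x]
    by (intro lborel.borel_measurable_lebesgue_integral) (simp add: cong: measurable_cong_sets)
  then have "(\<lambda>\<alpha>. complex_of_real \<alpha> * (LINT \<beta>|lborel. indicator {0<..} \<alpha> *\<^sub>R kern m \<phi> x \<alpha> \<beta>)) \<in> borel_measurable lborel"
    by (intro borel_measurable_times borel_measurable_of_real) auto
  then show ?thesis
    by (rule back_subst[of "\<lambda>u. u \<in> borel_measurable lborel"]) (auto simp: indicator_def)
qed

lemma inner_norm_le:
  assumes d: "dominated m s" and b: "bounded_by \<phi> k"
  shows "ennreal (cmod (indicator {0<..} \<alpha> *\<^sub>R kern_int m \<phi> x \<alpha>)) \<le>
     ennreal \<alpha> * knorm m \<phi> x \<alpha> * indicator {0<..} \<alpha>"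
proof (cases "0 < \<alpha>")
  case True
  have "ennreal (cmod (LINT \<beta>|lborel. kern m \<phi> x \<alpha> \<beta>)) \<le> knorm m \<phi> x \<alpha>"
    by (rule integral_norm_bound_ennreal[OF kern_integrable[OF d b True]])
  then show ?thesis
    using True by (simp add: norm_mult ennreal_mult mult_left_mono)
qed simp

lemma outer_integrable:
  assumes d: "dominated m s" and b: "bounded_by \<phi> k"
  shows "set_integrable lborel {0<..} (\<lambda>\<alpha>. kern_int m \<phi> x \<alpha>)"
  unfolding set_integrable_def
proof (rule integrableI_bounded)
  show "(\<lambda>\<alpha>. indicator {0<..} \<alpha> *\<^sub>R kern_int m \<phi> x \<alpha>) \<in> borel_measurable lborel"
    using d b by (intro inner_measurable) (auto simp: dominated_def bounded_by_def)
  have [measurable]: "s \<in> borel_measurable borel" and s: "\<And>\<alpha>. 0 \<le> s \<alpha>" "mass s < top"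
    using d by (auto simp: dominated_def)
  have k: "0 \<le> k" using b by (simp add: bounded_by_def)
  have "(\<integral>\<^sup>+\<alpha>. ennreal (cmod (indicator {0<..} \<alpha> *\<^sub>R kern_int m \<phi> x \<alpha>)) \<partial>lborel)
    \<le> (\<integral>\<^sup>+\<alpha>. ennreal (K * k * norm x) * (ennreal (s \<alpha>) * indicator {0<..} \<alpha>) \<partial>lborel)"
  proof (intro nn_integral_mono)
    fix \<alpha> :: real
    have "ennreal \<alpha> * knorm m \<phi> x \<alpha> * indicator {0<..} \<alpha> \<le>
        ennreal (K * k * norm x) * (ennreal (s \<alpha>) * indicator {0<..} \<alpha>)"
      using kern_nn_integral[OF d b, of \<alpha> x] K_nonneg k s
      by (cases "0 < \<alpha>") (auto simp: ennreal_mult[symmetric])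
    then show "ennreal (cmod (indicator {0<..} \<alpha> *\<^sub>R kern_int m \<phi> x \<alpha>)) \<le>
        ennreal (K * k * norm x) * (ennreal (s \<alpha>) * indicator {0<..} \<alpha>)"
      by (rule order_trans[OF inner_norm_le[OF d b]])
  qed
  also have "\<dots> = ennreal (K * k * norm x) * mass s"
    by (intro nn_integral_cmult) measurable
  also have "\<dots> < \<infinity>" using s by (simp add: ennreal_mult_less_top)
  finally show "(\<integral>\<^sup>+\<alpha>. ennreal (cmod (indicator {0<..} \<alpha> *\<^sub>R kern_int m \<phi> x \<alpha>)) \<partial>lborel) < \<infinity>" .
qed

lemma F_le_iterated:
  assumes d: "dominated m s" and b: "bounded_by \<phi> k"
  shows "ennreal (cmod (F m \<phi> x)) \<le>
    (\<integral>\<^sup>+\<alpha>\<in>{0<..}. ennreal \<alpha> * knorm m \<phi> x \<alpha> \<partial>lborel)"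
proof -
  have "ennreal (cmod (F m \<phi> x)) \<le>
      (\<integral>\<^sup>+\<alpha>. ennreal (cmod (indicator {0<..} \<alpha> *\<^sub>R kern_int m \<phi> x \<alpha>)) \<partial>lborel)"
    unfolding F_def set_lebesgue_integral_def
    by (intro integral_norm_bound_ennreal outer_integrable[OF d b, unfolded set_integrable_def])
  also have "\<dots> \<le> (\<integral>\<^sup>+\<alpha>\<in>{0<..}. ennreal \<alpha> * knorm m \<phi> x \<alpha> \<partial>lborel)"
    by (intro nn_integral_mono inner_norm_le[OF d b])
  finally show ?thesis .
qed

lemma F_bound:
  assumes d: "dominated m s" and b: "bounded_by \<phi> k"
  shows "ennreal (cmod (F m \<phi> x)) \<le> ennreal (K * k * norm x) * mass s"
proof -
  have [measurable]: "s \<in> borel_measurable borel" and s: "\<And>\<alpha>. 0 \<le> s \<alpha>"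
    using d by (auto simp: dominated_def)
  have k: "0 \<le> k" using b by (simp add: bounded_by_def)
  have "ennreal (cmod (F m \<phi> x)) \<le> (\<integral>\<^sup>+\<alpha>. ennreal (K * k * norm x) * (ennreal (s \<alpha>) * indicator {0<..} \<alpha>) \<partial>lborel)"
  proof (rule order_trans[OF F_le_iterated[OF d b]], intro nn_integral_mono)
    fix \<alpha> :: real
    show "ennreal \<alpha> * knorm m \<phi> x \<alpha> * indicator {0<..} \<alpha> \<le>
        ennreal (K * k * norm x) * (ennreal (s \<alpha>) * indicator {0<..} \<alpha>)"
      using kern_nn_integral[OF d b, of \<alpha> x] K_nonneg k s
      by (cases "0 < \<alpha>") (auto simp: ennreal_mult[symmetric])
  qed
  also have "\<dots> = ennreal (K * k * norm x) * mass s"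
    by (intro nn_integral_cmult) measurable
  finally show ?thesis .
qed

text \<open>One statement covers additivity in the vector, the splitting of m over a set and its
  complement, and differences of symbols.\<close>

lemma F_combine:
  assumes "dominated m s" "dominated m' s'" "dominated m'' s''" "bounded_by \<phi> k"
    and eq: "\<And>\<alpha> \<beta>. 0 < \<alpha> \<Longrightarrow> kern m \<phi> x \<alpha> \<beta> = kern m' \<phi> x' \<alpha> \<beta> + kern m'' \<phi> x'' \<alpha> \<beta>"
  shows "F m \<phi> x = F m' \<phi> x' + F m'' \<phi> x''"
proof -
  have "F m \<phi> x = (LINT \<alpha>:{0<..}|lborel. kern_int m' \<phi> x' \<alpha> +
      kern_int m'' \<phi> x'' \<alpha>)"
    unfolding F_def
  proof (rule set_lebesgue_integral_cong)
    show "\<forall>\<alpha>. \<alpha> \<in> {0<..} \<longrightarrow> kern_int m \<phi> x \<alpha> =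
      kern_int m' \<phi> x' \<alpha> + kern_int m'' \<phi> x'' \<alpha>"
      using assms(2-4) by (auto simp: eq kern_integrable distrib_left)
  qed simp
  also have "\<dots> = F m' \<phi> x' + F m'' \<phi> x''"
    unfolding F_def using assms by (intro set_integral_add outer_integrable)
  finally show ?thesis .
qed

lemma F_add:
  assumes "dominated m s" "bounded_by \<phi> k"
  shows "F m \<phi> (x + y) = F m \<phi> x + F m \<phi> y"
proof (rule F_combine[OF assms(1,1,1,2)])
  fix \<alpha> \<beta> :: real assume \<alpha>: "0 < \<alpha>"
  have "\<phi> (res2 \<alpha> (- \<beta>) (x + y)) = \<phi> (res2 \<alpha> (- \<beta>) x) + \<phi> (res2 \<alpha> (- \<beta>) y)"
    using assms(2) by (simp add: bounded_by_def cdual_linear linear_add[OF bounded_linear.linear] res2_bl[OF \<alpha>])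
  then show "kern m \<phi> (x + y) \<alpha> \<beta> = kern m \<phi> x \<alpha> \<beta> + kern m \<phi> y \<alpha> \<beta>"
    by (simp add: kern_def distrib_right)
qed

lemma F_cscale:
  assumes "cdual J \<phi>"
  shows "F m \<phi> (c \<cdot> x) = c * F m \<phi> x"
proof -
  have "kern_int m \<phi> (c \<cdot> x) \<alpha> =
      c * kern_int m \<phi> x \<alpha>" if "0 < \<alpha>" for \<alpha>
  proof -
    have "kern m \<phi> (c \<cdot> x) \<alpha> \<beta> = c * kern m \<phi> x \<alpha> \<beta>" for \<beta>
      using that by (simp add: kern_def res2_def cbounded_cscale[OF R_cbounded] cdual_cscale[OF assms])
    then show ?thesis by simp
  qed
  then have "F m \<phi> (c \<cdot> x) = (LINT \<alpha>:{0<..}|lborel. c * kern_int m \<phi> x \<alpha>)"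
    unfolding F_def by (intro set_lebesgue_integral_cong) auto
  then show ?thesis by (simp add: F_def)
qed

end

section \<open>A vector representing the weak integral\<close>

lemma integral_eq_lebesgue_integral:
  fixes f :: "real \<Rightarrow> 'a::euclidean_space"
  assumes "continuous_on {a..b} f"
  shows "integral {a..b} f = (LINT t|lborel. indicator {a..b} t *\<^sub>R f t)"
  using set_borel_integral_eq_integral(2)[OF borel_integrable_atLeastAtMost'[OF assms]]
  by (simp add: set_lebesgue_integral_def)

lemma inverse_square_tail:
  assumes N: "0 < N"
  shows "(\<integral>\<^sup>+\<beta>. ennreal (1 / \<beta>\<^sup>2) * indicator {\<beta>. N < \<bar>\<beta>\<bar>} \<beta> \<partial>lborel) \<le> ennreal (2 / N)"
proof -
  define q where "q \<beta> = ennreal (1 / \<beta>\<^sup>2) * indicator {N..} \<beta>" for \<beta> :: real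
  have [measurable]: "q \<in> borel_measurable borel" unfolding q_def by measurable
  have half: "(\<integral>\<^sup>+\<beta>. q \<beta> \<partial>lborel) = ennreal (1 / N)"
  proof -
    have "(\<integral>\<^sup>+\<beta>. ennreal (1 / \<beta>\<^sup>2) * indicator {N..} \<beta> \<partial>lborel) = ennreal (0 - (- (1 / N)))"
    proof (rule nn_integral_FTC_atLeast)
      show "((\<lambda>\<beta>. - (1 / \<beta>)) has_real_derivative 1 / \<beta>\<^sup>2) (at \<beta>)" if "N \<le> \<beta>" for \<beta>
        using that N by (auto intro!: derivative_eq_intros simp: power2_eq_square)
      have "((\<lambda>\<beta>::real. 1 / \<beta>) \<longlongrightarrow> 0) at_top"
        by (intro tendsto_divide_0[OF tendsto_const] filterlim_at_top_imp_at_infinity filterlim_ident)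
      from tendsto_minus[OF this] show "((\<lambda>\<beta>::real. - (1 / \<beta>)) \<longlongrightarrow> 0) at_top" by simp
    qed (use N in auto)
    then show ?thesis by (simp add: q_def)
  qed
  have "(\<integral>\<^sup>+\<beta>. ennreal (1 / \<beta>\<^sup>2) * indicator {\<beta>. N < \<bar>\<beta>\<bar>} \<beta> \<partial>lborel) \<le> (\<integral>\<^sup>+\<beta>. q \<beta> + q (- \<beta>) \<partial>lborel)"
    by (intro nn_integral_mono) (auto simp: q_def indicator_def)
  also have "\<dots> = (\<integral>\<^sup>+\<beta>. q \<beta> \<partial>lborel) + (\<integral>\<^sup>+\<beta>. q (- \<beta>) \<partial>lborel)"
    by (intro nn_integral_add) measurable
  also have "(\<integral>\<^sup>+\<beta>. q (- \<beta>) \<partial>lborel) = (\<integral>\<^sup>+\<beta>. q \<beta> \<partial>lborel)"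
    using nn_integral_real_affine[of q "-1" 0] by simp
  finally show ?thesis
    using N by (simp add: half ennreal_plus[symmetric] del: ennreal_plus)
qed

lemma dominated_restrict:
  assumes "dominated m s" "B \<in> sets borel"
  shows "dominated (\<lambda>z. indicator B z *\<^sub>R m z) s"
proof -
  have "(\<lambda>z. indicator B z *\<^sub>R (indicator RHP z *\<^sub>R m z)) \<in> borel_measurable borel"
    using assms(1) unfolding dominated_def
    by (intro borel_measurable_scaleR[OF borel_measurable_indicator[OF assms(2)]]) blast
  then have "(\<lambda>z. indicator RHP z *\<^sub>R (indicator B z *\<^sub>R m z)) \<in> borel_measurable borel"
    by (simp add: mult.commute)
  moreover have "cmod (indicator B (Complex \<alpha> \<beta>) *\<^sub>R m (Complex \<alpha> \<beta>)) \<le> s \<alpha>" if "0 < \<alpha>" for \<alpha> \<beta>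
    using assms(1) that by (auto simp: indicator_def dominated_def)
  ultimately show ?thesis
    using assms(1) by (simp add: dominated_def)
qed

definition rect :: "real \<Rightarrow> real \<Rightarrow> real \<Rightarrow> complex set" where
  "rect a b N = {z. a \<le> Re z \<and> Re z \<le> b \<and> - N \<le> Im z \<and> Im z \<le> N}"

lemma rect_borel: "rect a b N \<in> sets borel"
proof -
  have "rect a b N = cbox (Complex a (- N)) (Complex b N)"
    by (auto simp: rect_def in_cbox_complex_iff)
  then show ?thesis by simp
qed

context GSF_operator
begin

text \<open>On a compact rectangle the integrand is continuous in norm, so the iterated
  vector-valued gauge integral exists and commutes with functionals; for the resulting continuous
  scalar functions it agrees with the Lebesgue integral in \<open>F\<close>.\<close>

lemma rect_representation:
  assumes m: "continuous_on RHP m" and a: "0 < a"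
  obtains v where "\<And>\<phi>. cdual J \<phi> \<Longrightarrow> \<phi> v = F (\<lambda>z. indicator (rect a b N) z *\<^sub>R m z) \<phi> x"
proof -
  define h where "h \<alpha> \<beta> = m (Complex \<alpha> \<beta>) \<cdot> res2 \<alpha> (- \<beta>) x" for \<alpha> \<beta>
  define I where "I \<alpha> = integral {-N..N} (h \<alpha>)" for \<alpha>
  have ch: "continuous_on ({a..b} \<times> cbox (- N) N) (\<lambda>(\<alpha>, \<beta>). h \<alpha> \<beta>)"
  proof -
    have cm: "continuous_on ({a..b} \<times> cbox (- N) N) (\<lambda>p. m (Complex (fst p) (snd p)))"
      using a by (intro continuous_on_compose2[OF m] continuous_intros) auto
    have cr: "continuous_on ({a..b} \<times> cbox (- N) N) (\<lambda>p. res2 (fst p) (- snd p) x)"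
      unfolding res2_def using a by (intro continuous_on_compose2[OF continuous_R2] continuous_intros) auto
    show ?thesis
      unfolding h_def case_prod_beta cscale_def
      by (intro continuous_intros cm cr bounded_linear.continuous_on[OF J_bounded])
  qed
  have ci: "continuous_on {-N..N} (h \<alpha>)" if "\<alpha> \<in> {a..b}" for \<alpha>
  proof -
    have "continuous_on {-N..N} (\<lambda>\<beta>. (\<lambda>(\<alpha>, \<beta>). h \<alpha> \<beta>) (\<alpha>, \<beta>))"
      using that by (intro continuous_on_compose2[OF ch] continuous_intros) auto
    then show ?thesis by simp
  qed
  have cI: "continuous_on {a..b} I"
    unfolding I_def using integral_continuous_on_param[OF ch] by simp
  define v where "v = integral {a..b} (\<lambda>\<alpha>. \<alpha> *\<^sub>R I \<alpha>)"
  have "\<phi> v = F (\<lambda>z. indicator (rect a b N) z *\<^sub>R m z) \<phi> x" if \<phi>: "cdual J \<phi>" for \<phi>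
  proof -
    note bl = cdual_linear[OF \<phi>]
    interpret \<phi>: bounded_linear \<phi> by (rule bl)
    have kern_h: "\<phi> (h \<alpha> \<beta>) = kern m \<phi> x \<alpha> \<beta>" for \<alpha> \<beta>
      by (simp add: h_def kern_def cdual_cscale[OF \<phi>])
    have inner: "\<phi> (I \<alpha>) = (LINT \<beta>|lborel. indicator {-N..N} \<beta> *\<^sub>R kern m \<phi> x \<alpha> \<beta>)" if \<alpha>: "\<alpha> \<in> {a..b}" for \<alpha>
    proof -
      have "\<phi> (I \<alpha>) = integral {-N..N} (\<phi> \<circ> h \<alpha>)"
        unfolding I_def by (intro integral_linear[symmetric] integrable_continuous_real ci \<alpha> bl)
      also have "\<dots> = (LINT \<beta>|lborel. indicator {-N..N} \<beta> *\<^sub>R (\<phi> \<circ> h \<alpha>) \<beta>)"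
        unfolding o_def by (intro integral_eq_lebesgue_integral bounded_linear.continuous_on[OF bl] ci \<alpha>)
      finally show ?thesis by (simp add: kern_h)
    qed
    have cv: "continuous_on {a..b} (\<lambda>\<alpha>. \<alpha> *\<^sub>R I \<alpha>)"
      by (intro continuous_intros cI)
    define mr where "mr = (\<lambda>z. indicator (rect a b N) z *\<^sub>R m z)"
    have "\<phi> v = integral {a..b} (\<phi> \<circ> (\<lambda>\<alpha>. \<alpha> *\<^sub>R I \<alpha>))"
      unfolding v_def by (intro integral_linear[symmetric] integrable_continuous_real cv bl)
    also have "\<dots> = (LINT \<alpha>|lborel. indicator {a..b} \<alpha> *\<^sub>R (\<phi> \<circ> (\<lambda>\<alpha>. \<alpha> *\<^sub>R I \<alpha>)) \<alpha>)"
      unfolding o_def by (intro integral_eq_lebesgue_integral bounded_linear.continuous_on[OF bl] cv)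
    also have "\<dots> = (LINT \<alpha>|lborel. indicator {0<..} \<alpha> *\<^sub>R (complex_of_real \<alpha> *
        (LINT \<beta>|lborel. kern mr \<phi> x \<alpha> \<beta>)))"
    proof (rule Bochner_Integration.integral_cong[OF refl])
      fix \<alpha> :: real
      have kr: "kern mr \<phi> x \<alpha> \<beta> =
          (if \<alpha> \<in> {a..b} then indicator {-N..N} \<beta> *\<^sub>R kern m \<phi> x \<alpha> \<beta> else 0)" for \<beta>
        by (auto simp: kern_def mr_def rect_def indicator_def)
      show "indicator {a..b} \<alpha> *\<^sub>R (\<phi> \<circ> (\<lambda>\<alpha>. \<alpha> *\<^sub>R I \<alpha>)) \<alpha> = indicator {0<..} \<alpha> *\<^sub>R (complex_of_real \<alpha> *
        (LINT \<beta>|lborel. kern mr \<phi> x \<alpha> \<beta>))"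
      proof (cases "\<alpha> \<in> {a..b}")
        case True
        then show ?thesis using a by (simp add: kr inner \<phi>.scaleR scaleR_conv_of_real)
      next
        case False
        then have "(LINT \<beta>|lborel. kern mr \<phi> x \<alpha> \<beta>) = 0"
          unfolding kr by (simp only: if_False Bochner_Integration.integral_zero)
        then show ?thesis using False by simp
      qed
    qed
    finally show ?thesis by (simp add: F_def set_lebesgue_integral_def mr_def)
  qed
  then show thesis by (rule that)
qed

lemma strip_truncation:
  assumes d: "dominated m s" and e: "0 < e"
  obtains M :: real where "1 \<le> M" "(\<integral>\<^sup>+\<alpha>. ennreal (s \<alpha>) * indicator ({0<..} - {1 / M..M}) \<alpha> \<partial>lborel) < ennreal e"
proof -
  have [measurable]: "s \<in> borel_measurable borel" and fin: "mass s < top"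
    using d by (auto simp: dominated_def)
  have "(\<lambda>n. \<integral>\<^sup>+\<alpha>. ennreal (s \<alpha>) * indicator ({0<..} - {1 / real (Suc n)..real (Suc n)}) \<alpha> \<partial>lborel) \<longlonglongrightarrow>
      (\<integral>\<^sup>+\<alpha>. 0 \<partial>(lborel :: real measure))"
  proof (rule nn_integral_dominated_convergence[where w="\<lambda>\<alpha>. ennreal (s \<alpha>) * indicator {0<..} \<alpha>"])
    show "AE \<alpha> in lborel. (\<lambda>n. ennreal (s \<alpha>) * indicator ({0<..} - {1 / real (Suc n)..real (Suc n)}) \<alpha>) \<longlonglongrightarrow> 0"
    proof (intro AE_I2 tendsto_eventually)
      fix \<alpha> :: real
      obtain N :: nat where N: "max \<alpha> (1 / \<alpha>) < real N" using reals_Archimedean2 by blast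
      show "\<forall>\<^sub>F n in sequentially. ennreal (s \<alpha>) * indicator ({0<..} - {1 / real (Suc n)..real (Suc n)}) \<alpha> = 0"
      proof (rule eventually_sequentiallyI[of N])
        fix n assume "N \<le> n"
        then have n: "\<alpha> \<le> real (Suc n)" "1 / \<alpha> \<le> real (Suc n)" using N by auto
        have "1 / real (Suc n) \<le> \<alpha>" if "0 < \<alpha>"
          using n(2) that by (simp add: field_simps)
        then have "\<alpha> \<notin> {0<..} - {1 / real (Suc n)..real (Suc n)}" using n(1) by auto
        then show "ennreal (s \<alpha>) * indicator ({0<..} - {1 / real (Suc n)..real (Suc n)}) \<alpha> = 0" by simp
      qed
    qed
  qed (use fin in \<open>auto simp: indicator_def\<close>)
  then have "\<forall>\<^sub>F n in sequentially.
      (\<integral>\<^sup>+\<alpha>. ennreal (s \<alpha>) * indicator ({0<..} - {1 / real (Suc n)..real (Suc n)}) \<alpha> \<partial>lborel) < ennreal e"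
    using e by (intro order_tendstoD) auto
  then obtain n where "(\<integral>\<^sup>+\<alpha>. ennreal (s \<alpha>) * indicator ({0<..} - {1 / real (Suc n)..real (Suc n)}) \<alpha> \<partial>lborel) < ennreal e"
    by (auto simp: eventually_sequentially)
  then show thesis by (intro that[of "real (Suc n)"]) auto
qed

text \<open>Outside a strip 1 / M \<le> \<alpha> \<le> M the remaining mass of s is small; inside
  it, \<open>res2_decay\<close> makes large heights negligible. The bound is proportional to k,
  hence uniform over functionals of norm at most one.\<close>

lemma tail_small:
  assumes d: "dominated m s" and x: "x = R 1 (R 1 y)" and e: "0 < e"
  obtains a b N where "0 < a"
    "\<And>\<phi> k. bounded_by \<phi> k \<Longrightarrow> cmod (F (\<lambda>z. indicator (- rect a b N) z *\<^sub>R m z) \<phi> x) \<le> e * k"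
proof -
  have [measurable]: "s \<in> borel_measurable borel" and s0: "\<And>\<alpha>. 0 \<le> s \<alpha>"
    and fin: "mass s < top"
    and sm: "\<And>\<alpha> \<beta>. 0 < \<alpha> \<Longrightarrow> cmod (m (Complex \<alpha> \<beta>)) \<le> s \<alpha>"
    using d by (auto simp: dominated_def)
  obtain S where S: "mass s = ennreal S" "0 \<le> S"
    using fin by (cases "mass s") auto
  define e1 where "e1 = e / (2 * (K * norm x + 1))"
  have Kx: "0 \<le> K * norm x" using K_nonneg by simp
  have "0 < e1" using e Kx by (simp add: e1_def add_nonneg_pos)
  then obtain M where M: "1 \<le> M"
    "(\<integral>\<^sup>+\<alpha>. ennreal (s \<alpha>) * indicator ({0<..} - {1 / M..M}) \<alpha> \<partial>lborel) < ennreal e1"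
    using strip_truncation[OF d] by blast
  have M0: "0 < 1 / M" using M(1) by simp
  obtain c where c: "0 \<le> c"
    "\<And>\<alpha> \<beta>. 1 / M \<le> \<alpha> \<Longrightarrow> \<alpha> \<le> M \<Longrightarrow> \<beta> \<noteq> 0 \<Longrightarrow> norm (res2 \<alpha> \<beta> x) \<le> c / \<beta>\<^sup>2"
    using res2_decay[OF M0, of M y] unfolding x by blast
  \<comment> \<open>Heights beyond N contribute at most k e / 2: M bounds \<alpha>, c is the decay
    constant, S the mass of s and 2 / N the tail of the inverse square. \<open>e1\<close> yields the
    other half, for the part outside the strip.\<close>
  define N where "N = 4 * M * c * S / e + 1"
  have N: "0 < N" using M(1) c(1) S(2) e by (simp add: N_def add_nonneg_pos)
  have NS: "M * c * (2 / N) * S \<le> e / 2"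
  proof -
    have "4 * (M * c * S) \<le> e * N" using e by (simp add: N_def field_simps)
    then show ?thesis using N by (simp add: field_simps)
  qed
  have "cmod (F (\<lambda>z. indicator (- rect (1 / M) M N) z *\<^sub>R m z) \<phi> x) \<le> e * k" if b: "bounded_by \<phi> k" for \<phi> k
  proof -
    define m' where "m' = (\<lambda>z. indicator (- rect (1 / M) M N) z *\<^sub>R m z)"
    have d': "dominated m' s"
      unfolding m'_def by (rule dominated_restrict[OF d]) (use rect_borel in auto)
    have k: "0 \<le> k" "\<And>y. cmod (\<phi> y) \<le> k * norm y" using b by (auto simp: bounded_by_def)
    have pw: "ennreal \<alpha> * knorm m' \<phi> x \<alpha> * indicator {0<..} \<alpha> \<le>
        ennreal (K * k * norm x) * (ennreal (s \<alpha>) * indicator ({0<..} - {1 / M..M}) \<alpha>) +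
        ennreal (M * (k * c) * (2 / N)) * (ennreal (s \<alpha>) * indicator {0<..} \<alpha>)" (is "_ \<le> ?a + ?b") for \<alpha>
    proof -
      consider "\<alpha> \<le> 0" | "0 < \<alpha>" "\<alpha> \<notin> {1 / M..M}" | "0 < \<alpha>" "\<alpha> \<in> {1 / M..M}" by fastforce
      then show ?thesis
      proof cases
        case 2
        have "ennreal \<alpha> * knorm m' \<phi> x \<alpha> \<le> ennreal (K * k * norm x * s \<alpha>)"
          by (rule kern_nn_integral[OF d' b 2(1)])
        also have "\<dots> = ?a"
          using 2 K_nonneg k s0 by (simp add: ennreal_mult[symmetric])
        finally have "ennreal \<alpha> * knorm m' \<phi> x \<alpha> \<le> ?a" .
        then have "ennreal \<alpha> * knorm m' \<phi> x \<alpha> \<le> ?a + ?b"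
          by (rule order_trans) (rule add_increasing2; simp)
        then show ?thesis using 2 by simp
      next
        case 3
        have "knorm m' \<phi> x \<alpha> \<le>
          (\<integral>\<^sup>+\<beta>. ennreal (s \<alpha> * (k * c)) * (ennreal (1 / \<beta>\<^sup>2) * indicator {\<beta>. N < \<bar>\<beta>\<bar>} \<beta>) \<partial>lborel)"
        proof (intro nn_integral_mono)
          fix \<beta> :: real
          show "ennreal (cmod (kern m' \<phi> x \<alpha> \<beta>)) \<le>
            ennreal (s \<alpha> * (k * c)) * (ennreal (1 / \<beta>\<^sup>2) * indicator {\<beta>. N < \<bar>\<beta>\<bar>} \<beta>)"
          proof (cases "N < \<bar>\<beta>\<bar>")
            case True
            then have "\<beta> \<noteq> 0" using N by auto
            have "cmod (\<phi> (res2 \<alpha> (- \<beta>) x)) \<le> k * norm (res2 \<alpha> (- \<beta>) x)" by (rule k(2))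
            also have "\<dots> \<le> k * (c / \<beta>\<^sup>2)"
              using c(2)[of \<alpha> "- \<beta>"] 3 \<open>\<beta> \<noteq> 0\<close> k(1) by (intro mult_left_mono) auto
            finally have *: "cmod (\<phi> (res2 \<alpha> (- \<beta>) x)) \<le> k * (c / \<beta>\<^sup>2)" .
            have "cmod (m' (Complex \<alpha> \<beta>)) \<le> s \<alpha>"
              using d' 3(1) by (simp add: dominated_def)
            then have "cmod (kern m' \<phi> x \<alpha> \<beta>) \<le> (k * (c / \<beta>\<^sup>2)) * s \<alpha>"
              unfolding kern_def norm_mult using * k c by (intro mult_mono) auto
            then have "cmod (kern m' \<phi> x \<alpha> \<beta>) \<le> s \<alpha> * (k * c) * (1 / \<beta>\<^sup>2)"
              by (simp add: mult_ac)
            then show ?thesis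
              using True s0 k c by (simp add: ennreal_mult[symmetric] ennreal_leI)
          next
            case False
            then have "Complex \<alpha> \<beta> \<in> rect (1 / M) M N" using 3 by (auto simp: rect_def)
            then show ?thesis by (simp add: kern_def m'_def)
          qed
        qed
        also have "\<dots> = ennreal (s \<alpha> * (k * c)) * (\<integral>\<^sup>+\<beta>. ennreal (1 / \<beta>\<^sup>2) * indicator {\<beta>. N < \<bar>\<beta>\<bar>} \<beta> \<partial>lborel)"
          by (intro nn_integral_cmult) measurable
        also have "\<dots> \<le> ennreal (s \<alpha> * (k * c)) * ennreal (2 / N)"
          by (intro mult_left_mono inverse_square_tail N) auto
        finally have "ennreal \<alpha> * knorm m' \<phi> x \<alpha> \<le>
            ennreal M * (ennreal (s \<alpha> * (k * c)) * ennreal (2 / N))"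
          using 3 by (intro mult_mono ennreal_leI) auto
        also have "\<dots> = ?b"
          using 3 s0 k c M(1) N by (simp add: ennreal_mult[symmetric] mult_ac)
        finally have "ennreal \<alpha> * knorm m' \<phi> x \<alpha> \<le> ?b" .
        then have "ennreal \<alpha> * knorm m' \<phi> x \<alpha> \<le> ?a + ?b"
          by (rule order_trans) (rule add_increasing; simp)
        then show ?thesis using 3 by simp
      qed simp
    qed
    have "ennreal (cmod (F m' \<phi> x)) \<le>
      (\<integral>\<^sup>+\<alpha>. ennreal (K * k * norm x) * (ennreal (s \<alpha>) * indicator ({0<..} - {1 / M..M}) \<alpha>) +
        ennreal (M * (k * c) * (2 / N)) * (ennreal (s \<alpha>) * indicator {0<..} \<alpha>) \<partial>lborel)"
      by (rule order_trans[OF F_le_iterated[OF d' b]]) (intro nn_integral_mono pw)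
    also have "\<dots> = ennreal (K * k * norm x) * (\<integral>\<^sup>+\<alpha>. ennreal (s \<alpha>) * indicator ({0<..} - {1 / M..M}) \<alpha> \<partial>lborel) +
        ennreal (M * (k * c) * (2 / N)) * ennreal S"
      unfolding S(1)[symmetric] by (simp add: nn_integral_add nn_integral_cmult)
    also have "\<dots> \<le> ennreal (K * k * norm x) * ennreal e1 + ennreal (M * (k * c) * (2 / N)) * ennreal S"
      using M(2) by (intro add_right_mono mult_left_mono) auto
    also have "\<dots> = ennreal (k * (K * norm x * e1 + M * c * (2 / N) * S))"
      using K_nonneg k c M(1) N S(2) \<open>0 < e1\<close>
      by (simp add: ennreal_mult[symmetric] ennreal_plus[symmetric] algebra_simps del: ennreal_plus)
    also have "\<dots> \<le> ennreal (k * e)"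
    proof (intro ennreal_leI mult_left_mono k)
      have "K * norm x * e1 \<le> (K * norm x + 1) * e1" using \<open>0 < e1\<close> by (intro mult_right_mono) auto
      also have "\<dots> = e / 2" using Kx by (simp add: e1_def field_simps)
      finally show "K * norm x * e1 + M * c * (2 / N) * S \<le> e" using NS by simp
    qed
    finally show ?thesis
      using k e by (simp add: m'_def mult.commute ennreal_le_iff)
  qed
  then show thesis using that[OF M0] by blast
qed

text \<open>Replacing x by a nearby x' in the range of (1 + A)^-2 costs at most K S norm (x - x')
  times k. For x' a rectangle integral is given by a vector and the rest is small by
  \<open>tail_small\<close>.\<close>

lemma approximate_representation:
  assumes d: "dominated m s" and m: "continuous_on RHP m" and e: "0 < e"
  obtains v where "\<And>\<phi> k. bounded_by \<phi> k \<Longrightarrow> cmod (F m \<phi> x - \<phi> v) \<le> e * k"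
proof -
  have fin: "mass s < top"
    using d by (auto simp: dominated_def)
  obtain S where S: "mass s = ennreal S" "0 \<le> S"
    using fin by (cases "mass s") auto
  have one: "1 \<in> RHP" by (simp add: RHP_def)
  have pos: "0 < 2 * (K * S + 1)" using K_nonneg S(2) by (simp add: add_nonneg_pos)
  obtain y where y: "dist (R 1 (R 1 y)) x < e / (2 * (K * S + 1))"
    using dense_range_R2[OF one, of "e / (2 * (K * S + 1))" x] e pos by auto
  define x' where "x' = R 1 (R 1 y)"
  obtain a b N where aN: "0 < a"
    "\<And>\<phi> k. bounded_by \<phi> k \<Longrightarrow> cmod (F (\<lambda>z. indicator (- rect a b N) z *\<^sub>R m z) \<phi> x') \<le> e / 2 * k"
    using tail_small[OF d x'_def, of "e / 2"] e by auto
  obtain v where v: "\<And>\<phi>. cdual J \<phi> \<Longrightarrow> \<phi> v = F (\<lambda>z. indicator (rect a b N) z *\<^sub>R m z) \<phi> x'"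
    using rect_representation[OF m aN(1)] by blast
  have "cmod (F m \<phi> x - \<phi> v) \<le> e * k" if b: "bounded_by \<phi> k" for \<phi> k
  proof -
    have \<phi>: "cdual J \<phi>" and k: "0 \<le> k" using b by (auto simp: bounded_by_def)
    have "F m \<phi> x = F m \<phi> (x - x') + F m \<phi> x'"
      using F_add[OF d b, of "x - x'" x'] by simp
    moreover have "F m \<phi> x' = F (\<lambda>z. indicator (rect a b N) z *\<^sub>R m z) \<phi> x' +
        F (\<lambda>z. indicator (- rect a b N) z *\<^sub>R m z) \<phi> x'"
      by (rule F_combine[OF d dominated_restrict[OF d rect_borel] dominated_restrict[OF d] b])
        (use rect_borel in \<open>auto simp: kern_def indicator_def\<close>)
    ultimately have "F m \<phi> x - \<phi> v = F m \<phi> (x - x') + F (\<lambda>z. indicator (- rect a b N) z *\<^sub>R m z) \<phi> x'"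
      by (simp add: v[OF \<phi>])
    also have "cmod \<dots> \<le> cmod (F m \<phi> (x - x')) + e / 2 * k"
      using norm_triangle_ineq aN(2)[OF b] by (rule order_trans[OF _ add_left_mono])
    also have "cmod (F m \<phi> (x - x')) \<le> e / 2 * k"
    proof -
      have "ennreal (cmod (F m \<phi> (x - x'))) \<le> ennreal (K * k * norm (x - x')) * ennreal S"
        using F_bound[OF d b, of "x - x'"] by (simp add: S(1))
      also have "\<dots> = ennreal (K * k * norm (x - x') * S)"
        using K_nonneg k S(2) by (simp add: ennreal_mult[symmetric])
      finally have "cmod (F m \<phi> (x - x')) \<le> K * k * norm (x - x') * S"
        using K_nonneg k S(2) by (simp add: ennreal_le_iff)
      also have "\<dots> = k * (K * S * norm (x - x'))" by (simp add: mult_ac)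
      also have "\<dots> \<le> k * (e / 2)"
      proof (rule mult_left_mono[OF _ k])
        have "K * S * norm (x - x') \<le> (K * S + 1) * norm (x - x')" by (intro mult_right_mono) auto
        also have "\<dots> \<le> (K * S + 1) * (e / (2 * (K * S + 1)))"
          using y pos by (intro mult_left_mono) (auto simp: x'_def dist_norm norm_minus_commute)
        also have "\<dots> = e / 2" using pos by (simp add: field_simps)
        finally show "K * S * norm (x - x') \<le> e / 2" .
      qed
      finally show ?thesis by (simp add: mult.commute)
    qed
    finally show ?thesis by simp
  qed
  then show thesis by (rule that)
qed

text \<open>The integral defining \<open>F m \<phi> x\<close> need not converge in norm, so \<open>v\<close> is found as a limit of the vectors
  of \<open>approximate_representation\<close>; this is what keeps it in the space instead of its bidual.\<close>

lemma representation:
  assumes d: "dominated m s" and m: "continuous_on RHP m"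
  shows "\<exists>v. \<forall>\<phi>. cdual J \<phi> \<longrightarrow> \<phi> v = F m \<phi> x"
proof -
  have "\<exists>v. \<forall>\<phi> k. bounded_by \<phi> k \<longrightarrow> cmod (F m \<phi> x - \<phi> v) \<le> 1 / real (Suc n) * k" for n
    using approximate_representation[OF d m, of "1 / real (Suc n)" x] by (metis of_nat_0_less_iff zero_less_Suc zero_less_divide_1_iff)
  then obtain v where v: "\<And>n \<phi> k. bounded_by \<phi> k \<Longrightarrow> cmod (F m \<phi> x - \<phi> (v n)) \<le> 1 / real (Suc n) * k"
    by metis
  \<comment> \<open>The errors are uniform over functionals of norm at most one, so the
    approximating vectors are close in norm and not merely weakly.\<close>
  have close: "norm (v n - v p) \<le> 1 / real (Suc n) + 1 / real (Suc p)" for n p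
  proof (rule cdual_norm_bound[OF cs])
    fix \<phi> assume \<phi>: "cdual J \<phi>" "\<And>y. cmod (\<phi> y) \<le> norm y"
    have "\<phi> (v n - v p) = (F m \<phi> x - \<phi> (v p)) - (F m \<phi> x - \<phi> (v n))"
      by (simp add: linear_diff[OF bounded_linear.linear[OF cdual_linear[OF \<phi>(1)]]])
    also have "cmod \<dots> \<le> cmod (F m \<phi> x - \<phi> (v p)) + cmod (F m \<phi> x - \<phi> (v n))"
      by (rule norm_triangle_ineq4)
    also have "\<dots> \<le> 1 / real (Suc p) * 1 + 1 / real (Suc n) * 1"
      by (intro add_mono v bounded_by_unit \<phi>)
    finally show "cmod (\<phi> (v n - v p)) \<le> 1 / real (Suc n) + 1 / real (Suc p)" by simp
  qed
  have "Cauchy v"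
  proof (rule metric_CauchyI)
    fix e :: real assume e: "0 < e"
    obtain M :: nat where M: "2 / e < real M" using reals_Archimedean2 by blast
    have "dist (v n) (v p) < e" if "M \<le> n" "M \<le> p" for n p
    proof -
      have *: "1 / real (Suc q) < e / 2" if "M \<le> q" for q
      proof -
        have "2 / e < real (Suc q)" using M that by simp
        then show ?thesis using e by (simp add: field_simps)
      qed
      show ?thesis using close[of n p] *[OF that(1)] *[OF that(2)] by (simp add: dist_norm)
    qed
    then show "\<exists>M. \<forall>m\<ge>M. \<forall>n\<ge>M. dist (v m) (v n) < e" by blast
  qed
  then obtain l where l: "v \<longlonglongrightarrow> l" using Cauchy_convergent convergent_def by blast
  have "\<phi> l = F m \<phi> x" if \<phi>: "cdual J \<phi>" for \<phi>
  proof -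
    obtain k where k: "bounded_by \<phi> k" using ex_bounded_by[OF \<phi>] by blast
    have "(\<lambda>n. \<phi> (v n)) \<longlonglongrightarrow> \<phi> l"
      by (rule bounded_linear.tendsto[OF cdual_linear[OF \<phi>] l])
    moreover have "(\<lambda>n. F m \<phi> x - \<phi> (v n)) \<longlonglongrightarrow> 0"
    proof (rule Lim_null_comparison)
      show "\<forall>\<^sub>F n in sequentially. norm (F m \<phi> x - \<phi> (v n)) \<le> 1 / real (Suc n) * k"
        by (intro always_eventually allI v k)
      have "(\<lambda>n. 1 / real (Suc n) * k) \<longlonglongrightarrow> 0 * k"
        by (intro tendsto_mult_right LIMSEQ_Suc[OF lim_1_over_n])
      then show "(\<lambda>n. 1 / real (Suc n) * k) \<longlonglongrightarrow> 0" by simp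
    qed
    then have "(\<lambda>n. F m \<phi> x - (F m \<phi> x - \<phi> (v n))) \<longlonglongrightarrow> F m \<phi> x - 0"
      by (intro tendsto_diff tendsto_const)
    then have "(\<lambda>n. \<phi> (v n)) \<longlonglongrightarrow> F m \<phi> x" by simp
    ultimately show ?thesis by (rule LIMSEQ_unique)
  qed
  then show ?thesis by blast
qed

end

section \<open>From functions of finite seminorm to operators\<close>

lemma dominated_deriv:
  assumes u: "u holomorphic_on RHP" and C: "\<And>z. z \<in> RHP \<Longrightarrow> cmod (u z) \<le> C" and fin: "B_seminorm u < top"
  obtains s where "dominated (deriv u) s" "mass s = B_seminorm u"
proof -
  \<comment> \<open>The exact line supremum, real-valued because Cauchy's inequality bounds it by 2
    C / \<alpha>; with this choice the mass equals the seminorm.\<close>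
  define s where "s \<alpha> = enn2real (vsup UNIV (deriv u) \<alpha> * indicator {0<..} \<alpha>)" for \<alpha>
  have cont: "continuous_on RHP (deriv u)"
    by (intro holomorphic_on_imp_continuous_on holomorphic_deriv u open_RHP)
  have s: "ennreal (s \<alpha>) = vsup UNIV (deriv u) \<alpha>" if "0 < \<alpha>" for \<alpha>
  proof -
    have "vsup UNIV (deriv u) \<alpha> \<le> ennreal (2 * C / \<alpha>)"
      using bounded_holomorphic_deriv_bound[OF u C, of "Complex \<alpha> _"] that
      by (intro vsup_least ennreal_leI) auto
    then show ?thesis using that by (simp add: s_def le_less_trans)
  qed
  have int: "mass s = B_seminorm u"
    unfolding B_seminorm_def
    by (intro nn_integral_cong) (auto simp: s vsup_def indicator_def)
  have "dominated (deriv u) s"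
    unfolding dominated_def
  proof (intro conjI allI impI)
    show "(\<lambda>z. indicator RHP z *\<^sub>R deriv u z) \<in> borel_measurable borel"
      by (rule borel_measurable_continuous_on_indicator[OF _ cont]) (simp add: open_RHP)
    show "s \<in> borel_measurable borel"
      unfolding s_def using measurable_vsup[OF cont, of UNIV] by measurable
    fix \<alpha> \<beta> :: real assume \<alpha>: "0 < \<alpha>"
    have "ennreal (cmod (deriv u (Complex \<alpha> \<beta>))) \<le> ennreal (s \<alpha>)"
      unfolding s[OF \<alpha>] by (rule vsup_upper) simp
    then show "cmod (deriv u (Complex \<alpha> \<beta>)) \<le> s \<alpha>"
      by (subst (asm) ennreal_le_iff) (auto simp: s_def)
  qed (use fin int in \<open>auto simp: s_def\<close>)
  then show thesis using int that by blast
qed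

context H1_primitive_vanishing
begin

text \<open>By the product rule the variation of u is multiplied by the bound G of g, and that of g
  by the bound C of u; at infinity the product vanishes because g does and u is bounded.\<close>

lemma product_in_B0:
  assumes u: "u holomorphic_on RHP" and C: "0 \<le> C" "\<And>z. z \<in> RHP \<Longrightarrow> cmod (u z) \<le> C" and fin: "B_seminorm u < top"
  shows "(\<lambda>z. u z * g z) holomorphic_on RHP"
    and "\<And>z. z \<in> RHP \<Longrightarrow> cmod (u z * g z) \<le> C * G"
    and "B_seminorm (\<lambda>z. u z * g z) < top"
    and "at_inf_val (\<lambda>z. u z * g z) = 0"
proof -
  show "(\<lambda>z. u z * g z) holomorphic_on RHP"
    by (intro holomorphic_intros u holg)
  show "cmod (u z * g z) \<le> C * G" if "z \<in> RHP" for z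
    unfolding norm_mult using C g_bound that by (intro mult_mono) auto
  have d: "deriv (\<lambda>z. u z * g z) z = deriv u z * g z + u z * deriv g z" if "z \<in> RHP" for z
    by (rule DERIV_imp_deriv)
      (auto intro!: derivative_eq_intros holomorphic_derivI[OF u open_RHP that] holomorphic_derivI[OF holg open_RHP that])
  have cont: "continuous_on RHP (deriv u)"
    by (intro holomorphic_on_imp_continuous_on holomorphic_deriv u open_RHP)
  have "B_seminorm (\<lambda>z. u z * g z) \<le> (\<integral>\<^sup>+x. ennreal G * (vsup UNIV (deriv u) x * indicator {0<..} x) +
      ennreal C * (vsup UNIV (deriv g) x * indicator {0<..} x) \<partial>lborel)"
    unfolding B_seminorm_def
  proof (intro nn_integral_mono)
    fix x :: real
    have "vsup UNIV (deriv (\<lambda>z. u z * g z)) x \<le> ennreal G * vsup UNIV (deriv u) x + ennreal C * vsup UNIV (deriv g) x"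
      if x: "0 < x"
    proof (rule vsup_least)
      fix y
      have z: "Complex x y \<in> RHP" using x by simp
      have "cmod (deriv (\<lambda>z. u z * g z) (Complex x y)) \<le>
          cmod (deriv u (Complex x y)) * cmod (g (Complex x y)) + cmod (u (Complex x y)) * cmod (deriv g (Complex x y))"
        unfolding d[OF z] by (metis norm_mult norm_triangle_ineq)
      also have "\<dots> \<le> G * cmod (deriv u (Complex x y)) + C * cmod (deriv g (Complex x y))"
        using g_bound[OF z] C(2)[OF z] by (subst mult.commute) (intro add_mono mult_right_mono; simp)
      finally have "ennreal (cmod (deriv (\<lambda>z. u z * g z) (Complex x y))) \<le>
          ennreal (G * cmod (deriv u (Complex x y)) + C * cmod (deriv g (Complex x y)))"
        by (rule ennreal_leI)
      also have "\<dots> = ennreal G * ennreal (cmod (deriv u (Complex x y))) + ennreal C * ennreal (cmod (deriv g (Complex x y)))"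
        using G_nonneg C by (simp add: ennreal_mult)
      also have "\<dots> \<le> ennreal G * vsup UNIV (deriv u) x + ennreal C * vsup UNIV (deriv g) x"
        by (intro add_mono mult_left_mono vsup_upper) auto
      finally show "ennreal (cmod (deriv (\<lambda>z. u z * g z) (Complex x y))) \<le>
        ennreal G * vsup UNIV (deriv u) x + ennreal C * vsup UNIV (deriv g) x" .
    qed
    then show "(SUP y. ennreal (cmod (deriv (\<lambda>z. u z * g z) (Complex x y)))) * indicator {0<..} x \<le>
      ennreal G * (vsup UNIV (deriv u) x * indicator {0<..} x) + ennreal C * (vsup UNIV (deriv g) x * indicator {0<..} x)"
      by (cases "0 < x") (auto simp: vsup_def)
  qed
  also have "\<dots> = ennreal G * vint (deriv u) +
      ennreal C * vint (deriv g)"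
    using measurable_vsup[OF cont, of UNIV] measurable_vsup[OF cont_deriv, of UNIV]
    by (simp add: nn_integral_add nn_integral_cmult)
  also have "\<dots> < top"
    using fin vint_bound unfolding B_seminorm_def vsup_def[of UNIV "deriv u"]
    by (auto simp: ennreal_mult_less_top le_less_trans)
  finally show "B_seminorm (\<lambda>z. u z * g z) < top" .
  have "((\<lambda>z. u z * g z) \<longlongrightarrow> 0) (filtercomap Re at_top)"
  proof (rule Lim_null_comparison)
    show "\<forall>\<^sub>F z in filtercomap Re at_top. norm (u z * g z) \<le> C * cmod (g z)"
      unfolding eventually_filtercomap_at_top_linorder norm_mult
      by (intro exI[of _ 1] allI impI mult_right_mono C) (auto simp: RHP_def)
    show "((\<lambda>z. C * cmod (g z)) \<longlongrightarrow> 0) (filtercomap Re at_top)"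
      using tendsto_mult_right_zero[OF tendsto_norm_zero[OF vanish]] .
  qed
  \<comment> \<open>A limit determines the value of \<open>Lim\<close> only along a nontrivial
    filter; surjectivity of Re makes this filter nontrivial.\<close>
  moreover have "filtercomap Re at_top \<noteq> bot"
    by (rule filtercomap_neq_bot_surj[OF _ surjI[of _ complex_of_real]]) auto
  ultimately show "at_inf_val (\<lambda>z. u z * g z) = 0"
    unfolding at_inf_val_def by (intro tendsto_Lim) auto
qed

end

context GSF_operator
begin

text \<open>The definite description in \<open>B_calc\<close> is resolved by assembling an operator
  from the representing vectors; functionals separate points, which gives its linearity from that of
  F and its uniqueness.\<close>

lemma B_calc_spec:
  assumes u: "u holomorphic_on RHP" and C: "\<And>z. z \<in> RHP \<Longrightarrow> cmod (u z) \<le> C" and fin: "B_seminorm u < top"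
    and inf: "at_inf_val u = 0"
  shows "cbounded J (B_calc J D A u)"
    and "\<And>\<phi> x. cdual J \<phi> \<Longrightarrow> \<phi> (B_calc J D A u x) = - complex_of_real (2 / pi) * F (deriv u) \<phi> x"
proof -
  obtain s where d: "dominated (deriv u) s" and s: "mass s = B_seminorm u"
    using dominated_deriv[OF u C fin] by blast
  obtain S where S: "B_seminorm u = ennreal S" "0 \<le> S"
    using fin by (cases "B_seminorm u") auto
  have cont: "continuous_on RHP (deriv u)"
    by (intro holomorphic_on_imp_continuous_on holomorphic_deriv u open_RHP)
  obtain V where V: "\<And>x \<phi>. cdual J \<phi> \<Longrightarrow> \<phi> (V x) = F (deriv u) \<phi> x"
    using representation[OF d cont] by metis
  have Vadd: "V (x + y) = V x + V y" for x y
  proof (rule cdual_eqI)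
    fix \<phi> assume \<phi>: "cdual J \<phi>"
    obtain k where "bounded_by \<phi> k" using ex_bounded_by[OF \<phi>] by blast
    then show "\<phi> (V (x + y)) = \<phi> (V x + V y)"
      using F_add[OF d] by (simp add: V[OF \<phi>] linear_add[OF bounded_linear.linear[OF cdual_linear[OF \<phi>]]])
  qed
  have Vc: "V (c \<cdot> x) = c \<cdot> V x" for c x
    by (rule cdual_eqI) (simp add: V F_cscale cdual_cscale)
  have Vbd: "norm (V x) \<le> K * S * norm x" for x
  proof (rule cdual_norm_bound[OF cs])
    fix \<phi> assume \<phi>: "cdual J \<phi>" "\<And>y. cmod (\<phi> y) \<le> norm y"
    have "ennreal (cmod (\<phi> (V x))) \<le> ennreal (K * 1 * norm x) * ennreal S"
      using F_bound[OF d bounded_by_unit[OF \<phi>], of x] unfolding V[OF \<phi>(1)] s S(1) .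
    then show "cmod (\<phi> (V x)) \<le> K * S * norm x"
      using K_nonneg S(2) by (simp add: ennreal_mult[symmetric] mult_ac)
  qed
  define T where "T x = (- (2 / pi)) *\<^sub>R V x" for x
  have sc: "of_real r \<cdot> x = r *\<^sub>R x" for r x by (simp add: cscale_def)
  have blV: "bounded_linear V"
  proof (rule bounded_linear_intro[where K = "K * S"])
    show "V (r *\<^sub>R x) = r *\<^sub>R V x" for r x using Vc[of "of_real r" x] by (simp add: sc)
    show "norm (V x) \<le> norm x * (K * S)" for x using Vbd[of x] by (simp add: mult_ac)
  qed (rule Vadd)
  have T: "cbounded J T"
    unfolding cbounded_def T_def using Vc[of \<i>]
    by (auto simp only: cscale_i J_simps bounded_linear_compose[OF bounded_linear_scaleR_right blV])
  have FT: "\<phi> (T x) = - complex_of_real (2 / pi) * F (deriv u) \<phi> x" if \<phi>: "cdual J \<phi>" for \<phi> x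
    unfolding T_def linear_scale[OF bounded_linear.linear[OF cdual_linear[OF \<phi>]]] V[OF \<phi>]
      scaleR_conv_of_real of_real_minus by (rule refl)
  have "B_calc J D A u = T"
    unfolding B_calc_def
  proof (rule the_equality)
    let ?rhs = "\<lambda>\<phi> x. at_inf_val u * \<phi> x - complex_of_real (2 / pi) *
        (LINT \<alpha>:{0<..}|lborel. complex_of_real \<alpha> *
          (LINT \<beta>|lborel. \<phi> (res_plus2 J D A (Complex \<alpha> (- \<beta>)) x) * deriv u (Complex \<alpha> \<beta>)))"
    have eq: "?rhs \<phi> x = - complex_of_real (2 / pi) * F (deriv u) \<phi> x" for \<phi> x
      unfolding inf F_def kern_def res2_def res_plus2_eq by simp
    show "cbounded J T \<and> (\<forall>x \<phi>. cdual J \<phi> \<longrightarrow> \<phi> (T x) = ?rhs \<phi> x)"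
      unfolding eq using T FT by blast
    fix T' assume T': "cbounded J T' \<and> (\<forall>x \<phi>. cdual J \<phi> \<longrightarrow> \<phi> (T' x) = ?rhs \<phi> x)"
    show "T' = T"
    proof
      fix x
      show "T' x = T x"
      proof (rule cdual_eqI)
        fix \<phi> assume \<phi>: "cdual J \<phi>"
        then show "\<phi> (T' x) = \<phi> (T x)"
          using T' unfolding eq FT[OF \<phi>] by blast
      qed
    qed
  qed
  then show "cbounded J (B_calc J D A u)"
    and "\<And>\<phi> x. cdual J \<phi> \<Longrightarrow> \<phi> (B_calc J D A u x) = - complex_of_real (2 / pi) * F (deriv u) \<phi> x"
    using T FT by auto
qed

text \<open>F is additive in the symbol, so the difference of the operators is governed by F at (u -
  v)', whose bound involves only the seminorm of u - v.\<close>

lemma B_calc_difference: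
  assumes u: "u holomorphic_on RHP" "\<And>z. z \<in> RHP \<Longrightarrow> cmod (u z) \<le> C" "B_seminorm u < top" "at_inf_val u = 0"
    and v: "v holomorphic_on RHP" "\<And>z. z \<in> RHP \<Longrightarrow> cmod (v z) \<le> C" "B_seminorm v < top" "at_inf_val v = 0"
    and fin: "B_seminorm (\<lambda>z. u z - v z) < top"
  shows "onorm (\<lambda>x. B_calc J D A u x - B_calc J D A v x) \<le> 2 / pi * K * enn2real (B_seminorm (\<lambda>z. u z - v z))"
proof (rule onorm_bound)
  show "0 \<le> 2 / pi * K * enn2real (B_seminorm (\<lambda>z. u z - v z))"
    using K_nonneg by simp
  fix x
  have w: "(\<lambda>z. u z - v z) holomorphic_on RHP" by (intro holomorphic_intros u v)
  have wC: "cmod (u z - v z) \<le> C + C" if "z \<in> RHP" for z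
    using norm_triangle_ineq4[of "u z" "v z"] u(2)[OF that] v(2)[OF that] by linarith
  obtain su where du: "dominated (deriv u) su" using dominated_deriv[OF u(1-3)] by blast
  obtain sv where dv: "dominated (deriv v) sv" using dominated_deriv[OF v(1-3)] by blast
  obtain sw where dw: "dominated (deriv (\<lambda>z. u z - v z)) sw"
    and sw: "mass sw = B_seminorm (\<lambda>z. u z - v z)"
    using dominated_deriv[OF w wC fin] by blast
  show "norm (B_calc J D A u x - B_calc J D A v x) \<le>
      2 / pi * K * enn2real (B_seminorm (\<lambda>z. u z - v z)) * norm x"
  proof (rule cdual_norm_bound[OF cs])
    fix \<phi> assume \<phi>: "cdual J \<phi>" "\<And>y. cmod (\<phi> y) \<le> norm y"
    note b = bounded_by_unit[OF \<phi>]
    have "F (deriv u) \<phi> x = F (deriv (\<lambda>z. u z - v z)) \<phi> x + F (deriv v) \<phi> x"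
    proof (rule F_combine[OF du dw dv b])
      fix \<alpha> \<beta> :: real assume "0 < \<alpha>"
      then have z: "Complex \<alpha> \<beta> \<in> RHP" by simp
      have "deriv (\<lambda>z. u z - v z) (Complex \<alpha> \<beta>) = deriv u (Complex \<alpha> \<beta>) - deriv v (Complex \<alpha> \<beta>)"
        by (rule DERIV_imp_deriv[OF DERIV_diff[OF holomorphic_derivI[OF u(1) open_RHP z] holomorphic_derivI[OF v(1) open_RHP z]]])
      then show "kern (deriv u) \<phi> x \<alpha> \<beta> = kern (deriv (\<lambda>z. u z - v z)) \<phi> x \<alpha> \<beta> + kern (deriv v) \<phi> x \<alpha> \<beta>"
        by (simp add: kern_def right_diff_distrib)
    qed
    then have "\<phi> (B_calc J D A u x - B_calc J D A v x) = - complex_of_real (2 / pi) * F (deriv (\<lambda>z. u z - v z)) \<phi> x"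
      by (simp add: linear_diff[OF bounded_linear.linear[OF cdual_linear[OF \<phi>(1)]]] B_calc_spec(2)[OF u \<phi>(1)]
          B_calc_spec(2)[OF v \<phi>(1)] distrib_left)
    then have n: "cmod (\<phi> (B_calc J D A u x - B_calc J D A v x)) = 2 / pi * cmod (F (deriv (\<lambda>z. u z - v z)) \<phi> x)"
      by (simp add: norm_mult norm_divide)
    have "ennreal (cmod (F (deriv (\<lambda>z. u z - v z)) \<phi> x)) \<le> ennreal (K * 1 * norm x) * B_seminorm (\<lambda>z. u z - v z)"
      using F_bound[OF dw b, of x] unfolding sw .
    also have "\<dots> = ennreal (K * norm x * enn2real (B_seminorm (\<lambda>z. u z - v z)))"
      using fin K_nonneg by (simp add: ennreal_mult)
    finally have "cmod (F (deriv (\<lambda>z. u z - v z)) \<phi> x) \<le> K * norm x * enn2real (B_seminorm (\<lambda>z. u z - v z))"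
      using K_nonneg by (subst (asm) ennreal_le_iff) auto
    then have "2 / pi * cmod (F (deriv (\<lambda>z. u z - v z)) \<phi> x) \<le> 2 / pi * (K * norm x * enn2real (B_seminorm (\<lambda>z. u z - v z)))"
      by (intro mult_left_mono) auto
    then show "cmod (\<phi> (B_calc J D A u x - B_calc J D A v x)) \<le>
        2 / pi * K * enn2real (B_seminorm (\<lambda>z. u z - v z)) * norm x"
      unfolding n by (simp add: mult_ac)
  qed
qed

end


theorem theorem4p13:
  fixes J :: "'a::banach \<Rightarrow> 'a" and D :: "'a set" and A :: "'a \<Rightarrow> 'a"
    and f :: "nat \<Rightarrow> complex \<Rightarrow> complex" and g :: "complex \<Rightarrow> complex"
  assumes cs: "complex_structure J"
    and dd: "densely_defined J D A"
    and spec: "op_spectrum J D A \<subseteq> {z. 0 \<le> Re z}"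
    and resbd: "\<And>x \<phi>. cdual J \<phi> \<Longrightarrow>
       (SUP \<alpha>\<in>{0<..}. ennreal \<alpha> *
          (\<integral>\<^sup>+ \<beta>. ennreal (cmod (\<phi> (res_plus2 J D A (Complex \<alpha> \<beta>) x))) \<partial>lborel)) < top"
    and fB: "\<And>n. n \<ge> 1 \<Longrightarrow> f n \<in> B_space"
    and fbd: "(SUP n\<in>{1..}. B_norm (f n)) < top"
    and flim: "\<And>z. z \<in> RHP \<Longrightarrow> (\<lambda>n. f n z) \<longlonglongrightarrow> f 0 z"
    and unif: "\<And>r \<epsilon>. r > 0 \<Longrightarrow> \<epsilon> > 0 \<Longrightarrow> \<exists>\<delta>0>0. \<forall>\<delta>. 0 < \<delta> \<and> \<delta> < \<delta>0 \<longrightarrow> (\<forall>n\<ge>1.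
         (\<integral>\<^sup>+ \<alpha>\<in>{0<..<\<delta>}. (SUP \<beta>\<in>{-r..r}. ennreal (cmod (deriv (f n) (Complex \<alpha> \<beta>)))) \<partial>lborel)
           < ennreal \<epsilon>)"
    and gH: "g holomorphic_on RHP"
    and g'H1: "deriv g \<in> H1_space"
    and ginf: "(g \<longlongrightarrow> 0) (filtercomap Re at_top)"
  shows "f 0 \<in> B_space \<and> (\<forall>n. (\<lambda>z. f n z * g z) \<in> B0_space) \<and>
    (\<lambda>n. onorm (\<lambda>x. B_calc J D A (\<lambda>z. f n z * g z) x - B_calc J D A (\<lambda>z. f 0 z * g z) x))
      \<longlonglongrightarrow> 0"
proof -
  interpret GSF_operator J D A
    by unfold_locales (use cs dd spec resbd in auto)
  have h1: "(SUP x\<in>{0<..}. \<integral>\<^sup>+y. ennreal (cmod (deriv g (Complex x y))) \<partial>lborel) < top"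
    using g'H1 by (simp add: H1_space_def)
  then obtain M where M: "(SUP x\<in>{0<..}. \<integral>\<^sup>+y. ennreal (cmod (deriv g (Complex x y))) \<partial>lborel) = ennreal M" "0 \<le> M"
    by (cases "SUP x\<in>{0<..}. \<integral>\<^sup>+y. ennreal (cmod (deriv g (Complex x y))) \<partial>lborel") auto
  interpret g: H1_primitive_vanishing g M
  proof unfold_locales
    fix x :: real assume "0 < x"
    then show "(\<integral>\<^sup>+y. ennreal (cmod (deriv g (Complex x y))) \<partial>lborel) \<le> ennreal M"
      unfolding M(1)[symmetric] by (intro SUP_upper) auto
  qed (use gH M ginf in auto)
  define S where "S = (SUP n\<in>{1..}. B_norm (f n))"
  have "S < top" using fbd by (simp only: S_def)
  then obtain C where C: "S = ennreal C" "0 \<le> C" by (cases S) auto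
  have Bn: "B_norm (f n) \<le> ennreal C" if "1 \<le> n" for n
    unfolding C(1)[symmetric] S_def using that by (intro SUP_upper) auto
  have fC: "cmod (f n z) \<le> C" if "1 \<le> n" "z \<in> RHP" for n z
  proof -
    have "ennreal (cmod (f n z)) \<le> (SUP z\<in>RHP. ennreal (cmod (f n z)))"
      by (rule SUP_upper[OF that(2)])
    also have "\<dots> \<le> B_norm (f n)"
      unfolding B_norm_def by (rule add_increasing2) auto
    also have "\<dots> \<le> ennreal C" by (rule Bn[OF that(1)])
    finally show ?thesis using C(2) by simp
  qed
  have fS: "B_seminorm (f n) \<le> ennreal C" if "1 \<le> n" for n
  proof -
    have "B_seminorm (f n) \<le> B_norm (f n)"
      unfolding B_norm_def by (rule add_increasing) auto
    then show ?thesis using Bn[OF that] by (rule order_trans)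
  qed
  have fH: "f n holomorphic_on RHP" if "1 \<le> n" for n
    using fB[OF that] by (simp add: B_space_def)
  \<comment> \<open>Index 0 holds the limit, so the sequence proper starts at 1 and is shifted by
    \<open>Suc\<close>.\<close>
  interpret conv: B_convergence g M "\<lambda>n. f (Suc n)" "f 0" C
  proof unfold_locales
    show "vint (deriv (f (Suc n))) \<le> ennreal C" for n
      using fS[of "Suc n"] by (simp add: B_seminorm_def vsup_def)
    show "(\<lambda>n. f (Suc n) z) \<longlonglongrightarrow> f 0 z" if "z \<in> RHP" for z
      by (rule LIMSEQ_Suc[OF flim[OF that]])
    fix r e :: real assume "0 < r" "0 < e"
    then obtain \<delta>0 where \<delta>0: "0 < \<delta>0" "\<And>\<delta> n. 0 < \<delta> \<Longrightarrow> \<delta> < \<delta>0 \<Longrightarrow> 1 \<le> n \<Longrightarrow>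
        (\<integral>\<^sup>+\<alpha>\<in>{0<..<\<delta>}. (SUP \<beta>\<in>{-r..r}. ennreal (cmod (deriv (f n) (Complex \<alpha> \<beta>)))) \<partial>lborel) < ennreal e"
      using unif[OF \<open>0 < r\<close> \<open>0 < e\<close>] by meson
    \<comment> \<open>Half of \<open>\<delta>0\<close>, because the hypothesis speaks of \<delta>
      strictly below it.\<close>
    have "(\<integral>\<^sup>+x\<in>{0<..<\<delta>0 / 2}. vsup {-r..r} (deriv (f (Suc n))) x \<partial>lborel) \<le> ennreal e" for n
      unfolding vsup_def by (rule less_imp_le[OF \<delta>0(2)]) (use \<delta>0(1) in auto)
    then show "\<exists>\<delta>>0. \<forall>n. (\<integral>\<^sup>+x\<in>{0<..<\<delta>}. vsup {-r..r} (deriv (f (Suc n))) x \<partial>lborel) \<le> ennreal e"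
      using \<delta>0(1) by (intro exI[of _ "\<delta>0 / 2"]) auto
  qed (use fH fC C in auto)
  have S0: "B_seminorm (f 0) < top"
    using conv.var0 by (simp add: B_seminorm_def vsup_def le_less_trans)
  \<comment> \<open>Index 0 is included: the limit has inherited the bound and the variation, so the
    operators are determined for every n.\<close>
  have all: "f n holomorphic_on RHP" "\<And>z. z \<in> RHP \<Longrightarrow> cmod (f n z) \<le> C" "B_seminorm (f n) < top" for n
    using fH[of n] fC[of n] fS[of n] conv.holf0 conv.f0C S0
    by (cases "n = 0"; auto simp: le_less_trans Suc_le_eq)+
  note P = g.product_in_B0[OF all(1) C(2) all(2) all(3)]
  let ?d = "\<lambda>n. B_seminorm (\<lambda>z. f n z * g z - f 0 z * g z)"
  let ?E = "\<lambda>n x. B_calc J D A (\<lambda>z. f n z * g z) x - B_calc J D A (\<lambda>z. f 0 z * g z) x"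
  have "(\<lambda>n. ?d (Suc n)) \<longlonglongrightarrow> 0" by (rule conv.product_var_tendsto)
  then have d0: "?d \<longlonglongrightarrow> 0" by (rule LIMSEQ_imp_Suc)
  have "(\<lambda>n. onorm (?E n)) \<longlonglongrightarrow> 0"
  proof (rule tendsto_sandwich[OF _ _ tendsto_const])
    have "bounded_linear (?E n)" for n
      using B_calc_spec(1)[OF P] by (intro bounded_linear_sub) (auto simp: cbounded_def)
    then show "\<forall>\<^sub>F n in sequentially. 0 \<le> onorm (?E n)"
      by (intro always_eventually allI onorm_pos_le)
    \<comment> \<open>\<open>B_calc_difference\<close> asks for a finite seminorm of the difference,
      which its convergence to 0 provides for all large n.\<close>
    have "\<forall>\<^sub>F n in sequentially. ?d n < top"
      using d0 by (rule order_tendstoD) simp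
    then show "\<forall>\<^sub>F n in sequentially. onorm (?E n) \<le> 2 / pi * K * enn2real (?d n)"
      by eventually_elim (rule B_calc_difference[OF P P])
    have "(\<lambda>n. enn2real (?d n)) \<longlonglongrightarrow> 0"
      using d0 by (intro tendsto_enn2real) auto
    then show "(\<lambda>n. 2 / pi * K * enn2real (?d n)) \<longlonglongrightarrow> 0"
      by (rule tendsto_mult_right_zero)
  qed
  then show ?thesis
    using conv.holf0 S0 P by (auto simp: B_space_def B0_space_def)
qed

end
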